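(* Every infinite-dimensional closed commutative ${}^*$-subalgebra of $\mathcal{L}(s',s)$ is isomorphic as a Fr\'echet ${}^*$-algebra to the algebra $\lambda^\infty(\max_{j\in\mathcal{N}_k}|f_j|_q)$ for some orthonormal sequence $(f_k)_{k\in\mathbb{N}}\subset s$ and some family $\{\mathcal{N}_k\}_{k\in\mathbb{N}}$ of finite nonempty pairwise disjoint sets of natural numbers. In fact, if $E$ is an infinite-dimensional closed commutative ${}^*$-subalgebra of $\mathcal{L}(s',s)$ and $\big(\sum_{j\in\mathcal{N}_k}\langle\cdot,f_j\rangle f_j\big)_{k\in\mathbb{N}}$ is its canonical Schauder basis (with such $(f_j)_{j\in\mathbb{N}}$ and $\{\mathcal{N}_k\}_{k\in\mathbb{N}}$), then $$E\cong\lambda^\infty\Big(\max_{j\in\mathcal{N}_k}|f_j|_q\Big)$$ as Fr\'echet ${}^*$-algebras and the isomorphism is given by $\sum_{j\in\mathcal{N}_k}\langle\cdot,f_j\rangle f_j\mapsto e_k$ for $k\in\mathbb{N}$. Conversely, if $(f_k)_{k\in\mathbb{N}}\subset s$ is an orthonormal sequence and $\{\mathcal{N}_k\}_{k\in\mathbb{N}}$ is a family of finite nonempty pairwise disjoint sets of natural numbers, then $\lambda^\infty(\max_{j\in\mathcal{N}_k}|f_j|_q)$ is isomorphic as a Fr\'echet ${}^*$-algebra to some infinite-dimensional closed commutative ${}^*$-subalgebra of $\mathcal{L}(s',s)$.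
   Context: $\mathbb{N}=\{1,2,\dots\}$, $\mathbb{N}_0=\mathbb{N}\cup\{0\}$; all spaces are over $\mathbb{C}$. A Fr\'echet ${}^*$-algebra is a Fr\'echet space (complete metrizable locally convex space) that is an algebra with continuous multiplication and continuous involution; an isomorphism of Fr\'echet ${}^*$-algebras is an algebra ${}^*$-isomorphism that is also a homeomorphism. The space $s$: $s=\{\xi=(\xi_j)_{j\in\mathbb{N}}\in\mathbb{C}^{\mathbb{N}}:|\xi|_q:=(\sum_{j=1}^\infty|\xi_j|^2j^{2q})^{1/2}<\infty\text{ for all }q\in\mathbb{N}_0\}$, with the topology of the norms $(|\cdot|_q)_{q\in\mathbb{N}_0}$. Its strong dual is identified with $s'=\{\xi\in\mathbb{C}^{\mathbb{N}}:|\xi|_q':=(\sum_{j=1}^\infty|\xi_j|^2j^{-2q})^{1/2}<\infty\text{ for some }q\in\mathbb{N}_0\}$ (with inductive limit topology) via $\langle\xi,\eta\rangle=\sum_j\xi_j\overline{\eta_j}$, which is defined on $s\times s'\cup s'\times s$ and on $\ell_2\times\ell_2$. Orthonormality is meant in $\ell_2$. The algebra $\mathcal{L}(s',s)$: all continuous linear operators $s'\to s$, with the topology of uniform convergence on bounded sets of $s'$, given by the norms $\|x\|_q:=\sup_{|\xi|_q'\leq1}|x\xi|_q$, $q\in\mathbb{N}_0$. Since $s\subset\ell_2\subset s'$ continuously and densely, each $x\in\mathcal{L}(s',s)$ is identified with the bounded operator on $\ell_2$ it induces; multiplication is composition and the involution is the Hilbert space adjoint. With these operations $\mathcal{L}(s',s)$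 is a Fr\'echet ${}^*$-algebra. Projections are orthogonal (self-adjoint idempotent) operators on $\ell_2$. A projection belongs to $\mathcal{L}(s',s)$ iff it has the form $\sum_{k\in I}\langle\cdot,f_k\rangle f_k$ with $I$ finite and $(f_k)_{k\in I}\subset s$ orthonormal. For an infinite-dimensional closed commutative ${}^*$-subalgebra $E$ of $\mathcal{L}(s',s)$, the nonzero minimal projections of $E$ (nonzero projections $P\in E$ such that no nonzero projection $Q\in E$, $Q\neq P$, satisfies $QP=Q$) are pairwise orthogonal and form a Schauder basis of $E$, called the canonical Schauder basis of $E$. For a matrix $(a_{k,q})_{k\in\mathbb{N},q\in\mathbb{N}_0}$ of non-negative numbers, non-decreasing in $q$ and with, for each $k$, some $a_{k,q}>0$, $\lambda^\infty(a_{k,q}):=\{\xi\in\mathbb{C}^{\mathbb{N}}:|\xi|_{\infty,q}:=\sup_{k}|\xi_k|a_{k,q}<\infty\text{ for all }q\in\mathbb{N}_0\}$ with the topology of the seminorms $|\cdot|_{\infty,q}$ and with pointwise multiplication and complex conjugation (a Fr\'echet ${}^*$-algebra when all $a_{k,q}\geq1$, as is the case here). $\lambda^\infty(\max_{j\in\mathcal{N}_k}|f_j|_q)$ is this algebra for $a_{k,q}=\max_{j\in\mathcal{N}_k}|f_j|_q$. $e_k$ is the sequence with $k$-th coordinate $1$ and all others $0$. *)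

theory Defs
  imports "HOL-Analysis.Analysis" "HOL-Library.Function_Algebras"
begin

text \<open>
  Sequences are functions \<open>nat \<Rightarrow> complex\<close>, indexed from 0: the entry at \<open>j\<close> is the
  mathematical \<open>(j+1)\<close>-st coordinate, so the weight at \<open>j\<close> is \<open>real (Suc j)\<close>.
  Addition, zero and pointwise multiplication of functions are the class operations of
  \<open>HOL-Library.Function_Algebras\<close>.
\<close>

subsection \<open>Topological star-algebras on subsets of a type\<close>

definition seminorm_topology ::
    "'a::ab_group_add set \<Rightarrow> ('a \<Rightarrow> real) set \<Rightarrow> 'a topology" where
  "seminorm_topology X P =
     topology_generated_by {{y \<in> X. p (y - x) < e} | p x e. p \<in> P \<and> x \<in> X \<and> 0 < e}"

record 'a star_alg =
  carr :: "'a set"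
  scal :: "complex \<Rightarrow> 'a \<Rightarrow> 'a"
  mul :: "'a \<Rightarrow> 'a \<Rightarrow> 'a"
  involution :: "'a \<Rightarrow> 'a"
  topol :: "'a topology"

definition closed_star_subalgebra :: "('a::ab_group_add) star_alg \<Rightarrow> 'a set \<Rightarrow> bool" where
  "closed_star_subalgebra A E \<longleftrightarrow>
     E \<subseteq> carr A \<and> 0 \<in> E \<and>
     (\<forall>x\<in>E. \<forall>y\<in>E. x + y \<in> E \<and> mul A x y \<in> E) \<and>
     (\<forall>c. \<forall>x\<in>E. scal A c x \<in> E) \<and>
     (\<forall>x\<in>E. involution A x \<in> E) \<and>
     closedin (topol A) E"

definition commutative_in :: "'a star_alg \<Rightarrow> 'a set \<Rightarrow> bool" where
  "commutative_in A E \<longleftrightarrow> (\<forall>x\<in>E. \<forall>y\<in>E. mul A x y = mul A y x)"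

definition infinite_dimensional_in :: "('a::ab_group_add) star_alg \<Rightarrow> 'a set \<Rightarrow> bool" where
  "infinite_dimensional_in A E \<longleftrightarrow>
     \<not> (\<exists>B. finite B \<and> B \<subseteq> E \<and> E \<subseteq> module.span (scal A) B)"

definition inf_dim_closed_comm_star_subalgebra ::
    "('a::ab_group_add) star_alg \<Rightarrow> 'a set \<Rightarrow> bool" where
  "inf_dim_closed_comm_star_subalgebra A E \<longleftrightarrow>
     closed_star_subalgebra A E \<and> commutative_in A E \<and> infinite_dimensional_in A E"

definition subalg :: "'a star_alg \<Rightarrow> 'a set \<Rightarrow> 'a star_alg" where
  "subalg A E = A\<lparr>carr := E, topol := subtopology (topol A) E\<rparr>"

definition star_alg_iso ::
    "('a::ab_group_add) star_alg \<Rightarrow> ('b::ab_group_add) star_alg \<Rightarrow> ('a \<Rightarrow> 'b) \<Rightarrow> bool" where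
  "star_alg_iso A B \<Phi> \<longleftrightarrow>
     bij_betw \<Phi> (carr A) (carr B) \<and>
     (\<forall>x\<in>carr A. \<forall>y\<in>carr A.
        \<Phi> (x + y) = \<Phi> x + \<Phi> y \<and> \<Phi> (mul A x y) = mul B (\<Phi> x) (\<Phi> y)) \<and>
     (\<forall>c. \<forall>x\<in>carr A. \<Phi> (scal A c x) = scal B c (\<Phi> x)) \<and>
     (\<forall>x\<in>carr A. \<Phi> (involution A x) = involution B (\<Phi> x)) \<and>
     homeomorphic_map (topol A) (topol B) \<Phi>"

definition star_alg_isomorphic ::
    "('a::ab_group_add) star_alg \<Rightarrow> ('b::ab_group_add) star_alg \<Rightarrow> bool" where
  "star_alg_isomorphic A B \<longleftrightarrow> (\<exists>\<Phi>. star_alg_iso A B \<Phi>)"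

definition nonzero_projections_in :: "('a::ab_group_add) star_alg \<Rightarrow> 'a set \<Rightarrow> 'a set" where
  "nonzero_projections_in A E = {P \<in> E. P \<noteq> 0 \<and> mul A P P = P \<and> involution A P = P}"

definition minimal_projections_in :: "('a::ab_group_add) star_alg \<Rightarrow> 'a set \<Rightarrow> 'a set" where
  "minimal_projections_in A E =
     {P \<in> nonzero_projections_in A E.
        \<not> (\<exists>Q \<in> nonzero_projections_in A E. Q \<noteq> P \<and> mul A Q P = Q)}"

text \<open>
  The canonical Schauder basis is by definition the family of nonzero minimal projections
  (enumerated without repetition). That this family is a Schauder basis of an
  infinite-dimensional closed commutative star-subalgebra of the operator algebra below is
  a theorem and not imposed here.
\<close>
definition canonical_schauder_basis ::
    "('a::ab_group_add) star_alg \<Rightarrow> 'a set \<Rightarrow> (nat \<Rightarrow> 'a) \<Rightarrow> bool" where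
  "canonical_schauder_basis A E P \<longleftrightarrow> bij_betw P UNIV (minimal_projections_in A E)"


subsection \<open>The sequence spaces\<close>

type_synonym cseq = "nat \<Rightarrow> complex"

definition seq_scale :: "complex \<Rightarrow> cseq \<Rightarrow> cseq" where
  "seq_scale c \<xi> = (\<lambda>j. c * \<xi> j)"

definition unit_seq :: "nat \<Rightarrow> cseq" where
  "unit_seq k = (\<lambda>j. if j = k then 1 else 0)"

definition pairing :: "cseq \<Rightarrow> cseq \<Rightarrow> complex" where
  "pairing \<xi> \<eta> = (\<Sum>j. \<xi> j * cnj (\<eta> j))"

definition ell2 :: "cseq set" where
  "ell2 = {\<xi>. summable (\<lambda>j. (cmod (\<xi> j))\<^sup>2)}"

definition orthonormal_seq :: "(nat \<Rightarrow> cseq) \<Rightarrow> bool" where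
  "orthonormal_seq f \<longleftrightarrow>
     (\<forall>i. f i \<in> ell2) \<and> (\<forall>i j. pairing (f i) (f j) = (if i = j then 1 else 0))"

definition s_norm :: "nat \<Rightarrow> cseq \<Rightarrow> real" where
  "s_norm q \<xi> = sqrt (\<Sum>j. (cmod (\<xi> j))\<^sup>2 * real (Suc j) ^ (2 * q))"

definition s_space :: "cseq set" where
  "s_space = {\<xi>. \<forall>q. summable (\<lambda>j. (cmod (\<xi> j))\<^sup>2 * real (Suc j) ^ (2 * q))}"

definition s_top :: "cseq topology" where
  "s_top = seminorm_topology s_space (range s_norm)"

definition s_dual_step :: "nat \<Rightarrow> cseq set" where
  "s_dual_step q = {\<xi>. summable (\<lambda>j. (cmod (\<xi> j))\<^sup>2 / real (Suc j) ^ (2 * q))}"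

definition s_dual_norm :: "nat \<Rightarrow> cseq \<Rightarrow> real" where
  "s_dual_norm q \<xi> = sqrt (\<Sum>j. (cmod (\<xi> j))\<^sup>2 / real (Suc j) ^ (2 * q))"

definition s_dual :: "cseq set" where
  "s_dual = (\<Union>q. s_dual_step q)"

definition seminorm_on :: "cseq set \<Rightarrow> (cseq \<Rightarrow> real) \<Rightarrow> bool" where
  "seminorm_on X p \<longleftrightarrow>
     (\<forall>\<xi>\<in>X. 0 \<le> p \<xi>) \<and>
     (\<forall>\<xi>\<in>X. \<forall>\<eta>\<in>X. p (\<xi> + \<eta>) \<le> p \<xi> + p \<eta>) \<and>
     (\<forall>c. \<forall>\<xi>\<in>X. p (seq_scale c \<xi>) = cmod c * p \<xi>)"

text \<open>
  Inductive limit topology (in the category of locally convex spaces) of the Hilbert spaces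
  \<open>s_dual_step q\<close>: the finest locally convex topology making all inclusions of the steps
  continuous, i.e. the one given by all seminorms whose restriction to every step is
  continuous.
\<close>
definition s_dual_top :: "cseq topology" where
  "s_dual_top = seminorm_topology s_dual
     {p. seminorm_on s_dual p \<and> (\<forall>q. \<exists>C. \<forall>\<xi>\<in>s_dual_step q. p \<xi> \<le> C * s_dual_norm q \<xi>)}"


subsection \<open>The algebra of continuous linear operators from \<open>s_dual\<close> to \<open>s_space\<close>\<close>

text \<open>
  An operator is represented by a function on all sequences that vanishes outside
  \<open>s_dual\<close>, so that equality of functions is equality of operators.
\<close>
type_synonym cop = "cseq \<Rightarrow> cseq"

definition Lss :: "cop set" where
  "Lss = {x. (\<forall>\<xi>. \<xi> \<notin> s_dual \<longrightarrow> x \<xi> = 0) \<and>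
             (\<forall>\<xi>\<in>s_dual. \<forall>\<eta>\<in>s_dual. x (\<xi> + \<eta>) = x \<xi> + x \<eta>) \<and>
             (\<forall>c. \<forall>\<xi>\<in>s_dual. x (seq_scale c \<xi>) = seq_scale c (x \<xi>)) \<and>
             continuous_map s_dual_top s_top x}"

definition op_norm :: "nat \<Rightarrow> cop \<Rightarrow> real" where
  "op_norm q x = (SUP \<xi> \<in> {\<xi> \<in> s_dual_step q. s_dual_norm q \<xi> \<le> 1}. s_norm q (x \<xi>))"

text \<open>The Hilbert space adjoint of the operator induced on \<open>ell2\<close>.\<close>
definition op_adjoint :: "cop \<Rightarrow> cop" where
  "op_adjoint x =
     (THE y. y \<in> Lss \<and> (\<forall>\<xi>\<in>ell2. \<forall>\<eta>\<in>ell2. pairing (x \<xi>) \<eta> = pairing \<xi> (y \<eta>)))"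

definition L_alg :: "cop star_alg" where
  "L_alg =
     \<lparr>carr = Lss,
      scal = (\<lambda>c x \<xi>. seq_scale c (x \<xi>)),
      mul = (\<lambda>x y. x \<circ> y),
      involution = op_adjoint,
      topol = seminorm_topology Lss (range op_norm)\<rparr>"

definition rank_one :: "cseq \<Rightarrow> cop" where
  "rank_one f = (\<lambda>\<xi>. if \<xi> \<in> s_dual then seq_scale (pairing \<xi> f) f else 0)"


subsection \<open>Koethe sequence algebras\<close>

definition koethe_norm :: "(nat \<Rightarrow> nat \<Rightarrow> real) \<Rightarrow> nat \<Rightarrow> cseq \<Rightarrow> real" where
  "koethe_norm a q \<xi> = (SUP k. cmod (\<xi> k) * a k q)"

definition koethe_space :: "(nat \<Rightarrow> nat \<Rightarrow> real) \<Rightarrow> cseq set" where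
  "koethe_space a = {\<xi>. \<forall>q. bdd_above (range (\<lambda>k. cmod (\<xi> k) * a k q))}"

definition koethe_alg :: "(nat \<Rightarrow> nat \<Rightarrow> real) \<Rightarrow> cseq star_alg" where
  "koethe_alg a =
     \<lparr>carr = koethe_space a,
      scal = seq_scale,
      mul = (\<lambda>\<xi> \<eta>. \<xi> * \<eta>),
      involution = (\<lambda>\<xi> j. cnj (\<xi> j)),
      topol = seminorm_topology (koethe_space a) (range (koethe_norm a))\<rparr>"

definition max_norm_matrix :: "(nat \<Rightarrow> cseq) \<Rightarrow> (nat \<Rightarrow> nat set) \<Rightarrow> nat \<Rightarrow> nat \<Rightarrow> real" where
  "max_norm_matrix f N k q = (MAX j\<in>N k. s_norm q (f j))"

definition orthonormal_block_data :: "(nat \<Rightarrow> cseq) \<Rightarrow> (nat \<Rightarrow> nat set) \<Rightarrow> bool" where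
  "orthonormal_block_data f N \<longleftrightarrow>
     range f \<subseteq> s_space \<and> orthonormal_seq f \<and>
     (\<forall>k. finite (N k) \<and> N k \<noteq> {}) \<and> disjoint_family N"

definition block_projection :: "(nat \<Rightarrow> cseq) \<Rightarrow> (nat \<Rightarrow> nat set) \<Rightarrow> nat \<Rightarrow> cop" where
  "block_projection f N k = (\<Sum>j\<in>N k. rank_one (f j))"

end

theory Submission
  imports Defs
begin

text \<open>
  The isomorphism reads off eigenvalues. If \<open>P k\<close> are the minimal projections of a closed
  commutative star-subalgebra \<open>E\<close>, every \<open>x\<close> in \<open>E\<close> acts on the range of \<open>P k\<close> as a
  scalar \<open>c k\<close>, and \<open>x\<close> is mapped to the sequence \<open>c\<close>. Two estimates identify the image and
  the topology. As the vectors $f_j$ with \<open>j \<in> N k\<close> are normalized eigenvectors,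
  $|c_k| \max_{j \in N_k} |f_j|_q \le \|x\|_q$ (\<open>eigenvalue_bound\<close>). Conversely
  $\|\sum_k c_k P_k\|_q \le \sum_k |c_k| \sum_{j \in N_k} |f_j|_q^2$, and the right-hand side is
  at most a constant times $\sup_k |c_k| \max_{j \in N_k} |f_j|_{4q+4}$
  (\<open>block_sum_bound\<close>): by interpolation $|f_j|_q^2 |f_j|_1^2 \le |f_j|_{4q+4}$, while
  $\sum_j |f_j|_1^{-2} \le \sum_n n^{-2}$ for every orthonormal sequence
  (\<open>orthonormal_inverse_norm_sum\<close>).

  It remains to see that \<open>E\<close> has enough minimal projections. If \<open>y\<close> in \<open>E\<close> is self-adjoint of
  norm one, its even powers decrease to the projection onto the eigenspaces for \<open>1\<close> and \<open>-1\<close>.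
  On bounded sets of operators, entrywise convergence is convergence in the operator algebra
  (\<open>bounded_entrywise_null\<close>); therefore the powers converge there and the limit lies in \<open>E\<close>
  (\<open>even_powers_limit\<close>, \<open>spectral_projection\<close>). The trace of a nonzero projection is finite
  and at least one, hence below every nonzero projection of \<open>E\<close> there is a minimal one
  (\<open>minimal_below\<close>), and an element of \<open>E\<close> annihilated by all minimal projections vanishes
  (\<open>minimals_separate\<close>). On the range of a minimal projection the elements of \<open>E\<close> are scalar,
  because a spectral projection below a minimal one coincides with it (\<open>minimal_eigenvalue\<close>).

  For the converse, the block series with coefficients in the Koethe space form a closed
  subalgebra, again by the two estimates (\<open>block_algebra_closed\<close>), to which the
  same isomorphism applies.
\<close>

section \<open>The Hilbert space of square-summable sequences\<close>

definition ell2_norm :: "cseq \<Rightarrow> real" where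
  "ell2_norm \<xi> = sqrt (\<Sum>j. (cmod (\<xi> j))\<^sup>2)"

lemma L2_set_le_ell2_norm:
  assumes "\<xi> \<in> ell2" shows "L2_set (\<lambda>j. cmod (\<xi> j)) {..<n} \<le> ell2_norm \<xi>"
  using assms unfolding ell2_norm_def L2_set_def ell2_def
  by (auto intro!: sum_le_suminf)

lemma ell2_normI:
  assumes "\<And>n. L2_set (\<lambda>j. cmod (\<xi> j)) {..<n} \<le> C"
  shows "\<xi> \<in> ell2" and "ell2_norm \<xi> \<le> C"
proof -
  have C: "C \<ge> 0" using assms[of 0] by simp
  have *: "(\<Sum>j<n. (cmod (\<xi> j))\<^sup>2) \<le> C\<^sup>2" for n
    using assms[of n] C unfolding L2_set_def
    by (simp add: sqrt_le_D)
  show s: "\<xi> \<in> ell2" unfolding ell2_def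
    using * by (auto intro!: summableI_nonneg_bounded)
  show "ell2_norm \<xi> \<le> C" unfolding ell2_norm_def
    using s * C unfolding ell2_def
    by (intro real_le_lsqrt) (auto intro!: suminf_le_const suminf_nonneg)
qed

lemma ell2_norm_nonneg [simp]: "\<xi> \<in> ell2 \<Longrightarrow> 0 \<le> ell2_norm \<xi>"
  using L2_set_le_ell2_norm[of \<xi> 0] by simp

lemma cmod_le_ell2_norm: "\<xi> \<in> ell2 \<Longrightarrow> cmod (\<xi> j) \<le> ell2_norm \<xi>"
  using L2_set_le_ell2_norm[of \<xi> "Suc j"]
    member_le_L2_set[of "{..<Suc j}" j "\<lambda>j. cmod (\<xi> j)"] by simp

lemma ell2_norm_eq_0: "\<xi> \<in> ell2 \<Longrightarrow> ell2_norm \<xi> = 0 \<Longrightarrow> \<xi> = 0"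
  using cmod_le_ell2_norm[of \<xi>] by (auto simp: fun_eq_iff)

lemma ell2_dominated:
  assumes "\<eta> \<in> ell2" "\<And>j. cmod (\<xi> j) \<le> cmod (\<eta> j)"
  shows "\<xi> \<in> ell2" and "ell2_norm \<xi> \<le> ell2_norm \<eta>"
proof -
  have "L2_set (\<lambda>j. cmod (\<xi> j)) {..<n} \<le> ell2_norm \<eta>" for n
    by (rule order_trans[OF L2_set_mono L2_set_le_ell2_norm]) (use assms in auto)
  then show "\<xi> \<in> ell2" and "ell2_norm \<xi> \<le> ell2_norm \<eta>"
    using ell2_normI by blast+
qed

lemma ell2_add:
  assumes "\<xi> \<in> ell2" "\<eta> \<in> ell2"
  shows "\<xi> + \<eta> \<in> ell2" and "ell2_norm (\<xi> + \<eta>) \<le> ell2_norm \<xi> + ell2_norm \<eta>"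
proof -
  have "L2_set (\<lambda>j. cmod ((\<xi> + \<eta>) j)) {..<n} \<le> ell2_norm \<xi> + ell2_norm \<eta>" for n
  proof -
    have "L2_set (\<lambda>j. cmod ((\<xi> + \<eta>) j)) {..<n}
        \<le> L2_set (\<lambda>j. cmod (\<xi> j) + cmod (\<eta> j)) {..<n}"
      by (rule L2_set_mono) (auto simp: norm_triangle_ineq)
    also have "\<dots> \<le> L2_set (\<lambda>j. cmod (\<xi> j)) {..<n} + L2_set (\<lambda>j. cmod (\<eta> j)) {..<n}"
      by (rule L2_set_triangle_ineq)
    also have "\<dots> \<le> ell2_norm \<xi> + ell2_norm \<eta>"
      using assms by (intro add_mono L2_set_le_ell2_norm)
    finally show ?thesis .
  qed
  then show "\<xi> + \<eta> \<in> ell2" and "ell2_norm (\<xi> + \<eta>) \<le> ell2_norm \<xi> + ell2_norm \<eta>"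
    using ell2_normI by blast+
qed

lemma ell2_scale:
  assumes "\<xi> \<in> ell2"
  shows "seq_scale c \<xi> \<in> ell2" and "ell2_norm (seq_scale c \<xi>) = cmod c * ell2_norm \<xi>"
proof -
  have s: "summable (\<lambda>j. (cmod (\<xi> j))\<^sup>2)" using assms by (simp add: ell2_def)
  have *: "(\<lambda>j. (cmod (seq_scale c \<xi> j))\<^sup>2) = (\<lambda>j. (cmod c)\<^sup>2 * (cmod (\<xi> j))\<^sup>2)"
    by (simp add: seq_scale_def norm_mult power_mult_distrib)
  show "seq_scale c \<xi> \<in> ell2" using s by (simp add: ell2_def * summable_mult)
  show "ell2_norm (seq_scale c \<xi>) = cmod c * ell2_norm \<xi>"
    unfolding ell2_norm_def * using s by (simp add: suminf_mult real_sqrt_mult)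
qed

lemma zero_in_ell2 [simp]: "0 \<in> ell2" and ell2_norm_zero [simp]: "ell2_norm 0 = 0"
  by (auto simp: ell2_def ell2_norm_def)

lemma ell2_sum: "(\<And>i. i \<in> I \<Longrightarrow> f i \<in> ell2) \<Longrightarrow> sum f I \<in> ell2"
  by (induction I rule: infinite_finite_induct) (auto simp: ell2_add)

lemma seq_scale_minus_one: "\<xi> - \<eta> = \<xi> + seq_scale (-1) \<eta>"
  by (auto simp: seq_scale_def fun_eq_iff)

lemma ell2_diff: "\<xi> \<in> ell2 \<Longrightarrow> \<eta> \<in> ell2 \<Longrightarrow> \<xi> - \<eta> \<in> ell2"
  by (simp add: seq_scale_minus_one ell2_add ell2_scale)

text \<open>The pairing is a \<open>suminf\<close>, hence additive only where the series converges. The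
  predicate covers both pairs in \<open>ell2\<close> and pairs from the dual and the space itself.\<close>

definition pairable :: "cseq \<Rightarrow> cseq \<Rightarrow> bool" where
  "pairable \<xi> \<eta> \<longleftrightarrow> summable (\<lambda>j. cmod (\<xi> j * cnj (\<eta> j)))"

lemma pairing_sums: "pairable \<xi> \<eta> \<Longrightarrow> (\<lambda>j. \<xi> j * cnj (\<eta> j)) sums pairing \<xi> \<eta>"
  unfolding pairable_def pairing_def by (rule summable_norm_cancel[THEN summable_sums])

lemma pairing_eqI: "(\<lambda>j. \<xi> j * cnj (\<eta> j)) sums c \<Longrightarrow> pairing \<xi> \<eta> = c"
  unfolding pairing_def by (rule sums_unique[symmetric])

lemma ell2_pairing:
  assumes "\<xi> \<in> ell2" "\<eta> \<in> ell2"
  shows "pairable \<xi> \<eta>" and "cmod (pairing \<xi> \<eta>) \<le> ell2_norm \<xi> * ell2_norm \<eta>"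
proof -
  have b: "(\<Sum>j<n. cmod (\<xi> j * cnj (\<eta> j))) \<le> ell2_norm \<xi> * ell2_norm \<eta>" for n
  proof -
    have "(\<Sum>j<n. cmod (\<xi> j * cnj (\<eta> j))) = (\<Sum>j<n. \<bar>cmod (\<xi> j)\<bar> * \<bar>cmod (\<eta> j)\<bar>)"
      by (simp add: norm_mult)
    also have "\<dots> \<le> L2_set (\<lambda>j. cmod (\<xi> j)) {..<n} * L2_set (\<lambda>j. cmod (\<eta> j)) {..<n}"
      by (rule L2_set_mult_ineq)
    also have "\<dots> \<le> ell2_norm \<xi> * ell2_norm \<eta>"
      using assms by (intro mult_mono L2_set_le_ell2_norm) auto
    finally show ?thesis .
  qed
  show p: "pairable \<xi> \<eta>" unfolding pairable_def
    using b by (intro summableI_nonneg_bounded) auto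
  have "cmod (pairing \<xi> \<eta>) \<le> (\<Sum>j. cmod (\<xi> j * cnj (\<eta> j)))"
    unfolding pairing_def using p by (intro summable_norm) (simp add: pairable_def)
  also have "\<dots> \<le> ell2_norm \<xi> * ell2_norm \<eta>"
    using p b by (intro suminf_le_const) (auto simp: pairable_def)
  finally show "cmod (pairing \<xi> \<eta>) \<le> ell2_norm \<xi> * ell2_norm \<eta>" .
qed

lemma pairing_add_left:
  "pairable \<xi> \<zeta> \<Longrightarrow> pairable \<eta> \<zeta> \<Longrightarrow> pairing (\<xi> + \<eta>) \<zeta> = pairing \<xi> \<zeta> + pairing \<eta> \<zeta>"
  by (rule pairing_eqI) (simp add: ring_distribs sums_add pairing_sums)

lemma pairing_scale_left:
  "pairable \<xi> \<zeta> \<Longrightarrow> pairing (seq_scale c \<xi>) \<zeta> = c * pairing \<xi> \<zeta>"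
  by (rule pairing_eqI) (simp add: seq_scale_def mult.assoc sums_mult pairing_sums)

lemma pairing_commute:
  assumes "pairable \<xi> \<eta>" shows "pairing \<eta> \<xi> = cnj (pairing \<xi> \<eta>)"
proof (rule pairing_eqI)
  have "(\<lambda>j. cnj (\<xi> j * cnj (\<eta> j))) sums cnj (pairing \<xi> \<eta>)"
    using pairing_sums[OF assms] by (simp only: sums_cnj)
  then show "(\<lambda>j. \<eta> j * cnj (\<xi> j)) sums cnj (pairing \<xi> \<eta>)" by (simp add: mult.commute)
qed

lemma pairing_zero [simp]: "pairing 0 \<xi> = 0" "pairing \<xi> 0 = 0"
  by (simp_all add: pairing_def)

lemma pairing_sum_left:
  "(\<And>i. i \<in> I \<Longrightarrow> f i \<in> ell2) \<Longrightarrow> \<eta> \<in> ell2 \<Longrightarrow>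
    pairing (sum f I) \<eta> = (\<Sum>i\<in>I. pairing (f i) \<eta>)"
  by (induction I rule: infinite_finite_induct)
    (auto simp: pairing_add_left ell2_pairing ell2_sum)

lemma ell2_norm_sums: "\<xi> \<in> ell2 \<Longrightarrow> (\<lambda>j. (cmod (\<xi> j))\<^sup>2) sums (ell2_norm \<xi>)\<^sup>2"
  unfolding ell2_norm_def ell2_def by (simp add: suminf_nonneg summable_sums)

lemma pairing_self:
  assumes "\<xi> \<in> ell2" shows "pairing \<xi> \<xi> = of_real ((ell2_norm \<xi>)\<^sup>2)"
proof (rule pairing_eqI)
  have "(\<lambda>j. complex_of_real ((cmod (\<xi> j))\<^sup>2)) sums of_real ((ell2_norm \<xi>)\<^sup>2)"
    by (rule sums_of_real[OF ell2_norm_sums[OF assms]])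
  then show "(\<lambda>j. \<xi> j * cnj (\<xi> j)) sums of_real ((ell2_norm \<xi>)\<^sup>2)"
    by (simp add: complex_norm_square flip: of_real_power)
qed

lemma pairing_diff_left:
  "\<xi> \<in> ell2 \<Longrightarrow> \<eta> \<in> ell2 \<Longrightarrow> \<zeta> \<in> ell2 \<Longrightarrow> pairing (\<xi> - \<eta>) \<zeta> = pairing \<xi> \<zeta> - pairing \<eta> \<zeta>"
  by (simp add: seq_scale_minus_one pairing_add_left pairing_scale_left ell2_pairing ell2_scale)

lemma pairing_diff_right:
  assumes "\<xi> \<in> ell2" "\<eta> \<in> ell2" "\<zeta> \<in> ell2"
  shows "pairing \<zeta> (\<xi> - \<eta>) = pairing \<zeta> \<xi> - pairing \<zeta> \<eta>"
  using assms pairing_commute[of "\<xi> - \<eta>" \<zeta>] pairing_commute[of \<xi> \<zeta>] pairing_commute[of \<eta> \<zeta>]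
  by (simp add: ell2_pairing ell2_diff pairing_diff_left)

lemma unit_seq_ell2 [simp]: "unit_seq j \<in> ell2"
  by (simp add: ell2_def unit_seq_def if_distrib[of cmod] if_distrib[of "\<lambda>x. x\<^sup>2"]
      summable_single[of j "\<lambda>_. 1"] cong: if_cong)

lemma pairing_unit_seq [simp]: "pairing \<xi> (unit_seq j) = \<xi> j"
  by (rule pairing_eqI) (use sums_single[of j \<xi>] in
      \<open>simp add: unit_seq_def if_distrib[of cnj] if_distrib[of "\<lambda>y. _ * y"] cong: if_cong\<close>)

definition orthonormal_on :: "'i set \<Rightarrow> ('i \<Rightarrow> cseq) \<Rightarrow> bool" where
  "orthonormal_on I f \<longleftrightarrow> (\<forall>i\<in>I. f i \<in> ell2) \<and>
     (\<forall>i\<in>I. \<forall>j\<in>I. pairing (f i) (f j) = (if i = j then 1 else 0))"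

lemma orthonormal_on_norm:
  assumes "orthonormal_on I f" "i \<in> I" shows "ell2_norm (f i) = 1"
proof -
  have e: "f i \<in> ell2" "pairing (f i) (f i) = 1" using assms by (auto simp: orthonormal_on_def)
  then have "(ell2_norm (f i))\<^sup>2 = 1"
    using pairing_self[of "f i"] by (metis of_real_eq_1_iff)
  then show ?thesis using ell2_norm_nonneg[OF e(1)] by (auto simp: power2_eq_1_iff)
qed

text \<open>The remainder of the orthogonal expansion. Its squared norm is the defect in Bessel's inequality,
  and a nonzero remainder enlarges the orthonormal family.\<close>

lemma bessel_defect:
  assumes "finite I" "orthonormal_on I f" "\<xi> \<in> ell2"
  shows "(ell2_norm (\<xi> - (\<Sum>i\<in>I. seq_scale (pairing \<xi> (f i)) (f i))))\<^sup>2
    = (ell2_norm \<xi>)\<^sup>2 - (\<Sum>i\<in>I. (cmod (pairing \<xi> (f i)))\<^sup>2)"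
    and "\<And>k. k \<in> I \<Longrightarrow> pairing (\<xi> - (\<Sum>i\<in>I. seq_scale (pairing \<xi> (f i)) (f i))) (f k) = 0"
proof -
  define g where "g = (\<Sum>i\<in>I. seq_scale (pairing \<xi> (f i)) (f i))"
  have f: "f i \<in> ell2" if "i \<in> I" for i using assms that by (auto simp: orthonormal_on_def)
  have g: "g \<in> ell2" unfolding g_def by (intro ell2_sum ell2_scale f)
  have gf: "pairing g (f k) = pairing \<xi> (f k)" if "k \<in> I" for k
  proof -
    have "pairing g (f k) = (\<Sum>i\<in>I. pairing \<xi> (f i) * (if i = k then 1 else 0))"
      unfolding g_def using assms that f
      by (subst pairing_sum_left) (auto simp: ell2_scale pairing_scale_left ell2_pairing
          orthonormal_on_def intro!: sum.cong)
    then show ?thesis using assms that by (simp add: if_distrib cong: if_cong)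
  qed
  then show "pairing (\<xi> - g) (f k) = 0" if "k \<in> I" for k
    using that g f assms by (simp add: pairing_diff_left)
  have e: "pairing g \<zeta> = (\<Sum>i\<in>I. pairing \<xi> (f i) * cnj (pairing \<zeta> (f i)))" if "\<zeta> \<in> ell2" for \<zeta>
  proof -
    have "pairing g \<zeta> = (\<Sum>i\<in>I. pairing \<xi> (f i) * pairing (f i) \<zeta>)"
      unfolding g_def using that f
      by (subst pairing_sum_left) (simp_all add: ell2_scale pairing_scale_left ell2_pairing)
    also have "\<dots> = (\<Sum>i\<in>I. pairing \<xi> (f i) * cnj (pairing \<zeta> (f i)))"
      by (intro sum.cong refl arg_cong2[where f="(*)"] pairing_commute ell2_pairing f that)
    finally show ?thesis .
  qed
  have sq: "z * cnj z = of_real ((cmod z)\<^sup>2)" for z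
    by (simp only: complex_norm_square)
  have gg: "pairing g g = (\<Sum>i\<in>I. of_real ((cmod (pairing \<xi> (f i)))\<^sup>2))"
    unfolding e[OF g] by (intro sum.cong refl) (simp only: gf sq)
  have gx: "pairing g \<xi> = (\<Sum>i\<in>I. of_real ((cmod (pairing \<xi> (f i)))\<^sup>2))"
    unfolding e[OF assms(3)] sq ..
  have xg: "pairing \<xi> g = (\<Sum>i\<in>I. of_real ((cmod (pairing \<xi> (f i)))\<^sup>2))"
    using gx pairing_commute[of g \<xi>] g assms(3) by (simp add: ell2_pairing)
  have "complex_of_real ((ell2_norm (\<xi> - g))\<^sup>2) = pairing (\<xi> - g) (\<xi> - g)"
    using g assms by (intro pairing_self[symmetric] ell2_diff)
  also have "\<dots> = of_real ((ell2_norm \<xi>)\<^sup>2 - (\<Sum>i\<in>I. (cmod (pairing \<xi> (f i)))\<^sup>2))"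
    using g assms(3) by (subst pairing_diff_left)
      (simp_all add: pairing_diff_right ell2_diff gg gx xg pairing_self)
  finally show "(ell2_norm (\<xi> - g))\<^sup>2 = (ell2_norm \<xi>)\<^sup>2 - (\<Sum>i\<in>I. (cmod (pairing \<xi> (f i)))\<^sup>2)"
    by (simp only: of_real_eq_iff)
qed

lemma bessel_inequality:
  assumes "finite I" "orthonormal_on I f" "\<xi> \<in> ell2"
  shows "(\<Sum>i\<in>I. (cmod (pairing \<xi> (f i)))\<^sup>2) \<le> (ell2_norm \<xi>)\<^sup>2"
  using bessel_defect(1)[OF assms] zero_le_power2[of "ell2_norm (\<xi> - (\<Sum>i\<in>I. seq_scale (pairing \<xi> (f i)) (f i)))"] by linarith

lemma ell2_tail_tendsto_0:
  assumes "\<xi> \<in> ell2"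
  shows "(\<lambda>n. ell2_norm (\<lambda>j. if j < n then 0 else \<xi> j)) \<longlonglongrightarrow> 0"
proof -
  let ?f = "\<lambda>j. (cmod (\<xi> j))\<^sup>2"
  have s: "summable ?f" using assms by (simp add: ell2_def)
  have "ell2_norm (\<lambda>j. if j < n then 0 else \<xi> j) = sqrt (suminf ?f - sum ?f {..<n})" for n
  proof -
    have "(\<lambda>j. if j \<in> {..<n} then ?f j else 0) sums sum ?f {..<n}"
      by (rule sums_If_finite_set) simp
    from sums_diff[OF summable_sums[OF s] this]
    have "(\<lambda>j. (cmod (if j < n then 0 else \<xi> j))\<^sup>2) sums (suminf ?f - sum ?f {..<n})"
      by (rule sums_cong[THEN iffD1, rotated]) auto
    then show ?thesis unfolding ell2_norm_def by (simp add: sums_iff)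
  qed
  moreover have "(\<lambda>n. sqrt (suminf ?f - sum ?f {..<n})) \<longlonglongrightarrow> sqrt (suminf ?f - suminf ?f)"
    by (intro tendsto_intros summable_LIMSEQ s)
  ultimately show ?thesis by simp
qed

section \<open>Weighted norms\<close>

text \<open>After these changes of weight, the norms of \<open>s_space\<close> and of the dual steps become the norm of
  \<open>ell2\<close>, and \<open>up q\<close> is dual to \<open>down q\<close> for the pairing.\<close>

definition up :: "nat \<Rightarrow> cseq \<Rightarrow> cseq" where
  "up q \<xi> = (\<lambda>j. \<xi> j * of_nat (Suc j) ^ q)"

definition down :: "nat \<Rightarrow> cseq \<Rightarrow> cseq" where
  "down q \<xi> = (\<lambda>j. \<xi> j / of_nat (Suc j) ^ q)"

lemma cmod_up: "cmod (up q \<xi> j) = cmod (\<xi> j) * real (Suc j) ^ q"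
  by (simp only: up_def norm_mult norm_power norm_of_nat)

lemma cmod_down: "cmod (down q \<xi> j) = cmod (\<xi> j) / real (Suc j) ^ q"
  by (simp only: down_def norm_divide norm_power norm_of_nat)

lemma s_norm_eq: "s_norm q \<xi> = ell2_norm (up q \<xi>)"
  unfolding s_norm_def ell2_norm_def cmod_up by (simp only: power_even_eq power_mult_distrib)

lemma s_dual_norm_eq: "s_dual_norm q \<xi> = ell2_norm (down q \<xi>)"
  unfolding s_dual_norm_def ell2_norm_def cmod_down by (simp only: power_even_eq power_divide)

lemma s_space_eq: "\<xi> \<in> s_space \<longleftrightarrow> (\<forall>q. up q \<xi> \<in> ell2)"
  unfolding s_space_def ell2_def mem_Collect_eq cmod_up
  by (simp only: power_even_eq power_mult_distrib)

lemma s_dual_step_eq: "\<xi> \<in> s_dual_step q \<longleftrightarrow> down q \<xi> \<in> ell2"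
  unfolding s_dual_step_def ell2_def mem_Collect_eq cmod_down
  by (simp only: power_even_eq power_divide)

lemma up_simps [simp]: "up q (\<xi> + \<eta>) = up q \<xi> + up q \<eta>" "up q (seq_scale c \<xi>) = seq_scale c (up q \<xi>)"
  "up q 0 = 0" "up 0 \<xi> = \<xi>" "up q (\<xi> - \<eta>) = up q \<xi> - up q \<eta>"
  by (auto simp: up_def seq_scale_def fun_eq_iff algebra_simps)

lemma down_simps [simp]: "down q (\<xi> + \<eta>) = down q \<xi> + down q \<eta>" "down q (seq_scale c \<xi>) = seq_scale c (down q \<xi>)"
  "down q 0 = 0" "down 0 \<xi> = \<xi>" "down q (\<xi> - \<eta>) = down q \<xi> - down q \<eta>"
  by (auto simp: down_def seq_scale_def fun_eq_iff add_divide_distrib diff_divide_distrib)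

lemma s_norm_0: "s_norm 0 \<xi> = ell2_norm \<xi>" and s_dual_norm_0: "s_dual_norm 0 \<xi> = ell2_norm \<xi>"
  and s_dual_step_0: "s_dual_step 0 = ell2"
  by (auto simp: s_norm_eq s_dual_norm_eq s_dual_step_eq)

lemma s_space_up: "\<xi> \<in> s_space \<Longrightarrow> up q \<xi> \<in> ell2" by (simp add: s_space_eq)

lemma s_norm_nonneg [simp]: "\<xi> \<in> s_space \<Longrightarrow> 0 \<le> s_norm q \<xi>"
  by (simp add: s_norm_eq s_space_eq)

lemma s_dual_norm_nonneg [simp]: "\<xi> \<in> s_dual_step q \<Longrightarrow> 0 \<le> s_dual_norm q \<xi>"
  by (simp add: s_dual_norm_eq s_dual_step_eq)

lemma zero_in_s [simp]: "0 \<in> s_space" and s_norm_zero [simp]: "s_norm q 0 = 0"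
  and zero_in_s_dual_step [simp]: "0 \<in> s_dual_step q" and s_dual_norm_zero [simp]: "s_dual_norm q 0 = 0"
  by (auto simp: s_space_eq s_norm_eq s_dual_norm_eq s_dual_step_eq)

lemma s_add: "\<xi> \<in> s_space \<Longrightarrow> \<eta> \<in> s_space \<Longrightarrow> \<xi> + \<eta> \<in> s_space"
  and s_scale: "\<xi> \<in> s_space \<Longrightarrow> seq_scale c \<xi> \<in> s_space"
  and s_diff: "\<xi> \<in> s_space \<Longrightarrow> \<eta> \<in> s_space \<Longrightarrow> \<xi> - \<eta> \<in> s_space"
  by (auto simp: s_space_eq ell2_add ell2_scale ell2_diff)

lemma s_norm_add: "\<xi> \<in> s_space \<Longrightarrow> \<eta> \<in> s_space \<Longrightarrow> s_norm q (\<xi> + \<eta>) \<le> s_norm q \<xi> + s_norm q \<eta>"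
  and s_norm_scale: "\<xi> \<in> s_space \<Longrightarrow> s_norm q (seq_scale c \<xi>) = cmod c * s_norm q \<xi>"
  by (auto simp: s_space_eq s_norm_eq ell2_add ell2_scale)

lemma s_dual_step_add: "\<xi> \<in> s_dual_step q \<Longrightarrow> \<eta> \<in> s_dual_step q \<Longrightarrow> \<xi> + \<eta> \<in> s_dual_step q"
  and s_dual_step_scale: "\<xi> \<in> s_dual_step q \<Longrightarrow> seq_scale c \<xi> \<in> s_dual_step q"
  and s_dual_step_diff: "\<xi> \<in> s_dual_step q \<Longrightarrow> \<eta> \<in> s_dual_step q \<Longrightarrow> \<xi> - \<eta> \<in> s_dual_step q"
  by (auto simp: s_dual_step_eq ell2_add ell2_scale ell2_diff)

lemma s_dual_norm_scale: "\<xi> \<in> s_dual_step q \<Longrightarrow> s_dual_norm q (seq_scale c \<xi>) = cmod c * s_dual_norm q \<xi>"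
  by (auto simp: s_dual_step_eq s_dual_norm_eq ell2_add ell2_scale)

lemma s_norm_mono:
  assumes "\<xi> \<in> s_space" "p \<le> q" shows "s_norm p \<xi> \<le> s_norm q \<xi>"
  unfolding s_norm_eq
  by (rule ell2_dominated) (use assms in \<open>auto simp del: of_nat_Suc
      simp: s_space_eq cmod_up intro!: mult_left_mono power_increasing\<close>)

lemma s_dual_step_mono:
  assumes "\<xi> \<in> s_dual_step p" "p \<le> q"
  shows "\<xi> \<in> s_dual_step q" and "s_dual_norm q \<xi> \<le> s_dual_norm p \<xi>"
  unfolding s_dual_step_eq s_dual_norm_eq
  by (rule ell2_dominated[of "down p \<xi>"]; use assms in \<open>auto simp del: of_nat_Suc
      simp: s_dual_step_eq cmod_down intro!: divide_left_mono power_increasing\<close>)+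

lemma s_subset_ell2: "\<xi> \<in> s_space \<Longrightarrow> \<xi> \<in> ell2"
  using s_space_up[of \<xi> 0] by simp

lemma ell2_s_dual_step: "\<xi> \<in> ell2 \<Longrightarrow> \<xi> \<in> s_dual_step q"
  and ell2_s_dual_norm: "\<xi> \<in> ell2 \<Longrightarrow> s_dual_norm q \<xi> \<le> ell2_norm \<xi>"
  using s_dual_step_mono[of \<xi> 0 q] by (auto simp: s_dual_step_0 s_dual_norm_0)

lemma ell2_subset_s_dual: "\<xi> \<in> ell2 \<Longrightarrow> \<xi> \<in> s_dual"
  unfolding s_dual_def using ell2_s_dual_step by blast

lemma s_subset_s_dual: "\<xi> \<in> s_space \<Longrightarrow> \<xi> \<in> s_dual"
  by (simp add: ell2_subset_s_dual s_subset_ell2)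

lemma ell2_norm_le_s_norm: "\<xi> \<in> s_space \<Longrightarrow> ell2_norm \<xi> \<le> s_norm q \<xi>"
  using s_norm_mono[of \<xi> 0 q] by (simp add: s_norm_0)

lemma s_dual_cases:
  assumes "\<xi> \<in> s_dual" "\<eta> \<in> s_dual"
  obtains q where "\<xi> \<in> s_dual_step q" "\<eta> \<in> s_dual_step q"
  using assms unfolding s_dual_def
  by (meson UN_iff max.cobounded1 max.cobounded2 s_dual_step_mono(1))

lemma s_dual_add: "\<xi> \<in> s_dual \<Longrightarrow> \<eta> \<in> s_dual \<Longrightarrow> \<xi> + \<eta> \<in> s_dual"
  by (rule s_dual_cases[of \<xi> \<eta>]) (auto simp: s_dual_def intro: s_dual_step_add)

lemma s_dual_diff: "\<xi> \<in> s_dual \<Longrightarrow> \<eta> \<in> s_dual \<Longrightarrow> \<xi> - \<eta> \<in> s_dual"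
  by (rule s_dual_cases[of \<xi> \<eta>]) (auto simp: s_dual_def intro: s_dual_step_diff)

lemma s_dual_scale: "\<xi> \<in> s_dual \<Longrightarrow> seq_scale c \<xi> \<in> s_dual"
  by (auto simp: s_dual_def intro: s_dual_step_scale)

lemma zero_in_s_dual [simp]: "0 \<in> s_dual" by (auto simp: s_dual_def)

lemma s_dual_s_pairing:
  assumes "\<xi> \<in> s_dual_step q" "\<eta> \<in> s_space"
  shows "pairable \<xi> \<eta>" and "cmod (pairing \<xi> \<eta>) \<le> s_dual_norm q \<xi> * s_norm q \<eta>"
proof -
  have e: "down q \<xi> j * cnj (up q \<eta> j) = \<xi> j * cnj (\<eta> j)" for j
    by (simp add: up_def down_def del: of_nat_Suc)
  have p: "down q \<xi> \<in> ell2" "up q \<eta> \<in> ell2" using assms by (auto simp: s_dual_step_eq s_space_eq)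
  show "pairable \<xi> \<eta>" using ell2_pairing(1)[OF p] unfolding pairable_def e .
  show "cmod (pairing \<xi> \<eta>) \<le> s_dual_norm q \<xi> * s_norm q \<eta>"
    using ell2_pairing(2)[OF p] unfolding pairing_def e s_dual_norm_eq s_norm_eq .
qed

lemma pairable_s_dual: "\<xi> \<in> s_dual \<Longrightarrow> \<eta> \<in> s_space \<Longrightarrow> pairable \<xi> \<eta>"
  unfolding s_dual_def using s_dual_s_pairing(1) by blast

lemma cmod_le_s_norm: "\<xi> \<in> s_space \<Longrightarrow> cmod (\<xi> j) * real (Suc j) ^ q \<le> s_norm q \<xi>"
  using cmod_le_ell2_norm[OF s_space_up, of \<xi> q j] by (simp only: s_norm_eq cmod_up)

text \<open>Cauchy-Schwarz, after half of the weights in the square have been moved from one factor of the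
  pairing to the other.\<close>

lemma s_norm_interpolation:
  assumes "\<xi> \<in> s_space" shows "(s_norm q \<xi>)\<^sup>2 \<le> ell2_norm \<xi> * s_norm (2 * q) \<xi>"
proof -
  have e: "pairing (up q \<xi>) (up q \<xi>) = pairing \<xi> (up (2 * q) \<xi>)"
    unfolding pairing_def up_def
    by (rule suminf_cong) (simp add: mult_2_right power_add mult_ac mult_2 del: of_nat_Suc)
  have "(s_norm q \<xi>)\<^sup>2 = cmod (pairing (up q \<xi>) (up q \<xi>))"
    using assms by (simp add: pairing_self s_space_up s_norm_eq norm_power)
  also have "\<dots> \<le> ell2_norm \<xi> * s_norm (2 * q) \<xi>"
    unfolding e s_norm_eq using assms by (intro ell2_pairing s_space_up s_subset_ell2)
  finally show ?thesis .
qed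

lemma unit_seq_in_s [simp]: "unit_seq j \<in> s_space"
  and s_dual_norm_unit_seq: "s_dual_norm q (unit_seq j) = 1 / real (Suc j) ^ q"
proof -
  have "up q (unit_seq j) = seq_scale (of_nat (Suc j) ^ q) (unit_seq j)" for q
    by (auto simp: up_def seq_scale_def unit_seq_def)
  then show "unit_seq j \<in> s_space" by (simp add: s_space_eq ell2_scale)
  have n: "ell2_norm (unit_seq j) = 1"
    using sums_unique[OF sums_single[of j "\<lambda>_. 1::real"]]
    by (simp add: ell2_norm_def unit_seq_def if_distrib[of cmod] if_distrib[of "\<lambda>x. x\<^sup>2"] cong: if_cong)
  have "down q (unit_seq j) = seq_scale (1 / of_nat (Suc j) ^ q) (unit_seq j)"
    by (auto simp: down_def seq_scale_def unit_seq_def)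
  then show "s_dual_norm q (unit_seq j) = 1 / real (Suc j) ^ q"
    by (simp add: s_dual_norm_eq ell2_scale n norm_divide norm_power del: of_nat_Suc)
qed

definition trunc :: "nat \<Rightarrow> cseq \<Rightarrow> cseq" where
  "trunc n \<xi> = (\<lambda>j. if j < n then \<xi> j else 0)"

lemma trunc_Suc: "trunc (Suc n) \<xi> = trunc n \<xi> + seq_scale (\<xi> n) (unit_seq n)"
  and trunc_0: "trunc 0 \<xi> = 0"
  by (auto simp: trunc_def seq_scale_def unit_seq_def fun_eq_iff less_Suc_eq)

lemma trunc_in_s [simp]: "trunc n \<xi> \<in> s_space"
  by (induction n) (simp_all only: trunc_Suc trunc_0 s_add s_scale zero_in_s unit_seq_in_s)

lemma trunc_tendsto:
  assumes "\<xi> \<in> s_dual_step q" shows "(\<lambda>n. s_dual_norm q (\<xi> - trunc n \<xi>)) \<longlonglongrightarrow> 0"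
proof -
  have "down q (\<xi> - trunc n \<xi>) = (\<lambda>j. if j < n then 0 else down q \<xi> j)" for n
    by (auto simp: down_def trunc_def simp del: of_nat_Suc)
  then show ?thesis using ell2_tail_tendsto_0[of "down q \<xi>"] assms
    unfolding s_dual_norm_eq s_dual_step_eq by (simp del: down_simps)
qed

text \<open>\<open>basel\<close> is $\sum_n n^{-2}$, the squared Hilbert-Schmidt norm of the inclusion of
  \<open>ell2\<close> into the first dual step.\<close>

definition basel :: real where "basel = (\<Sum>j. 1 / real (Suc j) ^ 2)"

lemma basel_summable: "summable (\<lambda>j. 1 / real (Suc j) ^ 2)"
  using inverse_power_summable[of 2, where 'a = real] unfolding inverse_eq_divide
  by (subst summable_Suc_iff) (simp add: field_simps)

lemma basel_nonneg: "0 \<le> basel"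
  unfolding basel_def by (intro suminf_nonneg basel_summable) auto

section \<open>Topologies generated by seminorms\<close>

definition seminorm_family :: "'a::ab_group_add set \<Rightarrow> ('a \<Rightarrow> real) set \<Rightarrow> bool" where
  "seminorm_family X P \<longleftrightarrow> P \<noteq> {} \<and>
     (\<forall>p\<in>P. p 0 = 0 \<and> (\<forall>x\<in>X. \<forall>y\<in>X. \<forall>z\<in>X. p (x - z) \<le> p (x - y) + p (y - z)))"

lemma topspace_seminorm_topology:
  assumes "seminorm_family X P" shows "topspace (seminorm_topology X P) = X"
proof -
  obtain p where p: "p \<in> P" "p 0 = 0" using assms by (auto simp: seminorm_family_def)
  have "x \<in> topspace (seminorm_topology X P)" if "x \<in> X" for x
    unfolding seminorm_topology_def topology_generated_by_topspace
    using p that by (intro UnionI[of "{y \<in> X. p (y - x) < 1}"]) force+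
  then show ?thesis unfolding seminorm_topology_def topology_generated_by_topspace by blast
qed

lemma openin_seminorm_ball:
  "p \<in> P \<Longrightarrow> x \<in> X \<Longrightarrow> 0 < e \<Longrightarrow> openin (seminorm_topology X P) {y \<in> X. p (y - x) < e}"
  unfolding seminorm_topology_def by (rule topology_generated_by_Basis) blast

text \<open>The topology is generated by balls around all points; the triangle inequality recentres them.\<close>

lemma openin_seminorm_topologyD:
  assumes fam: "seminorm_family X P"
    and "openin (seminorm_topology X P) U" "x \<in> U"
  shows "\<exists>F e. finite F \<and> F \<subseteq> P \<and> 0 < e \<and> {y \<in> X. \<forall>p\<in>F. p (y - x) < e} \<subseteq> U"
proof -
  have "generate_topology_on {{y \<in> X. p (y - x) < e} | p x e. p \<in> P \<and> x \<in> X \<and> 0 < e} U"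
    using assms(2) unfolding seminorm_topology_def openin_topology_generated_by_iff .
  then show ?thesis using \<open>x \<in> U\<close>
  proof (induction U)
    case (Int a b)
    then obtain F e F' e' where "finite F" "F \<subseteq> P" "0 < e" "{y \<in> X. \<forall>p\<in>F. p (y - x) < e} \<subseteq> a"
      "finite F'" "F' \<subseteq> P" "0 < e'" "{y \<in> X. \<forall>p\<in>F'. p (y - x) < e'} \<subseteq> b" by auto
    then show ?case by (intro exI[of _ "F \<union> F'"] exI[of _ "min e e'"]) auto
  next
    case (UN K) then show ?case by (meson Union_iff Sup_upper order_trans)
  next
    case (Basis s)
    then obtain p z e where s: "s = {y \<in> X. p (y - z) < e}" "p \<in> P" "z \<in> X" "x \<in> X" "p (x - z) < e"
      by auto
    have "p (y - z) < e" if "y \<in> X" "p (y - x) < e - p (x - z)" for y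
    proof -
      have "p (y - z) \<le> p (y - x) + p (x - z)"
        using fam s that unfolding seminorm_family_def by blast
      then show ?thesis using that by linarith
    qed
    then show ?case using s by (intro exI[of _ "{p}"] exI[of _ "e - p (x - z)"]) auto
  qed auto
qed

lemma closedin_seminorm_topologyI:
  assumes fam: "seminorm_family X P" and "E \<subseteq> X"
    and ad: "\<And>x. x \<in> X \<Longrightarrow> (\<And>p e. p \<in> P \<Longrightarrow> 0 < e \<Longrightarrow> \<exists>y\<in>E. p (y - x) < e) \<Longrightarrow> x \<in> E"
  shows "closedin (seminorm_topology X P) E"
  unfolding closedin_def topspace_seminorm_topology[OF fam]
proof (intro conjI \<open>E \<subseteq> X\<close>, subst openin_subopen, safe)
  fix x assume x: "x \<in> X" "x \<notin> E"
  then obtain p e where p: "p \<in> P" "0 < e" "\<not> (\<exists>y\<in>E. p (y - x) < e)" using ad by blast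
  have "p 0 = 0" using fam p(1) unfolding seminorm_family_def by blast
  then have "p (x - x) < e" using p(2) by simp
  then show "\<exists>T. openin (seminorm_topology X P) T \<and> x \<in> T \<and> T \<subseteq> X - E"
    using p x by (intro exI[of _ "{y \<in> X. p (y - x) < e}"]) (auto intro: openin_seminorm_ball)
qed

lemma closedin_seminorm_topologyD:
  assumes fam: "seminorm_family X P" and cl: "closedin (seminorm_topology X P) E" and x: "x \<in> X"
    and ad: "\<And>F e. finite F \<Longrightarrow> F \<subseteq> P \<Longrightarrow> 0 < e \<Longrightarrow> \<exists>y\<in>E. \<forall>p\<in>F. p (y - x) < e"
  shows "x \<in> E"
proof (rule ccontr)
  assume "x \<notin> E"
  then have "x \<in> X - E" "openin (seminorm_topology X P) (X - E)"
    using cl x unfolding closedin_def topspace_seminorm_topology[OF fam] by auto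
  from openin_seminorm_topologyD[OF fam this(2,1)]
  obtain F e where F: "finite F" "F \<subseteq> P" "0 < e" "{y \<in> X. \<forall>p\<in>F. p (y - x) < e} \<subseteq> X - E" by blast
  from ad[OF this(1,2,3)] obtain y where y: "y \<in> E" "\<forall>p\<in>F. p (y - x) < e" by blast
  moreover have "y \<in> X" using y(1) cl unfolding closedin_def topspace_seminorm_topology[OF fam] by auto
  ultimately show False using F(4) by auto
qed

lemma continuous_map_seminorm_topology:
  assumes fX: "seminorm_family X P" and fY: "seminorm_family Y Q"
    and E: "E \<subseteq> X" and f: "f \<in> E \<rightarrow> Y"
    and bd: "\<And>q. q \<in> Q \<Longrightarrow> \<exists>p\<in>P. \<exists>C\<ge>0. \<forall>x\<in>E. \<forall>x'\<in>E. q (f x' - f x) \<le> C * p (x' - x)"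
  shows "continuous_map (subtopology (seminorm_topology X P) E) (seminorm_topology Y Q) f"
proof -
  have ts: "topspace (subtopology (seminorm_topology X P) E) = E"
    using E by (simp add: topspace_seminorm_topology[OF fX] Int_absorb1)
  have op: "openin (subtopology (seminorm_topology X P) E) (f -` {y \<in> Y. q (y - z) < e} \<inter> E)"
    if q: "q \<in> Q" "z \<in> Y" for q z e
  proof (subst openin_subopen, safe)
    fix x assume x: "x \<in> E" "f x \<in> Y" "q (f x - z) < e"
    obtain p C where p: "p \<in> P" "0 \<le> C" "\<forall>x\<in>E. \<forall>x'\<in>E. q (f x' - f x) \<le> C * p (x' - x)" using bd[OF q(1)] by blast
    define d where "d = (e - q (f x - z)) / (C + 1)"
    have d: "d > 0" unfolding d_def using x p by simp
    have "q (f y - z) < e" if y: "y \<in> E" "p (y - x) < d" for y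
    proof -
      have "q (f y - z) \<le> q (f y - f x) + q (f x - z)"
        using fY q y x f unfolding seminorm_family_def by blast
      moreover have "q (f y - f x) \<le> C * p (y - x)" using p y x by blast
      moreover have "C * p (y - x) < e - q (f x - z)"
      proof -
        have "C * d < e - q (f x - z)" unfolding d_def using x p by (simp add: field_simps)
        moreover have "C * p (y - x) \<le> C * d"
          using y p by (intro mult_left_mono) auto
        ultimately show ?thesis by linarith
      qed
      ultimately show ?thesis by linarith
    qed
    then show "\<exists>T. openin (subtopology (seminorm_topology X P) E) T \<and> x \<in> T \<and>
        T \<subseteq> f -` {y \<in> Y. q (y - z) < e} \<inter> E"
      using p x E d fX f
      by (intro exI[of _ "E \<inter> {y \<in> X. p (y - x) < d}"] conjI openin_subtopology_Int2 openin_seminorm_ball)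
        (auto simp: seminorm_family_def)
  qed
  show ?thesis unfolding seminorm_topology_def[of Y]
  proof (rule continuous_on_generated_topo)
    show "f ` topspace (subtopology (seminorm_topology X P) E)
        \<subseteq> \<Union> {{y \<in> Y. q (y - x) < e} | q x e. q \<in> Q \<and> x \<in> Y \<and> 0 < e}"
      using f topspace_seminorm_topology[OF fY] unfolding ts seminorm_topology_def by auto
  next
    fix U assume "U \<in> {{y \<in> Y. q (y - x) < e} | q x e. q \<in> Q \<and> x \<in> Y \<and> 0 < e}"
    then show "openin (subtopology (seminorm_topology X P) E)
        (f -` U \<inter> topspace (subtopology (seminorm_topology X P) E))"
      unfolding ts using op by blast
  qed
qed

section \<open>Continuous operators from \<open>s_dual\<close> to \<open>s_space\<close>\<close>

text \<open>The pointwise rules for function spaces would turn a sum of two sequences or of two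
  operators into an explicit abstraction; they are applied on demand only.\<close>

declare plus_fun_apply [simp del] zero_fun_apply [simp del] minus_apply [simp del]

lemmas pointwise = plus_fun_apply zero_fun_apply minus_apply

lemma seminorm_family_s: "seminorm_family s_space (range s_norm)"
proof -
  have "s_norm q (x - z) \<le> s_norm q (x - y) + s_norm q (y - z)"
    if "x \<in> s_space" "y \<in> s_space" "z \<in> s_space" for q x y z
    using s_norm_add[of "x - y" "y - z" q] that by (simp add: s_diff)
  then show ?thesis by (auto simp: seminorm_family_def)
qed

definition dual_seminorms :: "(cseq \<Rightarrow> real) set" where
  "dual_seminorms = {p. seminorm_on s_dual p \<and>
     (\<forall>q. \<exists>C. \<forall>\<xi>\<in>s_dual_step q. p \<xi> \<le> C * s_dual_norm q \<xi>)}"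

lemma seq_scale_zero: "seq_scale 0 \<xi> = 0" and seq_scale_zero_right [simp]: "seq_scale c 0 = 0"
  by (auto simp: seq_scale_def pointwise fun_eq_iff)

lemma seminorm_family_s_dual: "seminorm_family s_dual dual_seminorms"
proof -
  have "(\<lambda>_. 0) \<in> dual_seminorms"
    by (auto simp: dual_seminorms_def seminorm_on_def intro: exI[of _ 0])
  moreover have "p 0 = 0" if "p \<in> dual_seminorms" for p
  proof -
    have "p (seq_scale 0 0) = cmod 0 * p 0"
      using that zero_in_s_dual unfolding dual_seminorms_def seminorm_on_def by blast
    then show ?thesis by simp
  qed
  moreover have "p (x - z) \<le> p (x - y) + p (y - z)"
    if "p \<in> dual_seminorms" "x \<in> s_dual" "y \<in> s_dual" "z \<in> s_dual" for p x y z
  proof -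
    have "p ((x - y) + (y - z)) \<le> p (x - y) + p (y - z)"
      using that s_dual_diff unfolding dual_seminorms_def seminorm_on_def by blast
    then show ?thesis by simp
  qed
  ultimately show ?thesis by (auto simp: seminorm_family_def)
qed

lemma s_dual_top_eq: "s_dual_top = seminorm_topology s_dual dual_seminorms"
  by (simp add: s_dual_top_def dual_seminorms_def)

text \<open>It suffices to compare norms of equal index, because the dual norms decrease and the norms of
  \<open>s_space\<close> increase with the index. Then the norms of \<open>x \<xi>\<close> are themselves among the seminorms
  that define the inductive limit topology.\<close>

lemma LssI:
  assumes "\<And>\<xi>. \<xi> \<notin> s_dual \<Longrightarrow> x \<xi> = 0"
    and add: "\<And>\<xi> \<eta>. \<xi> \<in> s_dual \<Longrightarrow> \<eta> \<in> s_dual \<Longrightarrow> x (\<xi> + \<eta>) = x \<xi> + x \<eta>"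
    and sc: "\<And>c \<xi>. \<xi> \<in> s_dual \<Longrightarrow> x (seq_scale c \<xi>) = seq_scale c (x \<xi>)"
    and s: "\<And>\<xi>. \<xi> \<in> s_dual \<Longrightarrow> x \<xi> \<in> s_space"
    and bd: "\<And>q. \<exists>C\<ge>0. \<forall>\<xi>\<in>s_dual_step q. s_norm q (x \<xi>) \<le> C * s_dual_norm q \<xi>"
  shows "x \<in> Lss"
proof -
  have dp: "(\<lambda>\<xi>. s_norm q (x \<xi>)) \<in> dual_seminorms" for q
  proof -
    have "\<exists>C. \<forall>\<xi>\<in>s_dual_step r. s_norm q (x \<xi>) \<le> C * s_dual_norm r \<xi>" for r
    proof -
      obtain C where C: "C \<ge> 0"
        "\<And>\<xi>. \<xi> \<in> s_dual_step (max q r) \<Longrightarrow> s_norm (max q r) (x \<xi>) \<le> C * s_dual_norm (max q r) \<xi>"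
        using bd[of "max q r"] by blast
      have "s_norm q (x \<xi>) \<le> C * s_dual_norm r \<xi>" if x: "\<xi> \<in> s_dual_step r" for \<xi>
      proof -
        have "x \<xi> \<in> s_space" using s x by (auto simp: s_dual_def)
        then have "s_norm q (x \<xi>) \<le> s_norm (max q r) (x \<xi>)" by (simp add: s_norm_mono)
        also have "\<dots> \<le> C * s_dual_norm (max q r) \<xi>" by (rule C(2)[OF s_dual_step_mono(1)[OF x]]) simp
        also have "\<dots> \<le> C * s_dual_norm r \<xi>"
          by (intro mult_left_mono s_dual_step_mono(2)[OF x] C) simp
        finally show ?thesis .
      qed
      then show ?thesis by blast
    qed
    then show ?thesis unfolding dual_seminorms_def seminorm_on_def
      by (auto simp: s add sc s_norm_add s_norm_scale)
  qed
  have "continuous_map (subtopology s_dual_top s_dual) s_top x"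
    unfolding s_dual_top_eq s_top_def
  proof (rule continuous_map_seminorm_topology[OF seminorm_family_s_dual seminorm_family_s])
    fix p assume "p \<in> range s_norm"
    then obtain q where q: "p = s_norm q" by blast
    have "x (\<xi> - \<eta>) = x \<xi> - x \<eta>" if "\<xi> \<in> s_dual" "\<eta> \<in> s_dual" for \<xi> \<eta>
      using that by (simp add: seq_scale_minus_one add sc s_dual_scale)
    then show "\<exists>p'\<in>dual_seminorms. \<exists>C\<ge>0. \<forall>\<xi>\<in>s_dual. \<forall>\<eta>\<in>s_dual. p (x \<eta> - x \<xi>) \<le> C * p' (\<eta> - \<xi>)"
      using dp[of q] unfolding q by (intro bexI[OF _ dp[of q]] exI[of _ 1]) auto
  qed (use s in auto)
  moreover have "subtopology s_dual_top s_dual = s_dual_top"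
    using topspace_seminorm_topology[OF seminorm_family_s_dual]
    by (metis s_dual_top_eq subtopology_topspace)
  ultimately show ?thesis using assms unfolding Lss_def by auto
qed

lemma Lss_outside: "x \<in> Lss \<Longrightarrow> \<xi> \<notin> s_dual \<Longrightarrow> x \<xi> = 0"
  and Lss_add_arg: "x \<in> Lss \<Longrightarrow> \<xi> \<in> s_dual \<Longrightarrow> \<eta> \<in> s_dual \<Longrightarrow> x (\<xi> + \<eta>) = x \<xi> + x \<eta>"
  and Lss_scale_arg: "x \<in> Lss \<Longrightarrow> \<xi> \<in> s_dual \<Longrightarrow> x (seq_scale c \<xi>) = seq_scale c (x \<xi>)"
  by (auto simp: Lss_def)

lemma Lss_diff_arg: "x \<in> Lss \<Longrightarrow> \<xi> \<in> s_dual \<Longrightarrow> \<eta> \<in> s_dual \<Longrightarrow> x (\<xi> - \<eta>) = x \<xi> - x \<eta>"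
  by (simp add: seq_scale_minus_one Lss_add_arg Lss_scale_arg s_dual_scale)

lemma Lss_in_s [simp]: assumes "x \<in> Lss" shows "x \<xi> \<in> s_space"
proof (cases "\<xi> \<in> s_dual")
  case True
  have "x \<in> topspace s_dual_top \<rightarrow> topspace s_top"
    using assms unfolding Lss_def by (auto dest: continuous_map_funspace)
  then show ?thesis using True
    unfolding s_dual_top_eq s_top_def topspace_seminorm_topology[OF seminorm_family_s_dual]
      topspace_seminorm_topology[OF seminorm_family_s] by blast
qed (use assms in \<open>simp add: Lss_outside\<close>)

lemma Lss_zero_arg [simp]: "x \<in> Lss \<Longrightarrow> x 0 = 0"
  using Lss_scale_arg[of x 0 0] by (simp add: seq_scale_zero)

text \<open>A neighbourhood of zero that is mapped into the unit ball is given by finitely many seminorms,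
  each bounded on the step; homogeneity turns this into an estimate.\<close>

lemma Lss_bounded:
  assumes x: "x \<in> Lss"
  shows "\<exists>C. \<forall>\<xi>\<in>s_dual_step r. s_norm q (x \<xi>) \<le> C * s_dual_norm r \<xi>"
proof -
  define U where "U = {\<xi> \<in> s_dual. s_norm q (x \<xi>) < 1}"
  have cont: "continuous_map s_dual_top s_top x" using x by (simp add: Lss_def)
  have "openin s_top {y \<in> s_space. s_norm q (y - 0) < 1}"
    unfolding s_top_def by (rule openin_seminorm_ball) auto
  then have "openin s_dual_top {\<xi> \<in> topspace s_dual_top. x \<xi> \<in> {y \<in> s_space. s_norm q (y - 0) < 1}}"
    using cont openin_continuous_map_preimage by blast
  also have "{\<xi> \<in> topspace s_dual_top. x \<xi> \<in> {y \<in> s_space. s_norm q (y - 0) < 1}} = U"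
    unfolding U_def s_dual_top_eq topspace_seminorm_topology[OF seminorm_family_s_dual] using x by auto
  finally have "openin (seminorm_topology s_dual dual_seminorms) U" unfolding s_dual_top_eq .
  moreover have "0 \<in> U" using x by (simp add: U_def)
  ultimately obtain F e where F: "finite F" "F \<subseteq> dual_seminorms" "0 < e"
    "{y \<in> s_dual. \<forall>p\<in>F. p (y - 0) < e} \<subseteq> U"
    using openin_seminorm_topologyD[OF seminorm_family_s_dual] by meson
  have "\<forall>p\<in>F. \<exists>C. \<forall>\<xi>\<in>s_dual_step r. p \<xi> \<le> C * s_dual_norm r \<xi>"
    using F(2) unfolding dual_seminorms_def by blast
  then obtain c where c: "\<And>p \<xi>. p \<in> F \<Longrightarrow> \<xi> \<in> s_dual_step r \<Longrightarrow> p \<xi> \<le> c p * s_dual_norm r \<xi>"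
    by metis
  define C where "C = 1 + (\<Sum>p\<in>F. \<bar>c p\<bar>)"
  have C: "C > 0" and cC: "p \<in> F \<Longrightarrow> \<bar>c p\<bar> < C" for p
    using member_le_sum[of p F "\<lambda>p. \<bar>c p\<bar>"] F(1) unfolding C_def
    by (auto intro: add_pos_nonneg sum_nonneg)
  have "s_norm q (x \<xi>) \<le> C / e * s_dual_norm r \<xi>" if \<xi>: "\<xi> \<in> s_dual_step r" for \<xi>
  proof -
    have \<xi>': "\<xi> \<in> s_dual" using \<xi> by (auto simp: s_dual_def)
    have "s_norm q (x \<xi>) * e / C \<le> t" if t: "s_dual_norm r \<xi> < t" for t
    proof -
      have t0: "0 < t" using t s_dual_norm_nonneg[OF \<xi>] by linarith
      define a where "a = e / (C * t)"
      have a: "a > 0" using F C t0 by (simp add: a_def)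
      have "p (seq_scale (of_real a) \<xi>) < e" if p: "p \<in> F" for p
      proof -
        have "p (seq_scale (of_real a) \<xi>) = a * p \<xi>"
          using F(2) p \<xi>' a unfolding dual_seminorms_def seminorm_on_def by auto
        also have "\<dots> \<le> a * (C * s_dual_norm r \<xi>)"
        proof (intro mult_left_mono)
          have "p \<xi> \<le> c p * s_dual_norm r \<xi>" using c p \<xi> by blast
          also have "\<dots> \<le> C * s_dual_norm r \<xi>"
            using cC[OF p] \<xi> by (intro mult_right_mono) auto
          finally show "p \<xi> \<le> C * s_dual_norm r \<xi>" .
        qed (use a in simp)
        also have "\<dots> < a * (C * t)" using a C t by simp
        also have "\<dots> = e" using C t0 by (simp add: a_def)
        finally show ?thesis .
      qed
      then have "seq_scale (of_real a) \<xi> \<in> U" using F(4) s_dual_scale[OF \<xi>'] by auto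
      then have "a * s_norm q (x \<xi>) < 1"
        using x \<xi>' a by (simp add: U_def Lss_scale_arg s_norm_scale)
      then show ?thesis using C t0 by (simp add: a_def field_simps)
    qed
    then have "s_norm q (x \<xi>) * e / C \<le> s_dual_norm r \<xi>" by (rule dense_ge)
    then show ?thesis using C F(3) by (simp add: field_simps)
  qed
  then show ?thesis by blast
qed

lemma s_dual_norm_eq_0: "\<xi> \<in> s_dual_step q \<Longrightarrow> s_dual_norm q \<xi> = 0 \<Longrightarrow> \<xi> = 0"
  using ell2_norm_eq_0[of "down q \<xi>"]
  by (auto simp: s_dual_norm_eq s_dual_step_eq down_def fun_eq_iff pointwise simp del: of_nat_Suc)

lemma op_norm_bdd:
  assumes "x \<in> Lss"
  shows "bdd_above ((\<lambda>\<xi>. s_norm q (x \<xi>)) ` {\<xi> \<in> s_dual_step q. s_dual_norm q \<xi> \<le> 1})"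
proof -
  obtain C where C: "\<And>\<xi>. \<xi> \<in> s_dual_step q \<Longrightarrow> s_norm q (x \<xi>) \<le> C * s_dual_norm q \<xi>"
    using Lss_bounded[OF assms, of q q] by blast
  have "s_norm q (x \<xi>) \<le> \<bar>C\<bar>" if \<xi>: "\<xi> \<in> s_dual_step q" "s_dual_norm q \<xi> \<le> 1" for \<xi>
  proof -
    have "s_norm q (x \<xi>) \<le> C * s_dual_norm q \<xi>" using C \<xi> by blast
    also have "\<dots> \<le> \<bar>C\<bar> * 1" using \<xi> by (intro mult_mono) auto
    finally show ?thesis by simp
  qed
  then show ?thesis by (intro bdd_aboveI2) auto
qed

lemma op_norm_nonneg [simp]: "x \<in> Lss \<Longrightarrow> 0 \<le> op_norm q x"
  unfolding op_norm_def
  by (rule cSUP_upper2[OF op_norm_bdd, of _ 0]) auto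

lemma op_norm_bound:
  assumes x: "x \<in> Lss" and \<xi>: "\<xi> \<in> s_dual_step q"
  shows "s_norm q (x \<xi>) \<le> op_norm q x * s_dual_norm q \<xi>"
proof (cases "s_dual_norm q \<xi> = 0")
  case True
  then show ?thesis using s_dual_norm_eq_0[OF \<xi>] x by simp
next
  case False
  define t where "t = s_dual_norm q \<xi>"
  have t: "t > 0" using False s_dual_norm_nonneg[OF \<xi>] unfolding t_def by linarith
  have \<xi>': "\<xi> \<in> s_dual" using \<xi> by (auto simp: s_dual_def)
  have "s_norm q (x (seq_scale (of_real (1 / t)) \<xi>)) \<le> op_norm q x"
    unfolding op_norm_def using t \<xi>
    by (intro cSUP_upper op_norm_bdd x)
      (auto simp: s_dual_step_scale s_dual_norm_scale norm_divide simp flip: t_def)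
  then show ?thesis using x \<xi>' t
    by (simp add: Lss_scale_arg s_norm_scale norm_divide field_simps flip: t_def)
qed

lemma op_norm_leI:
  assumes "0 \<le> C" "\<And>\<xi>. \<xi> \<in> s_dual_step q \<Longrightarrow> s_norm q (x \<xi>) \<le> C * s_dual_norm q \<xi>"
  shows "op_norm q x \<le> C"
  unfolding op_norm_def
proof (rule cSUP_least)
  show "{\<xi> \<in> s_dual_step q. s_dual_norm q \<xi> \<le> 1} \<noteq> {}" by (auto intro: exI[of _ 0])
  fix \<xi> assume "\<xi> \<in> {\<xi> \<in> s_dual_step q. s_dual_norm q \<xi> \<le> 1}"
  then show "s_norm q (x \<xi>) \<le> C"
    using assms(2)[of \<xi>] mult_left_mono[of "s_dual_norm q \<xi>" 1 C] assms(1) by auto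
qed

lemma op_norm_bound_ell2:
  assumes "x \<in> Lss" "\<xi> \<in> ell2" shows "s_norm q (x \<xi>) \<le> op_norm q x * ell2_norm \<xi>"
  using op_norm_bound[OF assms(1) ell2_s_dual_step[OF assms(2)], of q]
    mult_left_mono[OF ell2_s_dual_norm[OF assms(2)] op_norm_nonneg[OF assms(1)]]
  by (rule order_trans)

lemma op_norm_mono:
  assumes "x \<in> Lss" "p \<le> q" shows "op_norm p x \<le> op_norm q x"
proof (rule op_norm_leI)
  fix \<xi> assume \<xi>: "\<xi> \<in> s_dual_step p"
  have "s_norm p (x \<xi>) \<le> s_norm q (x \<xi>)" using assms by (simp add: s_norm_mono)
  also have "\<dots> \<le> op_norm q x * s_dual_norm q \<xi>"
    using s_dual_step_mono[OF \<xi> assms(2)] assms by (intro op_norm_bound)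
  also have "\<dots> \<le> op_norm q x * s_dual_norm p \<xi>"
    using s_dual_step_mono[OF \<xi> assms(2)] assms by (intro mult_left_mono) auto
  finally show "s_norm p (x \<xi>) \<le> op_norm q x * s_dual_norm p \<xi>" .
qed (use assms in simp)

subsection \<open>Linear operations and composition\<close>

definition op_scale :: "complex \<Rightarrow> cop \<Rightarrow> cop" where
  "op_scale c x = (\<lambda>\<xi>. seq_scale c (x \<xi>))"

lemma op_scale_apply [simp]: "op_scale c x \<xi> = seq_scale c (x \<xi>)"
  by (simp add: op_scale_def)

lemma op_add_apply: "(x + y) \<xi> = x \<xi> + y \<xi>" and op_diff_apply: "(x - y) \<xi> = x \<xi> - y \<xi>"
  and op_zero_apply: "(0 :: cop) \<xi> = 0" for x y :: cop
  by (simp_all add: pointwise)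

lemma seq_scale_add: "seq_scale c (\<xi> + \<eta>) = seq_scale c \<xi> + seq_scale c \<eta>"
  and seq_scale_scale: "seq_scale c (seq_scale d \<xi>) = seq_scale (c * d) \<xi>"
  and seq_scale_add_left: "seq_scale (c + d) \<xi> = seq_scale c \<xi> + seq_scale d \<xi>"
  and seq_scale_one [simp]: "seq_scale 1 \<xi> = \<xi>"
  by (auto simp: seq_scale_def fun_eq_iff algebra_simps pointwise)

lemma Lss_add [simp]:
  assumes x: "x \<in> Lss" and y: "y \<in> Lss" shows "x + y \<in> Lss"
    and op_norm_add: "op_norm q (x + y) \<le> op_norm q x + op_norm q y"
proof -
  have *: "s_norm q ((x + y) \<xi>) \<le> (op_norm q x + op_norm q y) * s_dual_norm q \<xi>"
    if "\<xi> \<in> s_dual_step q" for q \<xi>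
    using s_norm_add[of "x \<xi>" "y \<xi>" q] op_norm_bound[OF x that] op_norm_bound[OF y that] x y
    by (simp add: ring_distribs op_add_apply)
  show "x + y \<in> Lss"
  proof (rule LssI)
    show "\<exists>C\<ge>0. \<forall>\<xi>\<in>s_dual_step q. s_norm q ((x + y) \<xi>) \<le> C * s_dual_norm q \<xi>" for q
      using * x y by (intro exI[of _ "op_norm q x + op_norm q y"]) auto
  qed (use x y in \<open>auto simp: Lss_outside Lss_add_arg Lss_scale_arg seq_scale_add s_add add_ac
        op_add_apply\<close>)
  show "op_norm q (x + y) \<le> op_norm q x + op_norm q y"
    using * x y by (intro op_norm_leI) auto
qed

lemma Lss_scale [simp]:
  assumes x: "x \<in> Lss" shows "op_scale c x \<in> Lss"
    and op_norm_scale: "op_norm q (op_scale c x) = cmod c * op_norm q x"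
proof -
  have *: "s_norm q (op_scale c y \<xi>) \<le> (cmod c * op_norm q y) * s_dual_norm q \<xi>"
    if "\<xi> \<in> s_dual_step q" "y \<in> Lss" for q \<xi> y c
    using op_norm_bound[OF that(2,1)] that by (simp add: s_norm_scale mult_left_mono mult.assoc)
  show L: "op_scale c x \<in> Lss" for c
  proof (rule LssI)
    show "\<exists>C\<ge>0. \<forall>\<xi>\<in>s_dual_step q. s_norm q (op_scale c x \<xi>) \<le> C * s_dual_norm q \<xi>" for q
      using *[OF _ x] x by (intro exI[of _ "cmod c * op_norm q x"]) auto
  qed (use x in \<open>auto simp: Lss_outside Lss_add_arg Lss_scale_arg seq_scale_add seq_scale_scale s_scale mult.commute\<close>)
  have le: "op_norm q (op_scale c y) \<le> cmod c * op_norm q y" if "y \<in> Lss" for y c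
    using *[OF _ that] that by (intro op_norm_leI) auto
  show "op_norm q (op_scale c x) = cmod c * op_norm q x"
  proof (cases "c = 0")
    case True
    then show ?thesis using le[OF x, of c] op_norm_nonneg[OF L[of c], of q] by simp
  next
    case False
    then have "op_scale (1 / c) (op_scale c x) = x" by (intro ext) (simp add: seq_scale_scale)
    then have "op_norm q x \<le> cmod (1 / c) * op_norm q (op_scale c x)"
      using le[OF L[of c], of "1 / c"] by simp
    then have "cmod c * op_norm q x \<le> op_norm q (op_scale c x)"
      using False by (simp add: norm_divide field_simps)
    with le[OF x, of c] show ?thesis by linarith
  qed
qed

lemma Lss_zero [simp]: "0 \<in> Lss" and op_norm_zero [simp]: "op_norm q 0 = 0"
proof -
  show z: "0 \<in> Lss" by (rule LssI) (auto simp: op_zero_apply intro!: exI[of _ 0])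
  show "op_norm q 0 = 0" using op_norm_leI[of 0 q 0] op_norm_nonneg[OF z, of q] by (simp add: op_zero_apply)
qed

lemma op_diff_eq: "x - y = x + op_scale (-1) y"
  by (rule ext) (simp add: seq_scale_minus_one op_add_apply op_diff_apply)

lemma Lss_diff [simp]: "x \<in> Lss \<Longrightarrow> y \<in> Lss \<Longrightarrow> x - y \<in> Lss"
  by (simp add: op_diff_eq)

lemma op_norm_diff_commute: "x \<in> Lss \<Longrightarrow> y \<in> Lss \<Longrightarrow> op_norm q (x - y) = op_norm q (y - x)"
proof -
  assume a: "x \<in> Lss" "y \<in> Lss"
  have "x - y = op_scale (-1) (y - x)" by (auto simp: seq_scale_def fun_eq_iff pointwise)
  then show ?thesis using a by (simp add: op_norm_scale)
qed

lemma op_norm_triangle: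
  assumes "x \<in> Lss" "y \<in> Lss" "z \<in> Lss"
  shows "op_norm q (x - z) \<le> op_norm q (x - y) + op_norm q (y - z)"
  using op_norm_add[of "x - y" "y - z" q] assms by simp

lemma Lss_sum [simp]: "(\<And>i. i \<in> I \<Longrightarrow> x i \<in> Lss) \<Longrightarrow> sum x I \<in> Lss"
  by (induction I rule: infinite_finite_induct) auto

lemma op_sum_apply: "(sum x I) \<xi> = (\<Sum>i\<in>I. x i \<xi>)" for x :: "'i \<Rightarrow> 'a \<Rightarrow> 'b::comm_monoid_add"
  by (induction I rule: infinite_finite_induct) (auto simp: pointwise)

text \<open>The operator norms are submultiplicative since on \<open>s_space\<close> each dual norm is dominated by the
  norm of the same index.\<close>

lemma Lss_comp [simp]:
  assumes x: "x \<in> Lss" and y: "y \<in> Lss" shows "x \<circ> y \<in> Lss"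
    and op_norm_comp: "op_norm q (x \<circ> y) \<le> op_norm q x * op_norm q y"
proof -
  have *: "s_norm q ((x \<circ> y) \<xi>) \<le> (op_norm q x * op_norm q y) * s_dual_norm q \<xi>"
    if \<xi>: "\<xi> \<in> s_dual_step q" for q \<xi>
  proof -
    have "s_norm q (x (y \<xi>)) \<le> op_norm q x * ell2_norm (y \<xi>)"
      using x y by (intro op_norm_bound_ell2) (auto intro: s_subset_ell2)
    also have "\<dots> \<le> op_norm q x * (op_norm q y * s_dual_norm q \<xi>)"
      using op_norm_bound[OF y \<xi>] ell2_norm_le_s_norm[of "y \<xi>" q] x y
      by (intro mult_left_mono) auto
    finally show ?thesis by (simp add: mult.assoc)
  qed
  show "x \<circ> y \<in> Lss"
  proof (rule LssI)
    show "\<exists>C\<ge>0. \<forall>\<xi>\<in>s_dual_step q. s_norm q ((x \<circ> y) \<xi>) \<le> C * s_dual_norm q \<xi>" for q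
      using * x y by (intro exI[of _ "op_norm q x * op_norm q y"]) auto
  qed (use x y in \<open>auto simp: Lss_outside Lss_add_arg Lss_scale_arg s_subset_s_dual\<close>)
  show "op_norm q (x \<circ> y) \<le> op_norm q x * op_norm q y"
    using * x y by (intro op_norm_leI) auto
qed

lemma comp_op_add: "x \<in> Lss \<Longrightarrow> y \<in> Lss \<Longrightarrow> z \<in> Lss \<Longrightarrow> x \<circ> (y + z) = (x \<circ> y) + (x \<circ> z)"
  and comp_op_diff: "x \<in> Lss \<Longrightarrow> y \<in> Lss \<Longrightarrow> z \<in> Lss \<Longrightarrow> x \<circ> (y - z) = (x \<circ> y) - (x \<circ> z)"
  and comp_op_scale: "x \<in> Lss \<Longrightarrow> y \<in> Lss \<Longrightarrow> x \<circ> op_scale c y = op_scale c (x \<circ> y)"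
  and op_add_comp: "(x + y) \<circ> z = (x \<circ> z) + (y \<circ> z)"
  and op_diff_comp: "(x - y) \<circ> z = (x \<circ> z) - (y \<circ> z)"
  and op_scale_comp: "op_scale c x \<circ> z = op_scale c (x \<circ> z)" for x y z :: cop
  by (rule ext; simp add: Lss_add_arg Lss_diff_arg Lss_scale_arg s_subset_s_dual
      op_add_apply op_diff_apply)+

lemma comp_op_zero [simp]: "x \<in> Lss \<Longrightarrow> x \<circ> (0 :: cop) = 0" and op_zero_comp [simp]: "(0 :: cop) \<circ> z = (0 :: cop)" for x z :: cop
  by (rule ext; simp add: op_zero_apply)+

lemma comp_op_sum:
  assumes "x \<in> Lss" "\<And>i. i \<in> I \<Longrightarrow> y i \<in> Lss" shows "x \<circ> sum y I = (\<Sum>i\<in>I. x \<circ> y i)"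
  using assms(2)
  by (induction I rule: infinite_finite_induct)
    (use assms(1) in \<open>simp_all add: comp_op_add comp_op_zero\<close>)

lemma op_sum_comp: "sum y I \<circ> x = (\<Sum>i\<in>I. y i \<circ> x)" for x :: cop and y :: "'i \<Rightarrow> cop"
  by (rule ext) (simp add: op_sum_apply)

subsection \<open>Matrices\<close>

definition entry :: "cop \<Rightarrow> nat \<Rightarrow> nat \<Rightarrow> complex" where
  "entry x i j = x (unit_seq j) i"

lemma entry_bound:
  assumes x: "x \<in> Lss"
  shows "cmod (entry x i j) * real (Suc i) ^ q * real (Suc j) ^ q \<le> op_norm q x"
proof -
  have "cmod (entry x i j) * real (Suc i) ^ q \<le> s_norm q (x (unit_seq j))"
    unfolding entry_def by (rule cmod_le_s_norm) (use x in simp)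
  also have "\<dots> \<le> op_norm q x * s_dual_norm q (unit_seq j)"
    using x by (intro op_norm_bound ell2_s_dual_step) auto
  also have "\<dots> = op_norm q x / real (Suc j) ^ q" by (simp add: s_dual_norm_unit_seq)
  finally show ?thesis by (simp add: field_simps del: of_nat_Suc)
qed

lemma Lss_trunc:
  assumes "x \<in> Lss" shows "x (trunc n \<xi>) i = (\<Sum>j<n. \<xi> j * entry x i j)"
proof (induction n)
  case 0
  have "x (trunc 0 \<xi>) = 0" using assms by (simp add: trunc_0)
  then show ?case by (simp add: pointwise)
next
  case (Suc n)
  have "x (trunc (Suc n) \<xi>) = x (trunc n \<xi>) + seq_scale (\<xi> n) (x (unit_seq n))"
    using assms by (simp add: trunc_Suc Lss_add_arg Lss_scale_arg s_subset_s_dual s_scale)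
  then show ?case by (simp add: Suc entry_def seq_scale_def pointwise)
qed

text \<open>Truncations converge in the norm of a dual step, and operators are continuous there. Hence an
  operator is determined by its matrix.\<close>

lemma Lss_sums:
  assumes x: "x \<in> Lss" and \<xi>: "\<xi> \<in> s_dual"
  shows "(\<lambda>j. \<xi> j * entry x i j) sums x \<xi> i"
proof -
  obtain q where q: "\<xi> \<in> s_dual_step q" using \<xi> by (auto simp: s_dual_def)
  have "(\<lambda>n. x (trunc n \<xi>) i - x \<xi> i) \<longlonglongrightarrow> 0"
  proof (rule Lim_null_comparison)
    show "\<forall>\<^sub>F n in sequentially. norm (x (trunc n \<xi>) i - x \<xi> i) \<le> op_norm q x * s_dual_norm q (\<xi> - trunc n \<xi>)"
    proof (intro always_eventually allI)
      fix n
      have st: "\<xi> - trunc n \<xi> \<in> s_dual_step q"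
        by (rule s_dual_step_diff[OF q ell2_s_dual_step[OF s_subset_ell2[OF trunc_in_s]]])
      have "norm (x (trunc n \<xi>) i - x \<xi> i) = cmod (x (\<xi> - trunc n \<xi>) i)"
        using x \<xi> by (simp add: Lss_diff_arg s_subset_s_dual norm_minus_commute pointwise)
      also have "\<dots> \<le> ell2_norm (x (\<xi> - trunc n \<xi>))"
        using x by (intro cmod_le_ell2_norm) (auto intro: s_subset_ell2)
      also have "\<dots> \<le> s_norm q (x (\<xi> - trunc n \<xi>))" using x by (simp add: ell2_norm_le_s_norm)
      also have "\<dots> \<le> op_norm q x * s_dual_norm q (\<xi> - trunc n \<xi>)" by (rule op_norm_bound[OF x st])
      finally show "norm (x (trunc n \<xi>) i - x \<xi> i) \<le> op_norm q x * s_dual_norm q (\<xi> - trunc n \<xi>)" .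
    qed
    show "(\<lambda>n. op_norm q x * s_dual_norm q (\<xi> - trunc n \<xi>)) \<longlonglongrightarrow> 0"
      using tendsto_mult_right_zero[OF trunc_tendsto[OF q]] .
  qed
  then have "(\<lambda>n. x (trunc n \<xi>) i) \<longlonglongrightarrow> x \<xi> i" by (rule LIM_zero_cancel)
  then show ?thesis unfolding sums_def Lss_trunc[OF x] .
qed

lemma Lss_eqI:
  assumes "x \<in> Lss" "y \<in> Lss" "\<And>i j. entry x i j = entry y i j" shows "x = y"
proof
  fix \<xi> show "x \<xi> = y \<xi>"
  proof (cases "\<xi> \<in> s_dual")
    case True
    have "x \<xi> i = y \<xi> i" for i
      using Lss_sums[OF assms(1) True, of i] Lss_sums[OF assms(2) True, of i] assms(3)
        sums_unique2 by fastforce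
    then show ?thesis by blast
  qed (use assms in \<open>simp add: Lss_outside\<close>)
qed

lemma harmonic_ell2: "(\<lambda>j. 1 / of_nat (Suc j)) \<in> ell2"
  and harmonic_ell2_norm: "ell2_norm (\<lambda>j. 1 / of_nat (Suc j)) = sqrt basel"
  using basel_summable by (simp_all add: ell2_def ell2_norm_def basel_def norm_divide power_divide
      del: of_nat_Suc)

text \<open>Weighted supremum norms dominate weighted \<open>ell2\<close> norms at the price of one weight.\<close>

lemma sup_bound_ell2:
  assumes "0 \<le> C" "\<And>j. cmod (\<xi> j) * real (Suc j) ^ Suc q \<le> C"
  shows "up q \<xi> \<in> ell2" and "s_norm q \<xi> \<le> C * sqrt basel"
proof -
  have "cmod (up q \<xi> j) \<le> cmod (seq_scale (of_real C) (\<lambda>j. 1 / of_nat (Suc j)) j)" for j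
    using assms(2)[of j] assms(1)
    by (simp add: cmod_up seq_scale_def norm_mult norm_divide field_simps del: of_nat_Suc)
  from ell2_dominated[OF ell2_scale(1)[OF harmonic_ell2] this]
  show "up q \<xi> \<in> ell2" "s_norm q \<xi> \<le> C * sqrt basel"
    using assms(1) by (simp_all add: s_norm_eq ell2_scale harmonic_ell2 harmonic_ell2_norm del: of_nat_Suc)
qed

text \<open>Rows are conjugated because the pairing is sesquilinear.\<close>

definition mat_op :: "(nat \<Rightarrow> nat \<Rightarrow> complex) \<Rightarrow> cop" where
  "mat_op M \<xi> = (if \<xi> \<in> s_dual then \<lambda>i. pairing \<xi> (\<lambda>j. cnj (M i j)) else 0)"

definition rapid :: "(nat \<Rightarrow> nat \<Rightarrow> complex) \<Rightarrow> bool" where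
  "rapid M \<longleftrightarrow> (\<forall>q. \<exists>C\<ge>0. \<forall>i j. cmod (M i j) * real (Suc i) ^ q * real (Suc j) ^ q \<le> C)"

lemma rapid_row:
  assumes "0 \<le> C" "\<And>i j. cmod (M i j) * real (Suc i) ^ Suc q * real (Suc j) ^ Suc q \<le> C"
  shows "up q (\<lambda>j. cnj (M i j)) \<in> ell2"
    and "s_norm q (\<lambda>j. cnj (M i j)) \<le> C / real (Suc i) ^ Suc q * sqrt basel"
proof -
  have "0 \<le> C / real (Suc i) ^ Suc q"
    "cmod (cnj (M i j)) * real (Suc j) ^ Suc q \<le> C / real (Suc i) ^ Suc q" for j
    using assms(1) assms(2)[of i j] by (simp_all add: field_simps del: of_nat_Suc power_Suc)
  from sup_bound_ell2[OF this]
  show "up q (\<lambda>j. cnj (M i j)) \<in> ell2"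
    "s_norm q (\<lambda>j. cnj (M i j)) \<le> C / real (Suc i) ^ Suc q * sqrt basel" .
qed

lemma rapid_row_in_s: "rapid M \<Longrightarrow> (\<lambda>j. cnj (M i j)) \<in> s_space"
  unfolding s_space_eq rapid_def using rapid_row(1) by metis

lemma mat_op_bound:
  assumes M: "rapid M" and C: "0 \<le> C"
    "\<And>i j. cmod (M i j) * real (Suc i) ^ Suc q * real (Suc j) ^ Suc q \<le> C"
    and \<xi>: "\<xi> \<in> s_dual_step q"
  shows "up q (mat_op M \<xi>) \<in> ell2" and "s_norm q (mat_op M \<xi>) \<le> basel * C * s_dual_norm q \<xi>"
proof -
  have \<xi>': "\<xi> \<in> s_dual" using \<xi> by (auto simp: s_dual_def)
  let ?D = "s_dual_norm q \<xi> * C * sqrt basel"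
  have D: "0 \<le> ?D" using \<xi> C basel_nonneg by simp
  have "cmod (mat_op M \<xi> i) * real (Suc i) ^ Suc q \<le> ?D" for i
  proof -
    have "cmod (mat_op M \<xi> i) \<le> s_dual_norm q \<xi> * s_norm q (\<lambda>j. cnj (M i j))"
      using s_dual_s_pairing(2)[OF \<xi> rapid_row_in_s[OF M]] \<xi>' by (simp add: mat_op_def)
    also have "\<dots> \<le> s_dual_norm q \<xi> * (C / real (Suc i) ^ Suc q * sqrt basel)"
      using \<xi> rapid_row(2)[OF C] by (intro mult_left_mono) auto
    finally show ?thesis by (simp add: field_simps del: of_nat_Suc power_Suc)
  qed
  from sup_bound_ell2[OF D this]
  show "up q (mat_op M \<xi>) \<in> ell2" "s_norm q (mat_op M \<xi>) \<le> basel * C * s_dual_norm q \<xi>"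
    using basel_nonneg by (simp_all add: mult_ac flip: mult.assoc[of "sqrt basel" "sqrt basel"])
qed

lemma mat_op:
  assumes M: "rapid M"
  shows "mat_op M \<in> Lss" and "entry (mat_op M) i j = M i j"
proof -
  have row: "(\<lambda>j. cnj (M i j)) \<in> s_space" for i using rapid_row_in_s[OF M] .
  have scale_pw: "seq_scale c (\<lambda>i. g i) i = c * g i" for c g i by (simp add: seq_scale_def)
  show "mat_op M \<in> Lss"
  proof (rule LssI)
    fix q
    obtain C where C: "C \<ge> 0" "\<And>i j. cmod (M i j) * real (Suc i) ^ Suc q * real (Suc j) ^ Suc q \<le> C"
      using M unfolding rapid_def by meson
    show "\<exists>C\<ge>0. \<forall>\<xi>\<in>s_dual_step q. s_norm q (mat_op M \<xi>) \<le> C * s_dual_norm q \<xi>"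
      using mat_op_bound(2)[OF M C] C basel_nonneg by (intro exI[of _ "basel * C"]) auto
  next
    fix \<xi> assume \<xi>: "\<xi> \<in> s_dual"
    have "up q (mat_op M \<xi>) \<in> ell2" for q
    proof -
      obtain r where r: "\<xi> \<in> s_dual_step r" using \<xi> by (auto simp: s_dual_def)
      obtain C where C: "C \<ge> 0"
        "\<And>i j. cmod (M i j) * real (Suc i) ^ Suc (max q r) * real (Suc j) ^ Suc (max q r) \<le> C"
        using M unfolding rapid_def by meson
      have "up (max q r) (mat_op M \<xi>) \<in> ell2"
        by (rule mat_op_bound(1)[OF M C s_dual_step_mono(1)[OF r]]) simp
      then show ?thesis
        by (rule ell2_dominated(1)) (auto simp: cmod_up simp del: of_nat_Suc
            intro!: mult_left_mono power_increasing)
    qed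
    then show "mat_op M \<xi> \<in> s_space" by (simp add: s_space_eq)
  qed (use row in \<open>auto simp: mat_op_def s_dual_add s_dual_scale pairing_add_left pairing_scale_left
        pairable_s_dual fun_eq_iff pointwise scale_pw\<close>)
  have "pairing (unit_seq j) (\<lambda>j. cnj (M i j)) = M i j"
    using pairing_commute[OF ell2_pairing(1)[OF s_subset_ell2[OF row] unit_seq_ell2]] by simp
  then show "entry (mat_op M) i j = M i j" by (simp add: entry_def mat_op_def s_subset_s_dual)
qed

lemma rapid_entry: "x \<in> Lss \<Longrightarrow> rapid (entry x)"
  unfolding rapid_def using entry_bound by (meson op_norm_nonneg)

lemma mat_op_entry: "x \<in> Lss \<Longrightarrow> mat_op (entry x) = x"
  by (rule Lss_eqI) (auto simp: mat_op rapid_entry)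

text \<open>Together with \<open>entry_bound\<close> this identifies the operator algebra with the rapidly decreasing
  matrices.\<close>

lemma op_norm_le_entries:
  assumes "x \<in> Lss" "0 \<le> C" "\<And>i j. cmod (entry x i j) * real (Suc i) ^ Suc q * real (Suc j) ^ Suc q \<le> C"
  shows "op_norm q x \<le> basel * C"
  using mat_op_bound(2)[OF rapid_entry[OF assms(1)] assms(2,3)] assms basel_nonneg
  by (intro op_norm_leI) (auto simp: mat_op_entry)

subsection \<open>The adjoint\<close>

text \<open>The identity holds on unit sequences by the assumption on the entries and extends by
  truncation.\<close>

lemma pairing_adjoint_entries:
  assumes x: "x \<in> Lss" and y: "y \<in> Lss" and m: "\<And>i j. entry y i j = cnj (entry x j i)"
    and \<xi>: "\<xi> \<in> ell2" and \<eta>: "\<eta> \<in> ell2"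
  shows "pairing (x \<xi>) \<eta> = pairing \<xi> (y \<eta>)"
proof -
  have l2: "z \<zeta> \<in> ell2" if "z \<in> Lss" for z \<zeta> using that by (simp add: s_subset_ell2)
  have col: "pairing (x (unit_seq j)) \<eta> = cnj (y \<eta> j)" for j
  proof -
    have "pairing \<eta> (x (unit_seq j)) = y \<eta> j"
    proof (rule pairing_eqI)
      have "(\<lambda>i. \<eta> i * entry y j i) sums y \<eta> j" by (intro Lss_sums y ell2_subset_s_dual \<eta>)
      then show "(\<lambda>i. \<eta> i * cnj (x (unit_seq j) i)) sums y \<eta> j" by (simp only: m) (simp only: entry_def)
    qed
    then show ?thesis
      using pairing_commute[OF ell2_pairing(1)[OF \<eta> l2[OF x]], of "unit_seq j"] by simp
  qed
  have tr: "pairing (x (trunc n \<xi>)) \<eta> = (\<Sum>j<n. \<xi> j * cnj (y \<eta> j))" for n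
  proof (induction n)
    case (Suc n)
    have "x (trunc (Suc n) \<xi>) = x (trunc n \<xi>) + seq_scale (\<xi> n) (x (unit_seq n))"
      using x by (simp add: trunc_Suc Lss_add_arg Lss_scale_arg s_subset_s_dual s_scale)
    then show ?case using Suc col[of n] l2[OF x] \<eta>
      by (simp add: pairing_add_left pairing_scale_left ell2_pairing ell2_scale)
  qed (use x in \<open>simp add: trunc_0\<close>)
  have "(\<lambda>n. pairing (x (trunc n \<xi>)) \<eta> - pairing (x \<xi>) \<eta>) \<longlonglongrightarrow> 0"
  proof (rule Lim_null_comparison)
    show "\<forall>\<^sub>F n in sequentially. norm (pairing (x (trunc n \<xi>)) \<eta> - pairing (x \<xi>) \<eta>)
        \<le> op_norm 0 x * s_dual_norm 0 (\<xi> - trunc n \<xi>) * ell2_norm \<eta>"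
    proof (intro always_eventually allI)
      fix n
      have t: "trunc n \<xi> \<in> ell2" by (simp add: s_subset_ell2)
      have "norm (pairing (x (trunc n \<xi>)) \<eta> - pairing (x \<xi>) \<eta>) = cmod (pairing (x (\<xi> - trunc n \<xi>)) \<eta>)"
        using x \<xi> \<eta> t l2[OF x]
        by (simp add: Lss_diff_arg ell2_subset_s_dual norm_minus_commute pairing_diff_left)
      also have "\<dots> \<le> ell2_norm (x (\<xi> - trunc n \<xi>)) * ell2_norm \<eta>"
        by (intro ell2_pairing l2 x \<eta>)
      also have "\<dots> \<le> op_norm 0 x * s_dual_norm 0 (\<xi> - trunc n \<xi>) * ell2_norm \<eta>"
        using op_norm_bound[OF x, of "\<xi> - trunc n \<xi>" 0] \<xi> t \<eta>
        by (intro mult_right_mono) (auto simp: s_norm_0 s_dual_step_0 ell2_diff)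
      finally show "norm (pairing (x (trunc n \<xi>)) \<eta> - pairing (x \<xi>) \<eta>)
        \<le> op_norm 0 x * s_dual_norm 0 (\<xi> - trunc n \<xi>) * ell2_norm \<eta>" .
    qed
    have "(\<lambda>n. s_dual_norm 0 (\<xi> - trunc n \<xi>)) \<longlonglongrightarrow> 0"
      by (rule trunc_tendsto) (use \<xi> in \<open>simp add: s_dual_step_0\<close>)
    then show "(\<lambda>n. op_norm 0 x * s_dual_norm 0 (\<xi> - trunc n \<xi>) * ell2_norm \<eta>) \<longlonglongrightarrow> 0"
      by (intro tendsto_mult_left_zero tendsto_mult_right_zero)
  qed
  then have "(\<lambda>n. pairing (x (trunc n \<xi>)) \<eta>) \<longlonglongrightarrow> pairing (x \<xi>) \<eta>" by (rule LIM_zero_cancel)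
  moreover have "(\<lambda>n. \<Sum>j<n. \<xi> j * cnj (y \<eta> j)) \<longlonglongrightarrow> pairing \<xi> (y \<eta>)"
    using pairing_sums[OF ell2_pairing(1)[OF \<xi> l2[OF y]]] unfolding sums_def .
  ultimately show ?thesis unfolding tr by (rule LIMSEQ_unique)
qed

lemma op_adjointI:
  assumes y: "y \<in> Lss" and a: "\<And>\<xi> \<eta>. \<xi> \<in> ell2 \<Longrightarrow> \<eta> \<in> ell2 \<Longrightarrow> pairing (x \<xi>) \<eta> = pairing \<xi> (y \<eta>)"
  shows "op_adjoint x = y"
  unfolding op_adjoint_def
proof (rule the_equality)
  fix z assume z: "z \<in> Lss \<and> (\<forall>\<xi>\<in>ell2. \<forall>\<eta>\<in>ell2. pairing (x \<xi>) \<eta> = pairing \<xi> (z \<eta>))"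
  have "entry w i j = cnj (pairing (unit_seq i) (w (unit_seq j)))" if "w \<in> Lss" for w i j
    using pairing_commute[of "unit_seq i" "w (unit_seq j)"] that
    by (simp add: entry_def ell2_pairing s_subset_ell2)
  then have "entry z i j = entry y i j" for i j
    using z y a by (metis unit_seq_ell2)
  with z y show "z = y" by (intro Lss_eqI) auto
qed (use assms in blast)

text \<open>The conjugate transpose of a rapidly decreasing matrix is again rapidly decreasing.\<close>

lemma op_adjoint:
  assumes x: "x \<in> Lss"
  shows op_adjoint_Lss [simp]: "op_adjoint x \<in> Lss"
    and entry_op_adjoint: "entry (op_adjoint x) i j = cnj (entry x j i)"
    and pairing_op_adjoint: "\<xi> \<in> ell2 \<Longrightarrow> \<eta> \<in> ell2 \<Longrightarrow> pairing (x \<xi>) \<eta> = pairing \<xi> (op_adjoint x \<eta>)"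
proof -
  define y where "y = mat_op (\<lambda>i j. cnj (entry x j i))"
  have "rapid (\<lambda>i j. cnj (entry x j i))"
    unfolding rapid_def
  proof
    fix q
    show "\<exists>C\<ge>0. \<forall>i j. cmod (cnj (entry x j i)) * real (Suc i) ^ q * real (Suc j) ^ q \<le> C"
    proof (intro exI[of _ "op_norm q x"] conjI allI)
      fix i j
      show "cmod (cnj (entry x j i)) * real (Suc i) ^ q * real (Suc j) ^ q \<le> op_norm q x"
        using entry_bound[OF x, of j i q] by (simp only: complex_mod_cnj mult_ac)
    qed (use x in simp)
  qed
  from mat_op[OF this] have y: "y \<in> Lss" "\<And>i j. entry y i j = cnj (entry x j i)"
    unfolding y_def by blast+
  have p: "\<xi> \<in> ell2 \<Longrightarrow> \<eta> \<in> ell2 \<Longrightarrow> pairing (x \<xi>) \<eta> = pairing \<xi> (y \<eta>)" for \<xi> \<eta>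
    by (rule pairing_adjoint_entries[OF x y])
  have e: "op_adjoint x = y" by (rule op_adjointI[OF y(1) p])
  show "op_adjoint x \<in> Lss" "entry (op_adjoint x) i j = cnj (entry x j i)"
    "\<xi> \<in> ell2 \<Longrightarrow> \<eta> \<in> ell2 \<Longrightarrow> pairing (x \<xi>) \<eta> = pairing \<xi> (op_adjoint x \<eta>)"
    unfolding e using y p by auto
qed

lemma entry_linear: "entry (x + y) i j = entry x i j + entry y i j" "entry (x - y) i j = entry x i j - entry y i j"
  "entry (op_scale c x) i j = c * entry x i j" "entry 0 i j = 0"
  by (simp_all add: entry_def pointwise seq_scale_def)

lemma entry_sum: "entry (sum x I) i j = (\<Sum>k\<in>I. entry (x k) i j)"
  by (induction I rule: infinite_finite_induct) (auto simp: entry_linear)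

lemma op_adjoint_adjoint: "x \<in> Lss \<Longrightarrow> op_adjoint (op_adjoint x) = x"
  by (rule Lss_eqI) (auto simp: entry_op_adjoint)

lemma op_adjoint_comp:
  assumes "x \<in> Lss" "y \<in> Lss" shows "op_adjoint (x \<circ> y) = op_adjoint y \<circ> op_adjoint x"
  by (rule op_adjointI) (use assms in \<open>auto simp: pairing_op_adjoint s_subset_ell2\<close>)

lemma op_adjoint_add: "x \<in> Lss \<Longrightarrow> y \<in> Lss \<Longrightarrow> op_adjoint (x + y) = op_adjoint x + op_adjoint y"
  and op_adjoint_scale: "x \<in> Lss \<Longrightarrow> op_adjoint (op_scale c x) = op_scale (cnj c) (op_adjoint x)"
  and op_adjoint_zero: "op_adjoint 0 = 0"
  by (rule Lss_eqI; simp add: entry_op_adjoint entry_linear)+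

lemma op_adjoint_diff: "x \<in> Lss \<Longrightarrow> y \<in> Lss \<Longrightarrow> op_adjoint (x - y) = op_adjoint x - op_adjoint y"
  by (rule Lss_eqI; simp add: entry_op_adjoint entry_linear)+

lemma op_adjoint_sum:
  "(\<And>i. i \<in> I \<Longrightarrow> x i \<in> Lss) \<Longrightarrow> op_adjoint (sum x I) = (\<Sum>i\<in>I. op_adjoint (x i))"
  by (induction I rule: infinite_finite_induct) (auto simp: op_adjoint_zero op_adjoint_add)

lemma ell2_norm_adjoint_comp:
  assumes x: "x \<in> Lss" and \<xi>: "\<xi> \<in> ell2"
  shows "complex_of_real ((ell2_norm (x \<xi>))\<^sup>2) = pairing (op_adjoint x (x \<xi>)) \<xi>"
proof -
  have "x \<xi> \<in> ell2" "op_adjoint x (x \<xi>) \<in> ell2" using x by (simp_all add: s_subset_ell2)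
  with x \<xi> show ?thesis
    using pairing_op_adjoint[OF op_adjoint_Lss[OF x], of "x \<xi>" \<xi>]
    by (simp add: op_adjoint_adjoint pairing_self)
qed

lemma adjoint_comp_eq_0:
  assumes x: "x \<in> Lss" and 0: "op_adjoint x \<circ> x = 0" shows "x = 0"
proof (rule Lss_eqI)
  fix i j
  have "complex_of_real ((ell2_norm (x (unit_seq j)))\<^sup>2) = pairing ((op_adjoint x \<circ> x) (unit_seq j)) (unit_seq j)"
    using ell2_norm_adjoint_comp[OF x, of "unit_seq j"] by simp
  then have "x (unit_seq j) = 0"
    unfolding 0 using x by (intro ell2_norm_eq_0) (auto simp: s_subset_ell2 op_zero_apply pairing_def[of 0] pointwise)
  then show "entry x i j = entry 0 i j" by (simp add: entry_def pointwise)
qed (use x in auto)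

subsection \<open>Convergence of operators\<close>

lemma seminorm_family_Lss: "seminorm_family Lss (range op_norm)"
  by (auto simp: seminorm_family_def op_norm_triangle)

definition op_tendsto :: "(nat \<Rightarrow> cop) \<Rightarrow> cop \<Rightarrow> bool" where
  "op_tendsto X x \<longleftrightarrow> (\<forall>q. (\<lambda>n. op_norm q (X n - x)) \<longlonglongrightarrow> 0)"

lemma op_tendsto_entry:
  assumes "op_tendsto X x" "\<And>n. X n \<in> Lss" "x \<in> Lss"
  shows "(\<lambda>n. entry (X n) i j) \<longlonglongrightarrow> entry x i j"
proof -
  have "(\<lambda>n. entry (X n) i j - entry x i j) \<longlonglongrightarrow> 0"
  proof (rule Lim_null_comparison)
    show "\<forall>\<^sub>F n in sequentially. norm (entry (X n) i j - entry x i j) \<le> op_norm 0 (X n - x)"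
      using entry_bound[of "X n - x" i j 0 for n] assms by (auto simp: entry_linear)
  qed (use assms in \<open>auto simp: op_tendsto_def\<close>)
  then show ?thesis by (rule LIM_zero_cancel)
qed

lemma op_tendsto_unique:
  assumes "op_tendsto X x" "op_tendsto X y" "\<And>n. X n \<in> Lss" "x \<in> Lss" "y \<in> Lss"
  shows "x = y"
  by (rule Lss_eqI[OF assms(4,5)],
      rule LIMSEQ_unique[OF op_tendsto_entry[OF assms(1,3,4)] op_tendsto_entry[OF assms(2,3,5)]])

lemma op_tendsto_closed:
  assumes "closedin (topol L_alg) E" "op_tendsto X x" "\<And>n. X n \<in> E" "x \<in> Lss"
  shows "x \<in> E"
proof (rule closedin_seminorm_topologyD[OF seminorm_family_Lss])
  show "closedin (seminorm_topology Lss (range op_norm)) E" using assms(1) by (simp add: L_alg_def)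
  fix F :: "(cop \<Rightarrow> real) set" and e :: real assume F: "finite F" "F \<subseteq> range op_norm" "0 < e"
  have "\<forall>\<^sub>F n in sequentially. p (X n - x) < e" if p: "p \<in> F" for p
  proof -
    obtain q where "p = op_norm q" using p F by auto
    then show ?thesis using assms(2) F(3) unfolding op_tendsto_def by (auto intro: order_tendstoD)
  qed
  then have "\<forall>\<^sub>F n in sequentially. \<forall>p\<in>F. p (X n - x) < e" using F(1) by (simp add: eventually_ball_finite)
  then show "\<exists>y\<in>E. \<forall>p\<in>F. p (y - x) < e"
    using assms(3) by (metis (mono_tags, lifting) eventually_sequentially order_refl)
qed (use assms in auto)

lemma op_tendsto_comp:
  assumes X: "op_tendsto X x" "\<And>n. X n \<in> Lss" "x \<in> Lss"
    and Y: "op_tendsto Y y" "\<And>n. Y n \<in> Lss" "y \<in> Lss"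
  shows "op_tendsto (\<lambda>n. X n \<circ> Y n) (x \<circ> y)"
  unfolding op_tendsto_def
proof
  fix q
  let ?b = "\<lambda>n. op_norm q (X n - x) * (op_norm q (Y n - y) + op_norm q y) + op_norm q x * op_norm q (Y n - y)"
  show "(\<lambda>n. op_norm q ((X n \<circ> Y n) - (x \<circ> y))) \<longlonglongrightarrow> 0"
  proof (rule Lim_null_comparison)
    show "\<forall>\<^sub>F n in sequentially. norm (op_norm q ((X n \<circ> Y n) - (x \<circ> y))) \<le> ?b n"
    proof (intro always_eventually allI)
      fix n
      note L = X(2)[of n] X(3) Y(2)[of n] Y(3)
      have e: "(X n \<circ> Y n) - (x \<circ> y) = ((X n - x) \<circ> Y n) + (x \<circ> (Y n - y))"
        using L by (simp add: comp_op_diff op_diff_comp)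
      have "op_norm q ((X n \<circ> Y n) - (x \<circ> y)) \<le> op_norm q ((X n - x) \<circ> Y n) + op_norm q (x \<circ> (Y n - y))"
        unfolding e using L by (intro op_norm_add) auto
      also have "\<dots> \<le> op_norm q (X n - x) * op_norm q (Y n) + op_norm q x * op_norm q (Y n - y)"
        using L by (intro add_mono op_norm_comp) auto
      also have "\<dots> \<le> ?b n"
        using L op_norm_add[of "Y n - y" y q] by (intro add_right_mono mult_left_mono) auto
      finally show "norm (op_norm q ((X n \<circ> Y n) - (x \<circ> y))) \<le> ?b n" using L by simp
    qed
    have "?b \<longlonglongrightarrow> 0 * (0 + op_norm q y) + op_norm q x * 0"
      using X(1) Y(1) unfolding op_tendsto_def by (intro tendsto_intros) auto
    then show "?b \<longlonglongrightarrow> 0" by simp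
  qed
qed

lemma op_tendsto_const: "op_tendsto (\<lambda>n. x) x"
  by (simp add: op_tendsto_def)

text \<open>Rapid decay makes bounded sets relatively compact: on a bounded set all but finitely many
  matrix entries are uniformly small, even after multiplication with the weights.\<close>

lemma bounded_entrywise_null:
  assumes X: "\<And>n. X n \<in> Lss" and bd: "\<And>q. \<exists>C. \<forall>n. op_norm q (X n) \<le> C"
    and lim: "\<And>i j. (\<lambda>n. entry (X n) i j) \<longlonglongrightarrow> 0"
  shows "(\<lambda>n. op_norm q (X n)) \<longlonglongrightarrow> 0"
proof (rule tendstoI)
  fix e :: real assume e: "e > 0"
  \<comment> \<open>Passing from entries to the operator norm costs the factor \<open>basel\<close>.\<close>
  define d where "d = e / (2 * (basel + 1))"
  have "0 < basel * e + e * 2" using e basel_nonneg by (intro add_nonneg_pos) auto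
  then have d: "d > 0" "basel * d < e" using e basel_nonneg unfolding d_def by (auto simp: field_simps)
  \<comment> \<open>One additional weight pays for the passage to the operator norm, the other one makes entries
     with a large index small.\<close>
  obtain C where C: "\<And>n. op_norm (Suc (Suc q)) (X n) \<le> C" using bd by blast
  have C0: "0 \<le> C" using C[of 0] op_norm_nonneg[OF X] order_trans by blast
  obtain m where m: "C / d < real m" using reals_Archimedean2 by blast
  let ?w = "\<lambda>n i j. cmod (entry (X n) i j) * real (Suc i) ^ Suc q * real (Suc j) ^ Suc q"
  have big: "?w n i j \<le> d" if "m \<le> i \<or> m \<le> j" for n i j
  proof -
    have "?w n i j * (real (Suc i) * real (Suc j)) \<le> C"
      using order_trans[OF entry_bound[OF X, of n i j "Suc (Suc q)"] C] by (simp add: mult_ac)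
    moreover have "real m \<le> real (Suc i) * real (Suc j)"
    proof -
      have "m \<le> Suc i * Suc j" using that by (auto simp: algebra_simps)
      then show ?thesis by (metis of_nat_le_iff of_nat_mult)
    qed
    ultimately have "?w n i j * real m \<le> C"
      by (meson mult_left_mono order_trans mult_nonneg_nonneg norm_ge_zero zero_le_power of_nat_0_le_iff)
    also have "C \<le> d * real m" using m d by (simp add: field_simps)
    finally have "?w n i j * real m \<le> d * real m" .
    moreover have "0 < real m" using m C0 d(1) by (meson divide_nonneg_pos le_less_trans)
    ultimately show ?thesis by (simp only: mult_le_cancel_right_pos)
  qed
  have "\<forall>\<^sub>F n in sequentially. \<forall>i\<in>{..<m}. \<forall>j\<in>{..<m}. ?w n i j < d"
  proof (intro eventually_ball_finite ballI finite_lessThan)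
    fix i j
    have "(\<lambda>n. ?w n i j) \<longlonglongrightarrow> 0"
      using tendsto_norm_zero[OF lim[of i j]] by (intro tendsto_mult_left_zero)
    then show "\<forall>\<^sub>F n in sequentially. ?w n i j < d" using d(1) by (rule order_tendstoD)
  qed
  then show "\<forall>\<^sub>F n in sequentially. dist (op_norm q (X n)) 0 < e"
  proof eventually_elim
    case (elim n)
    have "?w n i j \<le> d" for i j
    proof (cases "m \<le> i \<or> m \<le> j")
      case False
      then show ?thesis using elim by (simp add: not_le less_imp_le)
    qed (rule big)
    then have "op_norm q (X n) \<le> basel * d" using d(1) by (intro op_norm_le_entries X) auto
    then show ?case using d(2) op_norm_nonneg[OF X, of q n] by simp
  qed
qed

lemma bounded_entrywise_convergent:
  assumes X: "\<And>n. X n \<in> Lss" and bd: "\<And>q. \<exists>C. \<forall>n. op_norm q (X n) \<le> C"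
    and lim: "\<And>i j. convergent (\<lambda>n. entry (X n) i j)"
  obtains x where "x \<in> Lss" "op_tendsto X x" "\<And>i j. entry x i j = lim (\<lambda>n. entry (X n) i j)"
proof -
  define M where "M = (\<lambda>i j. lim (\<lambda>n. entry (X n) i j))"
  have M: "(\<lambda>n. entry (X n) i j) \<longlonglongrightarrow> M i j" for i j
    unfolding M_def using lim by (simp add: convergent_LIMSEQ_iff)
  have "rapid M" unfolding rapid_def
  proof
    fix q
    obtain C where C: "\<And>n. op_norm q (X n) \<le> C" using bd by blast
    have "cmod (M i j) * real (Suc i) ^ q * real (Suc j) ^ q \<le> C" for i j
    proof (rule LIMSEQ_le_const2)
      show "(\<lambda>n. cmod (entry (X n) i j) * real (Suc i) ^ q * real (Suc j) ^ q) \<longlonglongrightarrow>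
          cmod (M i j) * real (Suc i) ^ q * real (Suc j) ^ q"
        by (intro tendsto_intros M)
      show "\<exists>N. \<forall>n\<ge>N. cmod (entry (X n) i j) * real (Suc i) ^ q * real (Suc j) ^ q \<le> C"
        using entry_bound[OF X] C order_trans by blast
    qed
    moreover have "0 \<le> C" using C[of 0] op_norm_nonneg[OF X] order_trans by blast
    ultimately show "\<exists>C\<ge>0. \<forall>i j. cmod (M i j) * real (Suc i) ^ q * real (Suc j) ^ q \<le> C" by blast
  qed
  note x = mat_op[OF this]
  have "op_tendsto X (mat_op M)" unfolding op_tendsto_def
  proof
    fix q
    show "(\<lambda>n. op_norm q (X n - mat_op M)) \<longlonglongrightarrow> 0"
    proof (rule bounded_entrywise_null)
      fix r
      obtain C where C: "\<And>n. op_norm r (X n) \<le> C" using bd by blast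
      have "op_norm r (X n - mat_op M) \<le> C + op_norm r (mat_op M)" for n
        using op_norm_triangle[OF X[of n] Lss_zero x(1), of r]
          op_norm_diff_commute[OF Lss_zero x(1), of r] C[of n] by simp
      then show "\<exists>C. \<forall>n. op_norm r (X n - mat_op M) \<le> C" by blast
    next
      fix i j
      show "(\<lambda>n. entry (X n - mat_op M) i j) \<longlonglongrightarrow> 0"
        using M[of i j] by (simp add: entry_linear x LIM_zero)
    qed (use X x in auto)
  qed
  then show ?thesis using that x unfolding M_def by blast
qed

section \<open>Projections from powers of a self-adjoint operator\<close>

lemma funpow_in_Lss: "y \<in> Lss \<Longrightarrow> y ^^ Suc n \<in> Lss"
proof (induction n)
  case (Suc n)
  then have "y \<circ> y ^^ Suc n \<in> Lss" by (intro Lss_comp)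
  then show ?case by (simp only: funpow.simps)
qed simp

lemma funpow_in_ell2: "y \<in> Lss \<Longrightarrow> \<xi> \<in> ell2 \<Longrightarrow> (y ^^ n) \<xi> \<in> ell2"
  by (cases n) (auto intro: s_subset_ell2)

lemma funpow_self_adjoint:
  assumes y: "y \<in> Lss" "op_adjoint y = y" and "\<xi> \<in> ell2" "\<eta> \<in> ell2"
  shows "pairing ((y ^^ n) \<xi>) \<eta> = pairing \<xi> ((y ^^ n) \<eta>)"
  using \<open>\<eta> \<in> ell2\<close>
proof (induction n arbitrary: \<eta>)
  case (Suc n)
  have "y \<eta> \<in> ell2" using y by (simp add: s_subset_ell2)
  have "pairing ((y ^^ Suc n) \<xi>) \<eta> = pairing (y ((y ^^ n) \<xi>)) \<eta>" by simp
  also have "\<dots> = pairing ((y ^^ n) \<xi>) (y \<eta>)"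
    using pairing_op_adjoint[OF y(1) funpow_in_ell2[OF y(1) assms(3)] Suc.prems] y(2) by simp
  also have "\<dots> = pairing \<xi> ((y ^^ n) (y \<eta>))" by (rule Suc.IH) fact
  also have "(y ^^ n) (y \<eta>) = (y ^^ Suc n) \<eta>" by (simp add: funpow_swap1)
  finally show ?case .
qed simp

text \<open>The nontrivial half of the C-star identity for the operator norm on \<open>ell2\<close>.\<close>

lemma self_adjoint_square_norm:
  assumes y: "y \<in> Lss" "op_adjoint y = y"
  shows "(op_norm 0 y)\<^sup>2 \<le> op_norm 0 (y \<circ> y)"
proof -
  have yy0: "0 \<le> op_norm 0 (y \<circ> y)" using y by simp
  have "op_norm 0 y \<le> sqrt (op_norm 0 (y \<circ> y))"
  proof (rule op_norm_leI)
    fix \<xi> assume "\<xi> \<in> s_dual_step 0"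
    then have \<xi>: "\<xi> \<in> ell2" by (simp add: s_dual_step_0)
    have yy: "(y \<circ> y) \<xi> \<in> ell2" using y by (simp add: s_subset_ell2)
    have "(ell2_norm (y \<xi>))\<^sup>2 = cmod (pairing ((y \<circ> y) \<xi>) \<xi>)"
      using ell2_norm_adjoint_comp[OF y(1) \<xi>] y(2)
      by (metis comp_apply norm_of_real abs_of_nonneg zero_le_power2)
    also have "\<dots> \<le> ell2_norm ((y \<circ> y) \<xi>) * ell2_norm \<xi>" using yy \<xi> by (rule ell2_pairing)
    also have "\<dots> \<le> (op_norm 0 (y \<circ> y) * ell2_norm \<xi>) * ell2_norm \<xi>"
      using op_norm_bound_ell2[OF Lss_comp(1)[OF y(1) y(1)] \<xi>, of 0] \<xi>
      by (intro mult_right_mono) (auto simp: s_norm_0)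
    also have "\<dots> = (sqrt (op_norm 0 (y \<circ> y)) * ell2_norm \<xi>)\<^sup>2"
      using yy0
      by (simp add: power_mult_distrib power2_eq_square[of "ell2_norm \<xi>"])
    finally show "s_norm 0 (y \<xi>) \<le> sqrt (op_norm 0 (y \<circ> y)) * s_dual_norm 0 \<xi>"
      unfolding s_norm_0 s_dual_norm_0
      by (rule power2_le_imp_le) (use \<xi> y yy0 in auto)
  qed (use yy0 in simp)
  then have "(op_norm 0 y)\<^sup>2 \<le> (sqrt (op_norm 0 (y \<circ> y)))\<^sup>2" using y by (intro power_mono) auto
  then show ?thesis using yy0 by simp
qed

lemma funpow_adjoint:
  assumes y: "y \<in> Lss" "op_adjoint y = y" shows "op_adjoint (y ^^ Suc n) = y ^^ Suc n"
  by (rule op_adjointI[OF funpow_in_Lss[OF y(1)] funpow_self_adjoint[OF y]])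

lemma funpow_norm_power_two:
  assumes y: "y \<in> Lss" "op_adjoint y = y" "op_norm 0 y = 1"
  shows "1 \<le> op_norm 0 (y ^^ (2 ^ k))"
proof (induction k)
  case (Suc k)
  obtain m where m: "2 ^ k = Suc m" by (metis gr0_conv_Suc pos2 zero_less_power)
  let ?z = "y ^^ (2 ^ k)"
  have "?z \<in> Lss" "op_adjoint ?z = ?z" unfolding m using y by (simp_all only: funpow_in_Lss funpow_adjoint)
  then have "(op_norm 0 ?z)\<^sup>2 \<le> op_norm 0 (?z \<circ> ?z)" by (rule self_adjoint_square_norm)
  also have "?z \<circ> ?z = y ^^ (2 ^ Suc k)" by (simp add: funpow_add mult_2)
  finally show ?case using Suc.IH one_le_power[of "op_norm 0 ?z" 2] by linarith
qed (use y in simp)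

text \<open>The squared norms of $y^n \xi$ decrease, hence converge, and self-adjointness expresses the distance
  of two even powers through them.\<close>

lemma funpow_even_Cauchy:
  assumes y: "y \<in> Lss" "op_adjoint y = y" "op_norm 0 y \<le> 1" and \<xi>: "\<xi> \<in> ell2"
  shows "Cauchy (\<lambda>n. (y ^^ (2 * n)) \<xi> i)"
proof -
  define g where "g n = (ell2_norm ((y ^^ n) \<xi>))\<^sup>2" for n
  have l2: "(y ^^ n) \<xi> \<in> ell2" for n using y \<xi> by (simp add: funpow_in_ell2)
  have dec: "g (Suc n) \<le> g n" for n
  proof -
    have "ell2_norm (y ((y ^^ n) \<xi>)) \<le> op_norm 0 y * ell2_norm ((y ^^ n) \<xi>)"
      using op_norm_bound_ell2[OF y(1) l2, of 0 n] by (simp add: s_norm_0)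
    also have "\<dots> \<le> ell2_norm ((y ^^ n) \<xi>)" using y(3) l2 by (simp add: mult_left_le_one_le y)
    finally show ?thesis unfolding g_def using y l2[of "Suc n"] by (intro power_mono) auto
  qed
  have "decseq g" using dec by (rule decseq_SucI)
  then have "convergent g" using decseq_convergent[of g 0] unfolding convergent_def
    by (auto simp: g_def)
  then have "Cauchy g" by (rule convergent_Cauchy)
  have ip: "pairing ((y ^^ (2 * a)) \<xi>) ((y ^^ (2 * b)) \<xi>) = of_real (g (a + b))" for a b
  proof -
    have "pairing ((y ^^ (2 * a)) \<xi>) ((y ^^ (2 * b)) \<xi>) = pairing \<xi> ((y ^^ (2 * a)) ((y ^^ (2 * b)) \<xi>))"
      by (intro funpow_self_adjoint y \<xi> l2)
    also have "(y ^^ (2 * a)) ((y ^^ (2 * b)) \<xi>) = (y ^^ (2 * a + 2 * b)) \<xi>" by (simp add: funpow_add)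
    also have "2 * a + 2 * b = (a + b) + (a + b)" by simp
    also have "(y ^^ ((a + b) + (a + b))) \<xi> = (y ^^ (a + b)) ((y ^^ (a + b)) \<xi>)"
      by (subst funpow_add) simp
    also have "pairing \<xi> \<dots> = pairing ((y ^^ (a + b)) \<xi>) ((y ^^ (a + b)) \<xi>)"
      by (intro funpow_self_adjoint[symmetric] y \<xi> l2)
    finally show ?thesis unfolding g_def using l2 by (simp only: pairing_self)
  qed
  have diff: "(cmod ((y ^^ (2 * a)) \<xi> i - (y ^^ (2 * b)) \<xi> i))\<^sup>2 \<le> g (a + a) - g (a + b) - (g (b + a) - g (b + b))"
    for a b
  proof -
    let ?d = "(y ^^ (2 * a)) \<xi> - (y ^^ (2 * b)) \<xi>"
    have d: "?d \<in> ell2" using l2 by (simp add: ell2_diff)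
    have "complex_of_real ((ell2_norm ?d)\<^sup>2) = pairing ?d ?d" using d by (rule pairing_self[symmetric])
    also have "\<dots> = of_real (g (a + a) - g (a + b) - (g (b + a) - g (b + b)))"
      using l2 d by (subst pairing_diff_left) (simp_all add: pairing_diff_right ip)
    finally have "(ell2_norm ?d)\<^sup>2 = g (a + a) - g (a + b) - (g (b + a) - g (b + b))"
      by (simp only: of_real_eq_iff)
    moreover have "(cmod (?d i))\<^sup>2 \<le> (ell2_norm ?d)\<^sup>2"
      by (intro power_mono cmod_le_ell2_norm[OF d]) simp
    ultimately show ?thesis by (simp only: minus_apply)
  qed
  show ?thesis
  proof (rule CauchyI)
    fix e :: real assume e: "e > 0"
    then have "e\<^sup>2 / 2 > 0" by simp
    then obtain M where M: "\<And>m n. M \<le> m \<Longrightarrow> M \<le> n \<Longrightarrow> norm (g m - g n) < e\<^sup>2 / 2"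
      using CauchyD[OF \<open>Cauchy g\<close>] by meson
    have "norm ((y ^^ (2 * m)) \<xi> i - (y ^^ (2 * n)) \<xi> i) < e" if "M \<le> m" "M \<le> n" for m n
    proof -
      have "norm (g (m + m) - g (m + n)) < e\<^sup>2 / 2" "norm (g (n + m) - g (n + n)) < e\<^sup>2 / 2"
        by (rule M; use that in simp)+
      then have "(cmod ((y ^^ (2 * m)) \<xi> i - (y ^^ (2 * n)) \<xi> i))\<^sup>2 < e\<^sup>2"
        using diff[of m n] unfolding real_norm_def by linarith
      then show ?thesis using e by (simp add: power2_less_imp_less)
    qed
    then show "\<exists>M. \<forall>m\<ge>M. \<forall>n\<ge>M. norm ((y ^^ (2 * m)) \<xi> i - (y ^^ (2 * n)) \<xi> i) < e" by blast
  qed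
qed

text \<open>The outer factors of $y \, y^n \, y$ supply the weights and the inner power is a contraction.\<close>

lemma op_norm_funpow:
  assumes y: "y \<in> Lss" "op_norm 0 y \<le> 1"
  shows "op_norm q (y ^^ Suc (Suc n)) \<le> op_norm q y * op_norm q y"
proof (rule op_norm_leI)
  fix \<xi> assume \<xi>: "\<xi> \<in> s_dual_step q"
  have y2: "y \<eta> \<in> ell2" for \<eta> using y by (simp add: s_subset_ell2)
  have contr: "ell2_norm ((y ^^ n) \<eta>) \<le> ell2_norm \<eta>" if "\<eta> \<in> ell2" for n \<eta>
  proof (induction n)
    case (Suc n)
    have l2: "(y ^^ n) \<eta> \<in> ell2" using y that by (simp add: funpow_in_ell2)
    have "ell2_norm (y ((y ^^ n) \<eta>)) \<le> op_norm 0 y * ell2_norm ((y ^^ n) \<eta>)"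
      using op_norm_bound_ell2[OF y(1) l2, of 0] by (simp add: s_norm_0)
    also have "\<dots> \<le> ell2_norm ((y ^^ n) \<eta>)" using y l2 by (simp add: mult_left_le_one_le)
    finally show ?case using Suc by simp
  qed simp
  have "s_norm q ((y ^^ Suc (Suc n)) \<xi>) = s_norm q (y ((y ^^ n) (y \<xi>)))" by (simp add: funpow_swap1)
  also have "\<dots> \<le> op_norm q y * ell2_norm ((y ^^ n) (y \<xi>))"
    using y y2 by (intro op_norm_bound_ell2 funpow_in_ell2)
  also have "\<dots> \<le> op_norm q y * ell2_norm (y \<xi>)" using y y2 by (intro mult_left_mono contr) auto
  also have "\<dots> \<le> op_norm q y * s_norm q (y \<xi>)" using y by (intro mult_left_mono ell2_norm_le_s_norm) auto
  also have "\<dots> \<le> op_norm q y * (op_norm q y * s_dual_norm q \<xi>)"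
    using y \<xi> by (intro mult_left_mono op_norm_bound) auto
  finally show "s_norm q ((y ^^ Suc (Suc n)) \<xi>) \<le> op_norm q y * op_norm q y * s_dual_norm q \<xi>"
    by (simp add: mult.assoc)
qed (use y in simp)

text \<open>The even powers of a self-adjoint contraction of norm one decrease to the projection onto
  the eigenspaces for \<open>1\<close> and \<open>-1\<close>; as they factor as $y\,y^n\,y$ and \<open>y\<close> is
  smoothing, the convergence takes place in the operator algebra. The limit does not vanish,
  because all powers of \<open>y\<close> with exponent $2^k$ have norm one.\<close>

lemma even_powers_limit:
  assumes y: "y \<in> Lss" "op_adjoint y = y" "op_norm 0 y = 1"
  obtains R where "R \<in> Lss" "R \<noteq> 0" "R \<circ> R = R" "op_adjoint R = R" "y \<circ> y \<circ> R = R"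
    "op_tendsto (\<lambda>n. y ^^ (2 * n + 2)) R"
proof -
  define X where "X n = y ^^ (2 * n + 2)" for n
  have X: "X n \<in> Lss" for n unfolding X_def using funpow_in_Lss[OF y(1), of "2 * n + 1"] by simp
  have "\<exists>C. \<forall>n. op_norm q (X n) \<le> C" for q
    unfolding X_def using op_norm_funpow[of y q] y by auto
  moreover have "convergent (\<lambda>n. entry (X n) i j)" for i j
  proof -
    have "Cauchy (\<lambda>n. (y ^^ (2 * n)) (unit_seq j) i)"
      by (rule funpow_even_Cauchy) (use y in auto)
    then have "convergent (\<lambda>n. (y ^^ (2 * Suc n)) (unit_seq j) i)"
      by (subst convergent_Suc_iff) (rule Cauchy_convergent)
    then show ?thesis by (simp add: X_def entry_def)
  qed
  ultimately obtain R where R: "R \<in> Lss" "op_tendsto X R" "\<And>i j. entry R i j = lim (\<lambda>n. entry (X n) i j)"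
    using bounded_entrywise_convergent[of X] X by blast
  have sub: "op_tendsto (\<lambda>n. X (f n)) R" if "filterlim f at_top sequentially" for f
    using R(2) that unfolding op_tendsto_def by (auto intro: filterlim_compose)
  have adj: "op_adjoint R = R"
  proof (rule Lss_eqI)
    fix i j
    have "(\<lambda>n. cnj (entry (X n) j i)) \<longlonglongrightarrow> cnj (entry R j i)"
      by (intro tendsto_cnj op_tendsto_entry R X)
    moreover have "cnj (entry (X n) j i) = entry (X n) i j" for n
      using entry_op_adjoint[OF X[of n], of i j] funpow_adjoint[OF y(1,2), of "2 * n + 1"] by (simp add: X_def)
    ultimately have "entry R i j = cnj (entry R j i)"
      using op_tendsto_entry[OF R(2) X R(1), of i j] by (auto intro: LIMSEQ_unique)
    then show "entry (op_adjoint R) i j = entry R i j" by (simp add: entry_op_adjoint R)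
  qed (use R in auto)
  have "op_tendsto (\<lambda>n. X n \<circ> X n) (R \<circ> R)" by (intro op_tendsto_comp R X)
  moreover have "X n \<circ> X n = X (2 * n + 1)" for n
  proof -
    have "X n \<circ> X n = y ^^ ((2 * n + 2) + (2 * n + 2))" unfolding X_def by (simp only: funpow_add)
    also have "(2 * n + 2) + (2 * n + 2) = 2 * (2 * n + 1) + 2" by simp
    finally show ?thesis by (simp only: X_def)
  qed
  moreover have "op_tendsto (\<lambda>n. X (2 * n + 1)) R"
    by (intro sub filterlim_subseq) (auto simp: strict_mono_def)
  ultimately have idem: "R \<circ> R = R"
    using X R by (intro op_tendsto_unique[of "\<lambda>n. X n \<circ> X n"]) auto
  have "op_tendsto (\<lambda>n. (y \<circ> y) \<circ> X n) ((y \<circ> y) \<circ> R)"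
    using y by (intro op_tendsto_comp op_tendsto_const R X) auto
  moreover have "(y \<circ> y) \<circ> X n = X (n + 1)" for n by (simp add: X_def fun_eq_iff)
  moreover have "op_tendsto (\<lambda>n. X (n + 1)) R"
    by (intro sub filterlim_subseq) (auto simp: strict_mono_def)
  ultimately have yyR: "(y \<circ> y) \<circ> R = R"
    using X R y by (intro op_tendsto_unique[of "\<lambda>n. (y \<circ> y) \<circ> X n"]) auto
  have "R \<noteq> 0"
  proof
    assume "R = 0"
    then have "(\<lambda>n. op_norm 0 (X n)) \<longlonglongrightarrow> 0" using R(2) by (simp add: op_tendsto_def)
    then have "\<forall>\<^sub>F n in sequentially. op_norm 0 (X n) < 1" by (rule order_tendstoD) simp
    then obtain N where N: "\<And>n. n \<ge> N \<Longrightarrow> op_norm 0 (X n) < 1" by (auto simp: eventually_sequentially)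
    have "N < 2 ^ N" by (rule less_exp)
    then have "N \<le> 2 ^ N - 1" by linarith
    then have "op_norm 0 (X (2 ^ N - 1)) < 1" by (rule N)
    moreover have "X (2 ^ N - 1) = y ^^ (2 ^ Suc N)"
    proof -
      have "(1::nat) \<le> 2 ^ N" by simp
      then have "2 * (2 ^ N - 1) + 2 = (2 ^ Suc N :: nat)" unfolding power_Suc by linarith
      then show ?thesis unfolding X_def by (rule arg_cong)
    qed
    ultimately show False using funpow_norm_power_two[OF y, of "Suc N"] by simp
  qed
  then show ?thesis using that R adj idem yyR unfolding X_def by blast
qed

lemma op_norm_0_eq_0:
  assumes "x \<in> Lss" "op_norm 0 x = 0" shows "x = 0"
proof (rule Lss_eqI)
  fix i j show "entry x i j = entry 0 i j"
    using entry_bound[OF assms(1), of i j 0] assms(2) by (simp add: entry_linear)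
qed (use assms in auto)

section \<open>Spectral projections in closed subalgebras\<close>

locale closed_subalgebra =
  fixes E :: "cop set"
  assumes closed_star_subalgebra: "closed_star_subalgebra L_alg E"
begin

lemma E_Lss: "x \<in> E \<Longrightarrow> x \<in> Lss"
  and E_zero [simp]: "0 \<in> E"
  and E_add: "x \<in> E \<Longrightarrow> y \<in> E \<Longrightarrow> x + y \<in> E"
  and E_comp: "x \<in> E \<Longrightarrow> y \<in> E \<Longrightarrow> x \<circ> y \<in> E"
  and E_scale: "x \<in> E \<Longrightarrow> op_scale c x \<in> E"
  and E_adjoint: "x \<in> E \<Longrightarrow> op_adjoint x \<in> E"
  and E_closed: "closedin (topol L_alg) E"
  using closed_star_subalgebra unfolding closed_star_subalgebra_def
  by (auto simp: L_alg_def op_scale_def)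

lemma E_diff: "x \<in> E \<Longrightarrow> y \<in> E \<Longrightarrow> x - y \<in> E"
  by (simp add: op_diff_eq E_add E_scale)

lemma E_sum: "(\<And>i. i \<in> I \<Longrightarrow> x i \<in> E) \<Longrightarrow> sum x I \<in> E"
  by (induction I rule: infinite_finite_induct) (auto simp: E_add)

lemma E_funpow: "x \<in> E \<Longrightarrow> x ^^ Suc n \<in> E"
proof (induction n)
  case (Suc n)
  then have "x \<circ> x ^^ Suc n \<in> E" by (intro E_comp)
  then show ?case by (simp only: funpow.simps)
qed simp

abbreviation projections :: "cop set" where "projections \<equiv> nonzero_projections_in L_alg E"
abbreviation minimals :: "cop set" where "minimals \<equiv> minimal_projections_in L_alg E"

lemma projections_iff: "P \<in> projections \<longleftrightarrow> P \<in> E \<and> P \<noteq> 0 \<and> P \<circ> P = P \<and> op_adjoint P = P"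
  by (simp add: nonzero_projections_in_def L_alg_def)

lemma minimals_iff: "P \<in> minimals \<longleftrightarrow>
    P \<in> projections \<and> (\<forall>Q\<in>projections. Q \<circ> P = Q \<longrightarrow> Q = P)"
  by (auto simp: minimal_projections_in_def L_alg_def)

text \<open>The projections of a closed subalgebra arise as limits of even powers of a normalized
  self-adjoint element. The last two properties transfer relations of \<open>y\<close> to the projection.\<close>

lemma spectral_projection:
  assumes y: "y \<in> E" "op_adjoint y = y" "y \<noteq> 0"
  obtains R c where "R \<in> projections" "c > (0::real)" "y \<circ> y \<circ> R = op_scale (of_real (c\<^sup>2)) R"
    "\<And>z. z \<in> Lss \<Longrightarrow> y \<circ> z = 0 \<Longrightarrow> R \<circ> z = 0"
    "\<And>z. z \<in> Lss \<Longrightarrow> y \<circ> z = y \<Longrightarrow> R \<circ> z = R"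
proof -
  note yL = E_Lss[OF y(1)]
  define c where "c = op_norm 0 y"
  have c: "c > 0" using op_norm_0_eq_0[OF yL] op_norm_nonneg[OF yL, of 0] y(3) unfolding c_def by fastforce
  define z where "z = op_scale (of_real (1 / c)) y"
  have z: "z \<in> E" "op_adjoint z = z" "op_norm 0 z = 1"
    unfolding z_def using y yL c by (simp_all add: E_scale op_adjoint_scale op_norm_scale norm_divide c_def)
  have yz: "y = op_scale (of_real c) z"
    by (rule ext) (use c in \<open>simp add: z_def seq_scale_scale\<close>)
  note zL = E_Lss[OF z(1)]
  obtain R where R: "R \<in> Lss" "R \<noteq> 0" "R \<circ> R = R" "op_adjoint R = R" "z \<circ> z \<circ> R = R"
    "op_tendsto (\<lambda>n. z ^^ (2 * n + 2)) R"
    using even_powers_limit[OF zL z(2,3)] .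
  have XE: "z ^^ (2 * n + 2) \<in> E" for n using E_funpow[OF z(1), of "2 * n + 1"] by simp
  have "R \<in> E" by (rule op_tendsto_closed[OF E_closed R(6) XE R(1)])
  then have 1: "R \<in> projections" using R by (simp add: projections_iff)
  have 2: "y \<circ> y \<circ> R = op_scale (of_real (c\<^sup>2)) R"
  proof -
    have "y \<circ> y \<circ> R = op_scale (of_real c) (op_scale (of_real c) (z \<circ> z \<circ> R))"
      unfolding yz using zL R(1) by (simp add: op_scale_comp comp_op_scale)
    also have "\<dots> = op_scale (of_real (c\<^sup>2)) R"
      unfolding R(5) by (rule ext) (simp add: seq_scale_scale power2_eq_square)
    finally show ?thesis .
  qed
  have lim: "op_tendsto (\<lambda>n. z ^^ (2 * n + 2) \<circ> w) (R \<circ> w)" if "w \<in> Lss" for w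
    using op_tendsto_comp[OF R(6) E_Lss[OF XE] R(1) op_tendsto_const that that] .
  have shift: "z ^^ (2 * n + 2) \<circ> w = z ^^ (2 * n + 1) \<circ> (z \<circ> w)" for n w
    by (rule ext) (simp add: funpow_swap1)
  have zw: "z \<circ> w = op_scale (of_real (1 / c)) (y \<circ> w)" for w by (simp add: z_def op_scale_comp)
  have 3: "R \<circ> w = 0" if w: "w \<in> Lss" "y \<circ> w = 0" for w
  proof (rule op_tendsto_unique[OF lim[OF w(1)]])
    have "z \<circ> w = 0" by (rule ext) (simp add: zw w op_zero_apply)
    then have "z ^^ (2 * n + 2) \<circ> w = 0" for n
      unfolding shift using funpow_in_Lss[OF zL, of "2 * n"] by simp
    then show "op_tendsto (\<lambda>n. z ^^ (2 * n + 2) \<circ> w) 0" by (simp add: op_tendsto_const)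
  qed (use w R E_Lss[OF XE] in auto)
  have 4: "R \<circ> w = R" if w: "w \<in> Lss" "y \<circ> w = y" for w
  proof (rule op_tendsto_unique[OF lim[OF w(1)]])
    have "z \<circ> w = z" unfolding zw w(2) by (simp add: z_def)
    then have "z ^^ (2 * n + 2) \<circ> w = z ^^ (2 * n + 1) \<circ> z" for n
      unfolding shift by simp
    then have "z ^^ (2 * n + 2) \<circ> w = z ^^ (2 * n + 2)" for n
      by (simp add: fun_eq_iff funpow_swap1)
    then show "op_tendsto (\<lambda>n. z ^^ (2 * n + 2) \<circ> w) R" using R(6) by simp
  qed (use w R E_Lss[OF XE] in auto)
  show ?thesis using that 1 c 2 3 4 by blast
qed

end

section \<open>Finite-dimensional range of projections\<close>

definition op_trace :: "cop \<Rightarrow> real" where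
  "op_trace x = (\<Sum>j. Re (entry x j j))"

lemma op_trace_sums: assumes "x \<in> Lss" shows "(\<lambda>j. Re (entry x j j)) sums op_trace x"
proof -
  have "norm (Re (entry x j j)) \<le> op_norm 1 x * (1 / real (Suc j) ^ 2)" for j
  proof -
    have "cmod (entry x j j) * real (Suc j) ^ 2 \<le> op_norm 1 x"
      using entry_bound[OF assms, of j j 1] by (simp add: power2_eq_square mult.assoc del: of_nat_Suc)
    then have "cmod (entry x j j) \<le> op_norm 1 x * (1 / real (Suc j) ^ 2)"
      by (simp add: field_simps del: of_nat_Suc)
    then show ?thesis using abs_Re_le_cmod[of "entry x j j"] by simp
  qed
  then have "summable (\<lambda>j. Re (entry x j j))"
    by (intro summable_comparison_test'[OF summable_mult[OF basel_summable]])
  then show ?thesis unfolding op_trace_def by (rule summable_sums)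
qed

lemma op_trace_diff: "x \<in> Lss \<Longrightarrow> y \<in> Lss \<Longrightarrow> op_trace (x - y) = op_trace x - op_trace y"
  using sums_diff[OF op_trace_sums op_trace_sums] op_trace_sums[of "x - y"]
  by (simp add: entry_linear sums_iff)

lemma projection_entry:
  assumes P: "P \<in> Lss" "P \<circ> P = P" "op_adjoint P = P"
  shows "Re (entry P j j) = (ell2_norm (P (unit_seq j)))\<^sup>2"
proof -
  have "complex_of_real ((ell2_norm (P (unit_seq j)))\<^sup>2) = pairing ((P \<circ> P) (unit_seq j)) (unit_seq j)"
    using ell2_norm_adjoint_comp[OF P(1), of "unit_seq j"] P(3) by simp
  then have "complex_of_real ((ell2_norm (P (unit_seq j)))\<^sup>2) = entry P j j"
    unfolding P(2) by (simp add: entry_def)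
  then show ?thesis by (metis Re_complex_of_real)
qed

text \<open>Bessel's inequality at the columns of a projection, summed over all columns.\<close>

lemma card_le_op_trace:
  assumes P: "P \<in> Lss" "P \<circ> P = P" "op_adjoint P = P"
    and F: "finite F" "orthonormal_on F (\<lambda>f. f)" "\<And>f. f \<in> F \<Longrightarrow> P f = f"
  shows "real (card F) \<le> op_trace P"
proof -
  have l2: "f \<in> ell2" if "f \<in> F" for f using F(2) that by (simp add: orthonormal_on_def)
  have "(\<lambda>j. \<Sum>f\<in>F. (cmod (f j))\<^sup>2) sums (\<Sum>f\<in>F. (ell2_norm f)\<^sup>2)"
    by (intro sums_sum ell2_norm_sums l2)
  also have "(\<Sum>f\<in>F. (ell2_norm f)\<^sup>2) = real (card F)" using orthonormal_on_norm[OF F(2)] by simp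
  finally have 1: "(\<lambda>j. \<Sum>f\<in>F. (cmod (f j))\<^sup>2) sums real (card F)" .
  have 2: "(\<Sum>f\<in>F. (cmod (f j))\<^sup>2) \<le> Re (entry P j j)" for j
  proof -
    let ?p = "P (unit_seq j)"
    have p: "?p \<in> ell2" using P by (simp add: s_subset_ell2)
    have "cmod (f j) = cmod (pairing ?p f)" if f: "f \<in> F" for f
    proof -
      have "pairing (P f) (unit_seq j) = pairing f ?p"
        using pairing_op_adjoint[OF P(1) l2[OF f], of "unit_seq j"] P(3) by simp
      then have "f j = pairing f ?p" using F(3)[OF f] by simp
      then show ?thesis using pairing_commute[OF ell2_pairing(1)[OF p l2[OF f]]] by simp
    qed
    then have "(\<Sum>f\<in>F. (cmod (f j))\<^sup>2) = (\<Sum>f\<in>F. (cmod (pairing ?p f))\<^sup>2)" by simp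
    also have "\<dots> \<le> (ell2_norm ?p)\<^sup>2" by (rule bessel_inequality[OF F(1,2) p])
    finally show ?thesis by (simp add: projection_entry[OF P])
  qed
  show ?thesis by (rule sums_le[OF 2 1 op_trace_sums[OF P(1)]])
qed

text \<open>Used to enlarge orthonormal subsets of the range of \<open>P\<close>.\<close>

lemma normalize_in_range:
  assumes P: "P \<in> Lss" and g: "g \<in> s_space" "P g = g" "g \<noteq> 0"
  obtains h c where "h = seq_scale c g" "h \<in> s_space" "P h = h" "ell2_norm h = 1" "pairing h h = 1"
proof -
  have "ell2_norm g \<noteq> 0" using ell2_norm_eq_0[OF s_subset_ell2[OF g(1)]] g(3) by blast
  then have n: "ell2_norm g > 0" using ell2_norm_nonneg[OF s_subset_ell2[OF g(1)]] by linarith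
  define h where "h = seq_scale (of_real (1 / ell2_norm g)) g"
  have h: "h \<in> s_space" "P h = h" "ell2_norm h = 1"
    unfolding h_def using P g n
    by (simp_all add: s_scale Lss_scale_arg s_subset_s_dual ell2_scale s_subset_ell2 norm_divide)
  then have "pairing h h = 1" using pairing_self[OF s_subset_ell2[OF h(1)]] by simp
  with h h_def that show ?thesis by blast
qed

lemma op_trace_ge_1:
  assumes P: "P \<in> Lss" "P \<circ> P = P" "op_adjoint P = P" "P \<noteq> 0"
  shows "1 \<le> op_trace P"
proof -
  obtain j where j: "P (unit_seq j) \<noteq> 0"
    using Lss_eqI[OF P(1) Lss_zero] P(4) by (metis entry_def op_zero_apply)
  have "P (P (unit_seq j)) = P (unit_seq j)" using P(2) by (metis comp_apply)
  from normalize_in_range[OF P(1) Lss_in_s[OF P(1)] this j]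
  obtain h where h: "h \<in> s_space" "P h = h" "pairing h h = 1" by metis
  have "real (card {h}) \<le> op_trace P"
    using h by (intro card_le_op_trace P) (auto simp: orthonormal_on_def s_subset_ell2)
  then show ?thesis by simp
qed

lemma rank_one:
  assumes f: "f \<in> s_space"
  shows rank_one_Lss: "rank_one f \<in> Lss" and op_norm_rank_one: "op_norm q (rank_one f) \<le> (s_norm q f)\<^sup>2"
    and entry_rank_one: "entry (rank_one f) i j = f i * cnj (f j)"
    and op_adjoint_rank_one: "op_adjoint (rank_one f) = rank_one f"
proof -
  have b: "s_norm q (rank_one f \<xi>) \<le> (s_norm q f)\<^sup>2 * s_dual_norm q \<xi>" if "\<xi> \<in> s_dual_step q" for q \<xi>
  proof -
    have "\<xi> \<in> s_dual" using that by (auto simp: s_dual_def)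
    then have "s_norm q (rank_one f \<xi>) = cmod (pairing \<xi> f) * s_norm q f"
      using f by (simp add: rank_one_def s_norm_scale)
    also have "\<dots> \<le> (s_dual_norm q \<xi> * s_norm q f) * s_norm q f"
      using f that by (intro mult_right_mono s_dual_s_pairing) auto
    finally show ?thesis by (simp add: power2_eq_square mult_ac)
  qed
  show L: "rank_one f \<in> Lss"
  proof (rule LssI)
    show "\<exists>C\<ge>0. \<forall>\<xi>\<in>s_dual_step q. s_norm q (rank_one f \<xi>) \<le> C * s_dual_norm q \<xi>" for q
      using b by (intro exI[of _ "(s_norm q f)\<^sup>2"]) auto
  qed (use f in \<open>auto simp: rank_one_def s_dual_add s_dual_scale pairing_add_left pairing_scale_left
      pairable_s_dual seq_scale_add_left seq_scale_scale s_scale\<close>)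
  show "op_norm q (rank_one f) \<le> (s_norm q f)\<^sup>2" using b by (intro op_norm_leI) auto
  have "pairing (unit_seq j) f = cnj (f j)" for j
    using pairing_commute[OF ell2_pairing(1)[OF s_subset_ell2[OF f] unit_seq_ell2]] by simp
  then show e: "entry (rank_one f) i j = f i * cnj (f j)" for i j
    by (simp add: entry_def rank_one_def s_subset_s_dual seq_scale_def)
  show "op_adjoint (rank_one f) = rank_one f"
    by (rule Lss_eqI) (use L in \<open>simp_all add: entry_op_adjoint e\<close>)
qed

text \<open>An orthonormal set of maximal cardinality in the range spans it; the trace bounds the
  cardinality.\<close>

lemma projection_finite_rank:
  assumes P: "P \<in> Lss" "P \<circ> P = P" "op_adjoint P = P"
  obtains F where "finite F" "F \<subseteq> s_space" "orthonormal_on F (\<lambda>f. f)" "P = sum rank_one F"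
    "\<And>f. f \<in> F \<Longrightarrow> P f = f"
proof -
  define good where "good F \<longleftrightarrow> finite F \<and> F \<subseteq> s_space \<and> orthonormal_on F (\<lambda>f. f) \<and> (\<forall>f\<in>F. P f = f)" for F
  have "good {}" by (simp add: good_def orthonormal_on_def)
  moreover have "\<forall>F. good F \<longrightarrow> card F < Suc (nat \<lceil>op_trace P\<rceil>)"
  proof (intro allI impI)
    fix F assume "good F"
    then have "real (card F) \<le> op_trace P"
      unfolding good_def by (intro card_le_op_trace P) auto
    then show "card F < Suc (nat \<lceil>op_trace P\<rceil>)" by linarith
  qed
  ultimately have "\<exists>F. good F \<and> (\<forall>G. good G \<longrightarrow> card G \<le> card F)"
    by (rule ex_has_greatest_nat)
  then obtain F where F: "good F" and max: "\<And>G. good G \<Longrightarrow> card G \<le> card F" by auto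
  have Fin: "finite F" and Fs: "\<And>f. f \<in> F \<Longrightarrow> f \<in> s_space" and Fo: "orthonormal_on F (\<lambda>f. f)"
    and FP: "\<And>f. f \<in> F \<Longrightarrow> P f = f"
    using F by (auto simp: good_def)
  have span: "\<xi> = (\<Sum>f\<in>F. seq_scale (pairing \<xi> f) f)" if \<xi>: "\<xi> \<in> s_space" "P \<xi> = \<xi>" for \<xi>
  proof (rule ccontr)
    define S where "S = (\<Sum>f\<in>F. seq_scale (pairing \<xi> f) f)"
    assume "\<xi> \<noteq> (\<Sum>f\<in>F. seq_scale (pairing \<xi> f) f)"
    then have ne: "\<xi> - S \<noteq> 0" by (simp add: S_def)
    have "S \<in> s_space \<and> P S = S" unfolding S_def using Fs FP
    proof (induction F rule: infinite_finite_induct)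
      case (insert f F)
      then show ?case using P(1) by (simp add: s_add s_scale Lss_add_arg Lss_scale_arg s_subset_s_dual)
    qed (use P in auto)
    then have g: "\<xi> - S \<in> s_space" "P (\<xi> - S) = \<xi> - S"
      using \<xi> P by (auto simp: s_diff Lss_diff_arg s_subset_s_dual)
    obtain h c where h: "h = seq_scale c (\<xi> - S)" "h \<in> s_space" "P h = h" "pairing h h = 1"
      using normalize_in_range[OF P(1) g ne] by metis
    have orth: "pairing h f = 0" if f: "f \<in> F" for f
      using bessel_defect(2)[OF Fin Fo s_subset_ell2[OF \<xi>(1)] f] g Fs[OF f]
      unfolding h(1) S_def by (simp add: pairing_scale_left ell2_pairing s_subset_ell2)
    have orth': "pairing f h = 0" if f: "f \<in> F" for f
      using pairing_commute[OF ell2_pairing(1)[OF s_subset_ell2[OF h(2)] s_subset_ell2[OF Fs[OF f]]]] orth[OF f]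
      by simp
    have "h \<notin> F" using orth h(4) by auto
    moreover have "good (insert h F)"
      using F h orth orth' unfolding good_def orthonormal_on_def by (auto simp: s_subset_ell2)
    ultimately show False using max[of "insert h F"] Fin by simp
  qed
  have L: "sum rank_one F \<in> Lss" by (intro Lss_sum rank_one_Lss Fs)
  have "P = sum rank_one F"
  proof (rule Lss_eqI[OF P(1) L])
    fix i j
    let ?p = "P (unit_seq j)"
    have p: "?p \<in> s_space" "P ?p = ?p" using P by (auto simp flip: comp_apply[of P P])
    have "pairing ?p f = cnj (f j)" if f: "f \<in> F" for f
    proof -
      have "pairing ?p f = pairing (unit_seq j) (P f)"
        using pairing_op_adjoint[OF P(1) unit_seq_ell2 s_subset_ell2[OF Fs[OF f]]] P(3) by simp
      then show ?thesis
        using FP[OF f] pairing_commute[OF ell2_pairing(1)[OF s_subset_ell2[OF Fs[OF f]] unit_seq_ell2]] by simp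
    qed
    then have "?p = (\<Sum>f\<in>F. seq_scale (cnj (f j)) f)" using span[OF p] by simp
    then have "?p i = (\<Sum>f\<in>F. seq_scale (cnj (f j)) f i)" by (simp add: op_sum_apply)
    then show "entry P i j = entry (sum rank_one F) i j"
      by (simp add: entry_def[of P] entry_sum entry_rank_one Fs seq_scale_def mult.commute)
  qed
  then show ?thesis using that Fin Fs Fo FP by blast
qed

section \<open>Minimal projections\<close>

locale closed_commutative_subalgebra = closed_subalgebra +
  assumes commutative: "commutative_in L_alg E"
begin

lemma E_commute: "x \<in> E \<Longrightarrow> y \<in> E \<Longrightarrow> x \<circ> y = y \<circ> x"
  using commutative by (auto simp: commutative_in_def L_alg_def)

lemma projectionD:
  assumes "P \<in> projections"
  shows "P \<in> E" "P \<in> Lss" "P \<noteq> 0" "P \<circ> P = P" "op_adjoint P = P"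
  using assms by (auto simp: projections_iff E_Lss)

lemma minimal_projection: "P \<in> minimals \<Longrightarrow> P \<in> projections"
  by (simp add: minimals_iff)

text \<open>Passing to a proper nonzero subprojection lowers the trace by at least one.\<close>

lemma minimal_below:
  assumes "R \<in> projections" shows "\<exists>P\<in>minimals. R \<circ> P = P"
proof -
  have "op_trace R < real n \<Longrightarrow> R \<in> projections \<Longrightarrow> \<exists>P\<in>minimals. R \<circ> P = P" for n
  proof (induction n arbitrary: R)
    case 0
    then show ?case using op_trace_ge_1[of R] projectionD[OF 0(2)] by simp
  next
    case (Suc n)
    note R = projectionD[OF Suc.prems(2)]
    show ?case
    proof (cases "R \<in> minimals")
      case True
      then show ?thesis using R(4) by (intro bexI[of _ R])
    next
      case False
      then obtain Q where Qp: "Q \<in> projections" and QR: "Q \<circ> R = Q" and ne: "Q \<noteq> R"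
        using Suc.prems(2) by (auto simp: minimals_iff)
      note Q = projectionD[OF Qp]
      have RQ: "R \<circ> Q = Q" using QR E_commute[OF R(1) Q(1)] by simp
      have "1 \<le> op_trace (R - Q)"
      proof (rule op_trace_ge_1)
        show "(R - Q) \<circ> (R - Q) = R - Q"
          using R Q QR RQ by (simp add: op_diff_comp comp_op_diff)
      qed (use R Q ne in \<open>auto simp: op_adjoint_diff\<close>)
      then have "op_trace Q < real n" using Suc.prems(1) R Q by (simp add: op_trace_diff)
      from Suc.IH[OF this Qp] obtain P where P: "P \<in> minimals" "Q \<circ> P = P" by blast
      have "R \<circ> P = (R \<circ> Q) \<circ> P" using P(2) by (simp only: comp_assoc)
      also have "\<dots> = P" by (simp only: RQ P(2))
      finally show ?thesis using P(1) by blast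
    qed
  qed
  then show ?thesis using assms reals_Archimedean2 by blast
qed

text \<open>Otherwise the spectral projection of $w^* w$ would dominate a minimal projection, which \<open>w\<close>
  annihilates.\<close>

lemma minimals_separate:
  assumes w: "w \<in> E" and 0: "\<And>P. P \<in> minimals \<Longrightarrow> w \<circ> P = 0" shows "w = 0"
proof (rule ccontr)
  assume "w \<noteq> 0"
  define y where "y = op_adjoint w \<circ> w"
  note wL = E_Lss[OF w]
  have y: "y \<in> E" "op_adjoint y = y" "y \<noteq> 0"
    unfolding y_def using w wL \<open>w \<noteq> 0\<close> adjoint_comp_eq_0[OF wL]
    by (auto simp: E_comp E_adjoint op_adjoint_comp op_adjoint_adjoint)
  obtain R where R: "R \<in> projections" "\<And>z. z \<in> Lss \<Longrightarrow> y \<circ> z = 0 \<Longrightarrow> R \<circ> z = 0"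
    by (rule spectral_projection[OF y]) blast
  obtain P where P: "P \<in> minimals" "R \<circ> P = P" using minimal_below[OF R(1)] by blast
  have "y \<circ> P = 0" using 0[OF P(1)] wL by (simp add: y_def comp_assoc)
  then show False
    using R(2)[of P] P projectionD[OF minimal_projection[OF P(1)]] by simp
qed

lemma minimals_orthogonal:
  assumes "P \<in> minimals" "Q \<in> minimals" "P \<noteq> Q" shows "P \<circ> Q = 0"
proof (rule ccontr)
  assume ne: "P \<circ> Q \<noteq> 0"
  note P = projectionD[OF minimal_projection[OF assms(1)]]
    and Q = projectionD[OF minimal_projection[OF assms(2)]]
  have c: "Q \<circ> P = P \<circ> Q" using E_commute P(1) Q(1) by blast
  have PQQ: "(P \<circ> Q) \<circ> Q = P \<circ> Q" using Q(4) by (simp add: comp_assoc)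
  have PQP: "(P \<circ> Q) \<circ> P = P \<circ> Q" using P(4) by (simp only: comp_assoc c) (simp only: comp_assoc[symmetric])
  have "P \<circ> Q \<in> projections"
    using P Q ne PQP PQQ c by (simp add: projections_iff E_comp op_adjoint_comp flip: comp_assoc)
  then have "P \<circ> Q = Q" "P \<circ> Q = P" using assms PQQ PQP by (auto simp: minimals_iff)
  then show False using assms(3) by simp
qed

text \<open>If $x P$ does not vanish, its spectral projection is \<open>P\<close> by minimality, so its square is a
  positive multiple of \<open>P\<close>. A self-adjoint square root of \<open>P\<close> under \<open>P\<close> is \<open>P\<close> or its negative, again by
  minimality.\<close>

lemma minimal_eigenvalue_self_adjoint:
  assumes P: "P \<in> minimals" and x: "x \<in> E" "op_adjoint x = x"
  shows "\<exists>c. x \<circ> P = op_scale c P"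
proof (cases "x \<circ> P = 0")
  case True
  then show ?thesis by (intro exI[of _ 0]) (auto simp: fun_eq_iff seq_scale_def pointwise)
next
  case False
  note Pp = projectionD[OF minimal_projection[OF P]]
  note L = Pp(2) E_Lss[OF x(1)]
  define z where "z = x \<circ> P"
  have z: "z \<in> E" "op_adjoint z = z" "z \<noteq> 0"
    using False x Pp E_commute[OF x(1) Pp(1)] L by (simp_all add: z_def E_comp op_adjoint_comp)
  note zL = E_Lss[OF z(1)]
  have zP: "z \<circ> P = z" using Pp(4) by (simp add: z_def comp_assoc)
  have Pz: "P \<circ> z = z" using zP E_commute[OF z(1) Pp(1)] by simp
  obtain R c where R: "R \<in> projections" "c > (0::real)" "z \<circ> z \<circ> R = op_scale (of_real (c\<^sup>2)) R"
    "\<And>w. w \<in> Lss \<Longrightarrow> z \<circ> w = z \<Longrightarrow> R \<circ> w = R"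
    by (rule spectral_projection[OF z]) blast
  have "R \<circ> P = R" by (rule R(4)[OF Pp(2) zP])
  then have "R = P" using P R(1) by (simp add: minimals_iff)
  then have zz: "z \<circ> z = op_scale (of_real (c\<^sup>2)) P" using R(3) zP by (simp add: comp_assoc)
  \<comment> \<open>Since the square of $w = z / c$ is \<open>P\<close>, the operator $(P + w) / 2$ is a subprojection of \<open>P\<close>.\<close>
  define w where "w = op_scale (of_real (1 / c)) z"
  have w: "w \<in> E" "w \<in> Lss" "op_adjoint w = w" "w \<circ> P = w" "P \<circ> w = w"
    using z zL zP Pz Pp by (auto simp: w_def E_scale op_adjoint_scale op_scale_comp comp_op_scale)
  have ww: "w \<circ> w = P"
  proof -
    have "w \<circ> w = op_scale (of_real (1 / c)) (op_scale (of_real (1 / c)) (z \<circ> z))"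
      using zL by (simp add: w_def op_scale_comp comp_op_scale)
    also have "\<dots> = P" unfolding zz using R(2)
      by (intro ext) (simp add: op_scale_def seq_scale_def power2_eq_square)
    finally show ?thesis .
  qed
  have zw: "z = op_scale (of_real c) w"
    by (intro ext) (use R(2) in \<open>simp add: w_def op_scale_def seq_scale_def\<close>)
  define u where "u = op_scale (1 / 2) (P + w)"
  have "(P + w) \<circ> (P + w) = (P + w) + (P + w)"
    using Pp w ww by (simp add: op_add_comp comp_op_add add_ac)
  then have "u \<circ> u = op_scale (1 / 2) (op_scale (1 / 2) ((P + w) + (P + w)))"
    using Pp w by (simp add: u_def op_scale_comp comp_op_scale)
  also have "\<dots> = u" by (intro ext) (simp add: u_def op_scale_def seq_scale_def pointwise)
  finally have uu: "u \<circ> u = u" .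
  have u: "u \<in> E" "op_adjoint u = u" "u \<circ> P = u"
    using Pp w by (auto simp: u_def E_scale E_add op_adjoint_scale op_adjoint_add op_scale_comp op_add_comp)
  have Pw: "w = op_scale 2 u - P"
    by (intro ext) (simp add: u_def op_scale_def seq_scale_def pointwise add_divide_distrib)
  show ?thesis
  proof (cases "u = 0")
    case True
    then have "z = op_scale (- of_real c) P"
      unfolding zw Pw by (intro ext) (simp add: op_scale_def seq_scale_def pointwise)
    then show ?thesis by (auto simp: z_def)
  next
    case False
    then have "u \<in> projections" using u uu by (simp add: projections_iff)
    then have "u = P" using P u(3) by (simp add: minimals_iff)
    then have "z = op_scale (of_real c) P"
      unfolding zw Pw by (intro ext) (simp add: op_scale_def seq_scale_def pointwise)
    then show ?thesis by (auto simp: z_def)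
  qed
qed

text \<open>Apply the self-adjoint case to $x + x^*$ and $i (x - x^*)$.\<close>

lemma minimal_eigenvalue:
  assumes P: "P \<in> minimals" and x: "x \<in> E"
  shows "\<exists>c. x \<circ> P = op_scale c P"
proof -
  note L = E_Lss[OF x]
  define a where "a = x + op_adjoint x"
  define b where "b = op_scale \<i> (x - op_adjoint x)"
  have "a \<in> E" "op_adjoint a = a"
    using x L by (simp_all add: a_def E_add E_adjoint op_adjoint_add op_adjoint_adjoint add.commute)
  then obtain c where c: "a \<circ> P = op_scale c P" using minimal_eigenvalue_self_adjoint[OF P] by blast
  have "b \<in> E" using x by (simp add: b_def E_scale E_diff E_adjoint)
  moreover have "op_adjoint b = b"
    using L by (intro Lss_eqI) (simp_all add: b_def entry_linear entry_op_adjoint algebra_simps)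
  ultimately obtain d where d: "b \<circ> P = op_scale d P" using minimal_eigenvalue_self_adjoint[OF P] by blast
  have "x = op_scale (1 / 2) (a - op_scale \<i> b)"
    by (intro ext) (simp add: a_def b_def op_scale_def seq_scale_def pointwise)
  then have "x \<circ> P = op_scale (1 / 2) ((a \<circ> P) - op_scale \<i> (b \<circ> P))"
    by (metis op_diff_comp op_scale_comp)
  also have "\<dots> = op_scale ((c - \<i> * d) / 2) P"
    unfolding c d by (intro ext) (simp add: op_scale_def seq_scale_def pointwise algebra_simps)
  finally show ?thesis by blast
qed

end

section \<open>Series of block projections\<close>

text \<open>Since $1 = \langle f, f \rangle$ is at most the product of the first norm of \<open>f\<close> with its
  dual norm, the sum below is dominated by the squared Hilbert-Schmidt norm of the embedding of
  \<open>ell2\<close> into the first dual step. This is the nuclearity of \<open>s_space\<close> in quantitative form.\<close>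

lemma orthonormal_inverse_norm_sum:
  assumes I: "finite I" "orthonormal_on I f" and s: "\<And>i. i \<in> I \<Longrightarrow> f i \<in> s_space"
  shows "(\<Sum>i\<in>I. 1 / (s_norm 1 (f i))\<^sup>2) \<le> basel"
proof -
  have l2: "f i \<in> ell2" if "i \<in> I" for i using s[OF that] by (rule s_subset_ell2)
  have step: "f i \<in> s_dual_step 1" if "i \<in> I" for i using l2[OF that] by (rule ell2_s_dual_step)
  have pt: "1 / (s_norm 1 (f i))\<^sup>2 \<le> (s_dual_norm 1 (f i))\<^sup>2" if i: "i \<in> I" for i
  proof -
    have "1 \<le> s_dual_norm 1 (f i) * s_norm 1 (f i)"
      using s_dual_s_pairing(2)[OF step[OF i] s[OF i]] I(2) i by (simp add: orthonormal_on_def)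
    then have "1 \<le> (s_dual_norm 1 (f i) * s_norm 1 (f i))\<^sup>2" by (simp add: one_le_power)
    moreover have "s_norm 1 (f i) > 0"
      using ell2_norm_le_s_norm[OF s[OF i], of 1] orthonormal_on_norm[OF I(2) i] by linarith
    ultimately show ?thesis by (simp add: field_simps power_mult_distrib)
  qed
  have "(\<Sum>i\<in>I. 1 / (s_norm 1 (f i))\<^sup>2) \<le> (\<Sum>i\<in>I. (s_dual_norm 1 (f i))\<^sup>2)"
    by (intro sum_mono pt)
  also have "\<dots> \<le> basel"
  proof (rule sums_le)
    show "(\<lambda>n. \<Sum>i\<in>I. (cmod (down 1 (f i) n))\<^sup>2) sums (\<Sum>i\<in>I. (s_dual_norm 1 (f i))\<^sup>2)"
      unfolding s_dual_norm_eq using step by (intro sums_sum ell2_norm_sums) (simp add: s_dual_step_eq)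
    show "(\<lambda>n. 1 / real (Suc n) ^ 2) sums basel"
      unfolding basel_def using basel_summable by (rule summable_sums)
    fix n
    have "cmod (pairing (unit_seq n) (f i)) = cmod (f i n)" if "i \<in> I" for i
      using pairing_commute[OF ell2_pairing(1)[OF l2[OF that] unit_seq_ell2], of n] by simp
    then have "(\<Sum>i\<in>I. (cmod (f i n))\<^sup>2) = (\<Sum>i\<in>I. (cmod (pairing (unit_seq n) (f i)))\<^sup>2)" by simp
    also have "\<dots> \<le> (ell2_norm (unit_seq n))\<^sup>2" by (rule bessel_inequality[OF I unit_seq_ell2])
    also have "ell2_norm (unit_seq n) = 1" using s_dual_norm_unit_seq[of 0 n] by (simp add: s_dual_norm_0)
    finally have "(\<Sum>i\<in>I. (cmod (f i n))\<^sup>2) / real (Suc n) ^ 2 \<le> 1 / real (Suc n) ^ 2"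
      by (simp add: divide_right_mono)
    then show "(\<Sum>i\<in>I. (cmod (down 1 (f i) n))\<^sup>2) \<le> 1 / real (Suc n) ^ 2"
      by (simp only: cmod_down power_divide sum_divide_distrib power_one_right)
  qed
  finally show ?thesis .
qed

lemma s_norm_product:
  assumes f: "f \<in> s_space" "ell2_norm f = 1"
  shows "(s_norm q f)\<^sup>2 * (s_norm 1 f)\<^sup>2 \<le> s_norm (4 * q + 4) f"
proof -
  have sq: "(s_norm p f)\<^sup>2 \<le> s_norm r f" if "2 * p \<le> r" for p r
    using order_trans[OF s_norm_interpolation[OF f(1), of p]] s_norm_mono[OF f(1) that] f(2) by simp
  have "(s_norm q f)\<^sup>2 * (s_norm 1 f)\<^sup>2 \<le> s_norm (2 * q + 2) f * s_norm (2 * q + 2) f"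
    using f by (intro mult_mono sq) auto
  also have "\<dots> \<le> s_norm (4 * q + 4) f"
    using sq[of "2 * q + 2" "4 * q + 4"] by (simp add: power2_eq_square)
  finally show ?thesis .
qed

lemma comp_rank_one:
  assumes "x \<in> Lss" "f \<in> s_space" "x f = seq_scale c f"
  shows "x \<circ> rank_one f = op_scale c (rank_one f)"
proof
  fix \<xi> show "(x \<circ> rank_one f) \<xi> = op_scale c (rank_one f) \<xi>"
    using assms by (simp add: rank_one_def Lss_scale_arg s_subset_s_dual seq_scale_scale mult.commute)
qed

locale block_system =
  fixes f :: "nat \<Rightarrow> cseq" and N :: "nat \<Rightarrow> nat set"
  assumes block_data: "orthonormal_block_data f N"
begin

abbreviation P :: "nat \<Rightarrow> cop" where "P \<equiv> block_projection f N"
abbreviation a :: "nat \<Rightarrow> nat \<Rightarrow> real" where "a \<equiv> max_norm_matrix f N"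

definition partial_sum :: "cseq \<Rightarrow> nat \<Rightarrow> cop" where
  "partial_sum \<xi> n = (\<Sum>k<n. op_scale (\<xi> k) (P k))"

lemma f_in_s [simp]: "f j \<in> s_space"
  and f_ell2 [simp]: "f j \<in> ell2"
  and f_orthonormal: "pairing (f i) (f j) = (if i = j then 1 else 0)"
  and N_finite [simp]: "finite (N k)" and N_nonempty: "N k \<noteq> {}"
  using block_data by (auto simp: orthonormal_block_data_def orthonormal_seq_def)

lemma N_disjoint: "i \<in> N k \<Longrightarrow> i \<in> N l \<Longrightarrow> k = l"
  using block_data unfolding orthonormal_block_data_def disjoint_family_on_def by blast

lemma f_orthonormal_on: "orthonormal_on I f"
  by (simp add: orthonormal_on_def f_orthonormal)

lemma f_norm: "ell2_norm (f j) = 1"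
  using orthonormal_on_norm[OF f_orthonormal_on[of UNIV]] by simp

lemma a_ge: "j \<in> N k \<Longrightarrow> s_norm q (f j) \<le> a k q"
  by (simp add: max_norm_matrix_def)

lemma a_attained: "\<exists>j\<in>N k. a k q = s_norm q (f j)"
proof -
  have "a k q \<in> (\<lambda>j. s_norm q (f j)) ` N k"
    unfolding max_norm_matrix_def by (rule Max_in) (auto simp: N_nonempty)
  then show ?thesis by auto
qed

lemma a_zero: "a k 0 = 1"
  using a_attained[of k 0] by (auto simp: s_norm_0 f_norm)

lemma a_nonneg: "0 \<le> a k q"
  using a_attained[of k q] by auto

lemma P_Lss [simp]: "P k \<in> Lss"
  by (simp add: block_projection_def rank_one_Lss)

lemma P_adjoint: "op_adjoint (P k) = P k"
  by (simp add: block_projection_def op_adjoint_sum rank_one_Lss op_adjoint_rank_one)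

lemma rank_one_f: "rank_one (f i) (f j) = (if i = j then f i else 0)"
  by (simp add: rank_one_def f_orthonormal s_subset_s_dual seq_scale_zero)

lemma P_f: "P k (f j) = (if j \<in> N k then f j else 0)"
  by (simp add: block_projection_def op_sum_apply rank_one_f)

lemma comp_P:
  assumes x: "x \<in> Lss" "\<And>j. j \<in> N k \<Longrightarrow> x (f j) = seq_scale c (f j)"
  shows "x \<circ> P k = op_scale c (P k)"
proof -
  have "x \<circ> P k = (\<Sum>j\<in>N k. op_scale c (rank_one (f j)))"
    unfolding block_projection_def using x
    by (subst comp_op_sum) (simp_all add: rank_one_Lss comp_rank_one)
  also have "\<dots> = op_scale c (P k)"
    by (intro ext) (simp add: block_projection_def op_sum_apply seq_scale_def sum_distrib_left)
  finally show ?thesis .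
qed

lemma comp_P_f:
  assumes "x \<circ> P k = op_scale c (P k)" "j \<in> N k" shows "x (f j) = seq_scale c (f j)"
proof -
  have "(x \<circ> P k) (f j) = op_scale c (P k) (f j)" by (simp only: assms(1))
  then show ?thesis using assms(2) by (simp add: P_f)
qed

lemma P_comp_P: "P k \<circ> P l = (if k = l then P k else 0)"
proof -
  have "P k \<circ> P l = op_scale (if k = l then 1 else 0) (P l)"
    using N_disjoint by (intro comp_P) (auto simp: P_f seq_scale_zero)
  then show ?thesis by (auto simp: fun_eq_iff op_scale_def seq_scale_def pointwise)
qed

lemma P_neq_0: "P k \<noteq> 0"
proof
  assume 0: "P k = 0"
  obtain j where "j \<in> N k" using N_nonempty by blast
  then have "f j = 0" using P_f[of k j] 0 by (simp add: op_zero_apply)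
  then show False using f_norm[of j] by simp
qed

lemma op_scale_P_cancel: "op_scale c (P k) = op_scale d (P k) \<Longrightarrow> c = d"
proof -
  assume e: "op_scale c (P k) = op_scale d (P k)"
  obtain j where j: "j \<in> N k" using N_nonempty by blast
  then have "seq_scale c (f j) = seq_scale d (f j)"
    using fun_cong[OF e, of "f j"] by (simp add: P_f)
  then have "pairing (seq_scale c (f j)) (f j) = pairing (seq_scale d (f j)) (f j)" by simp
  then show ?thesis by (simp add: pairing_scale_left ell2_pairing f_orthonormal)
qed

lemma partial_sum_Lss [simp]: "partial_sum \<xi> n \<in> Lss"
  by (simp add: partial_sum_def)

lemma P_is_projection: "P k \<circ> P k = P k" using P_comp_P[of k k] by simp

lemma op_scale_if: "op_scale c (if b then x else 0) = (if b then op_scale c x else 0)"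
  by (auto simp: fun_eq_iff op_zero_apply)

lemma partial_sum_comp_P: "partial_sum \<xi> n \<circ> P k = (if k < n then op_scale (\<xi> k) (P k) else 0)"
  by (simp add: partial_sum_def op_sum_comp op_scale_comp P_comp_P op_scale_if)

lemma partial_sum_comp: "partial_sum \<xi> n \<circ> partial_sum \<eta> n = partial_sum (\<xi> * \<eta>) n"
proof -
  have "partial_sum \<xi> n \<circ> partial_sum \<eta> n = (\<Sum>k<n. op_scale (\<eta> k) (partial_sum \<xi> n \<circ> P k))"
    by (subst (2) partial_sum_def) (simp add: comp_op_sum comp_op_scale)
  also have "\<dots> = partial_sum (\<xi> * \<eta>) n"
    unfolding partial_sum_def[of "\<xi> * \<eta>"]
    by (rule sum.cong) (auto simp: partial_sum_comp_P fun_eq_iff seq_scale_scale mult.commute)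
  finally show ?thesis .
qed

lemma partial_sum_linear:
  "partial_sum (\<xi> + \<eta>) = (\<lambda>n. partial_sum \<xi> n + partial_sum \<eta> n)"
  "partial_sum (\<xi> - \<eta>) = (\<lambda>n. partial_sum \<xi> n - partial_sum \<eta> n)"
  "partial_sum (seq_scale c \<xi>) = (\<lambda>n. op_scale c (partial_sum \<xi> n))"
  by (intro ext; simp add: partial_sum_def op_sum_apply op_scale_def seq_scale_def pointwise
      ring_distribs sum.distrib sum_subtractf sum_distrib_left mult.assoc)+

lemma partial_sum_adjoint: "op_adjoint (partial_sum \<xi> n) = partial_sum (\<lambda>k. cnj (\<xi> k)) n"
  by (simp add: partial_sum_def op_adjoint_sum op_adjoint_scale P_adjoint)

text \<open>Eigenvalues are controlled by the operator norms: an eigenvector of norm one in \<open>ell2\<close>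
  is mapped to its multiple.\<close>

lemma eigenvalue_bound:
  assumes x: "x \<in> Lss" "x \<circ> P k = op_scale c (P k)"
  shows "cmod c * a k q \<le> op_norm q x"
proof -
  obtain j where j: "j \<in> N k" "a k q = s_norm q (f j)" using a_attained by blast
  have "cmod c * a k q = s_norm q (x (f j))"
    using comp_P_f[OF x(2) j(1)] j(2) by (simp add: s_norm_scale)
  also have "\<dots> \<le> op_norm q x * ell2_norm (f j)" by (rule op_norm_bound_ell2[OF x(1)]) simp
  finally show ?thesis by (simp add: f_norm)
qed

lemma op_norm_sum: "(\<And>i. i \<in> I \<Longrightarrow> x i \<in> Lss) \<Longrightarrow> op_norm q (sum x I) \<le> (\<Sum>i\<in>I. op_norm q (x i))"
proof (induction I rule: infinite_finite_induct)
  case (insert i I)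
  have "op_norm q (x i + sum x I) \<le> op_norm q (x i) + op_norm q (sum x I)"
    using insert by (intro op_norm_add) auto
  then show ?case using insert by fastforce
qed auto

lemma op_norm_P: "op_norm q (P k) \<le> (\<Sum>j\<in>N k. (s_norm q (f j))\<^sup>2)"
proof -
  have "op_norm q (P k) \<le> (\<Sum>j\<in>N k. op_norm q (rank_one (f j)))"
    unfolding block_projection_def by (rule op_norm_sum) (simp add: rank_one_Lss)
  also have "\<dots> \<le> (\<Sum>j\<in>N k. (s_norm q (f j))\<^sup>2)" by (intro sum_mono op_norm_rank_one) simp
  finally show ?thesis .
qed

text \<open>The converse estimate loses derivatives. By interpolation
  $|f_j|_q^2 \le |f_j|_{4q+4} \, |f_j|_1^{-2}$, and the last factors are summable over the
  union of all blocks.\<close>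

lemma block_sum_bound:
  assumes B: "\<And>k. cmod (\<xi> k) * a k (4 * q + 4) \<le> B"
  shows "(\<Sum>k<n. cmod (\<xi> k) * op_norm q (P k)) \<le> basel * B"
proof -
  have B0: "0 \<le> B" using B[of 0] a_nonneg[of 0 "4 * q + 4"] by (meson mult_nonneg_nonneg norm_ge_zero order_trans)
  have summand: "cmod (\<xi> k) * (s_norm q (f j))\<^sup>2 \<le> B * (1 / (s_norm 1 (f j))\<^sup>2)" if j: "j \<in> N k" for j k
  proof -
    have pos: "s_norm 1 (f j) > 0" using ell2_norm_le_s_norm[of "f j" 1] f_norm[of j] by simp
    have "cmod (\<xi> k) * ((s_norm q (f j))\<^sup>2 * (s_norm 1 (f j))\<^sup>2) \<le> cmod (\<xi> k) * s_norm (4 * q + 4) (f j)"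
      by (intro mult_left_mono s_norm_product) (auto simp: f_norm)
    also have "\<dots> \<le> cmod (\<xi> k) * a k (4 * q + 4)" by (intro mult_left_mono a_ge j) simp
    also have "\<dots> \<le> B" by (rule B)
    finally show ?thesis using pos by (simp add: field_simps)
  qed
  have "(\<Sum>k<n. cmod (\<xi> k) * op_norm q (P k)) \<le> (\<Sum>k<n. cmod (\<xi> k) * (\<Sum>j\<in>N k. (s_norm q (f j))\<^sup>2))"
    by (intro sum_mono mult_left_mono op_norm_P) simp
  also have "\<dots> \<le> (\<Sum>k<n. \<Sum>j\<in>N k. B * (1 / (s_norm 1 (f j))\<^sup>2))"
    unfolding sum_distrib_left by (intro sum_mono summand)
  also have "\<dots> = B * (\<Sum>j\<in>(\<Union>k<n. N k). 1 / (s_norm 1 (f j))\<^sup>2)"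
  proof -
    have "(\<Sum>j\<in>(\<Union>k<n. N k). 1 / (s_norm 1 (f j))\<^sup>2) = (\<Sum>k<n. \<Sum>j\<in>N k. 1 / (s_norm 1 (f j))\<^sup>2)"
      using N_disjoint by (intro sum.UNION_disjoint) auto
    then show ?thesis by (simp add: sum_distrib_left)
  qed
  also have "\<dots> \<le> B * basel"
    by (intro mult_left_mono orthonormal_inverse_norm_sum f_orthonormal_on B0) auto
  finally show ?thesis by (simp add: mult.commute)
qed

lemma partial_sum_bound:
  assumes B: "\<And>k. cmod (\<xi> k) * a k (4 * q + 4) \<le> B"
  shows "op_norm q (partial_sum \<xi> n) \<le> basel * B"
proof -
  have "op_norm q (partial_sum \<xi> n) \<le> (\<Sum>k<n. op_norm q (op_scale (\<xi> k) (P k)))"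
    unfolding partial_sum_def by (rule op_norm_sum) simp
  also have "\<dots> = (\<Sum>k<n. cmod (\<xi> k) * op_norm q (P k))" by (simp add: op_norm_scale)
  also have "\<dots> \<le> basel * B" by (rule block_sum_bound[OF B])
  finally show ?thesis .
qed

lemma koethe_bound:
  assumes "\<xi> \<in> koethe_space a" shows "cmod (\<xi> k) * a k q \<le> koethe_norm a q \<xi>"
  using assms unfolding koethe_norm_def koethe_space_def by (intro cSUP_upper) auto

lemma koethe_spaceI: "(\<And>q. \<exists>B. \<forall>k. cmod (\<xi> k) * a k q \<le> B) \<Longrightarrow> \<xi> \<in> koethe_space a"
  unfolding koethe_space_def by (auto simp: bdd_above_def)

lemma koethe_normI: "(\<And>k. cmod (\<xi> k) * a k q \<le> B) \<Longrightarrow> koethe_norm a q \<xi> \<le> B"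
  unfolding koethe_norm_def by (rule cSUP_least) auto

text \<open>The partial sums are bounded in every operator norm and their entries converge absolutely, so
  entrywise convergence suffices.\<close>

lemma block_series_converges:
  assumes \<xi>: "\<xi> \<in> koethe_space a"
  obtains x where "x \<in> Lss" "op_tendsto (partial_sum \<xi>) x"
proof -
  have bd: "\<exists>C. \<forall>n. op_norm q (partial_sum \<xi> n) \<le> C" for q
    using partial_sum_bound[OF koethe_bound[OF \<xi>]] by blast
  have conv: "convergent (\<lambda>n. entry (partial_sum \<xi> n) i j)" for i j
  proof -
    have "summable (\<lambda>k. norm (\<xi> k * entry (P k) i j))"
    proof (rule summableI_nonneg_bounded)
      fix n
      have "norm (\<xi> k * entry (P k) i j) \<le> cmod (\<xi> k) * op_norm 0 (P k)" for k
        using entry_bound[OF P_Lss, of k i j 0] by (simp add: norm_mult mult_left_mono)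
      then have "(\<Sum>k<n. norm (\<xi> k * entry (P k) i j)) \<le> (\<Sum>k<n. cmod (\<xi> k) * op_norm 0 (P k))"
        by (intro sum_mono)
      also have "\<dots> \<le> basel * koethe_norm a (4 * 0 + 4) \<xi>"
        by (rule block_sum_bound[OF koethe_bound[OF \<xi>]])
      finally show "(\<Sum>k<n. norm (\<xi> k * entry (P k) i j)) \<le> basel * koethe_norm a (4 * 0 + 4) \<xi>" .
    qed simp
    then have "summable (\<lambda>k. \<xi> k * entry (P k) i j)" by (rule summable_norm_cancel)
    then show ?thesis by (simp add: summable_iff_convergent partial_sum_def entry_sum entry_linear)
  qed
  show ?thesis
    by (rule bounded_entrywise_convergent[of "partial_sum \<xi>"]) (use bd conv that in auto)
qed

lemma block_series_bound:
  assumes x: "x \<in> Lss" "op_tendsto (partial_sum \<xi>) x"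
    and B: "\<And>k. cmod (\<xi> k) * a k (4 * q + 4) \<le> B"
  shows "op_norm q x \<le> basel * B"
proof (rule LIMSEQ_le_const)
  have "(\<lambda>n. op_norm q (partial_sum \<xi> n - x) + basel * B) \<longlonglongrightarrow> 0 + basel * B"
    using x(2) unfolding op_tendsto_def by (intro tendsto_intros) auto
  then show "(\<lambda>n. op_norm q (partial_sum \<xi> n - x) + basel * B) \<longlonglongrightarrow> basel * B" by simp
  have "op_norm q x \<le> op_norm q (partial_sum \<xi> n - x) + basel * B" for n
    using op_norm_triangle[OF x(1) partial_sum_Lss[of \<xi> n] Lss_zero, of q]
      op_norm_diff_commute[OF x(1) partial_sum_Lss[of \<xi> n], of q] partial_sum_bound[OF B, of n] by simp
  then show "\<exists>n0. \<forall>n\<ge>n0. op_norm q x \<le> op_norm q (partial_sum \<xi> n - x) + basel * B" by blast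
qed

lemma op_tendsto_offset: "op_tendsto (\<lambda>n. X (n + m)) x \<longleftrightarrow> op_tendsto X x"
  unfolding op_tendsto_def using LIMSEQ_offset[of "\<lambda>n. op_norm _ (X n - x)" m]
    LIMSEQ_ignore_initial_segment[of "\<lambda>n. op_norm _ (X n - x)" _ m] by auto

text \<open>All partial sums that contain the index \<open>k\<close> have the same product with \<open>P k\<close>.\<close>

lemma block_series_comp_P:
  assumes x: "x \<in> Lss" "op_tendsto (partial_sum \<xi>) x"
  shows "x \<circ> P k = op_scale (\<xi> k) (P k)"
proof -
  have "op_tendsto (\<lambda>n. partial_sum \<xi> (n + Suc k) \<circ> P k) (x \<circ> P k)"
    using x by (intro op_tendsto_comp op_tendsto_const) (auto simp only: op_tendsto_offset partial_sum_Lss P_Lss)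
  moreover have "partial_sum \<xi> (n + Suc k) \<circ> P k = op_scale (\<xi> k) (P k)" for n
    by (simp add: partial_sum_comp_P)
  ultimately have "op_tendsto (\<lambda>n. op_scale (\<xi> k) (P k)) (x \<circ> P k)" by simp
  then show ?thesis
    using x by (intro op_tendsto_unique[of "\<lambda>n. op_scale (\<xi> k) (P k)"] op_tendsto_const) auto
qed

end

section \<open>Koethe algebras as operator algebras\<close>

lemma star_alg_iso_inverse:
  assumes iso: "star_alg_iso A B \<Phi>"
    and top: "topspace (topol A) = carr A"
    and cl: "\<And>x y. x \<in> carr A \<Longrightarrow> y \<in> carr A \<Longrightarrow> x + y \<in> carr A \<and> mul A x y \<in> carr A"
      "\<And>c x. x \<in> carr A \<Longrightarrow> scal A c x \<in> carr A" "\<And>x. x \<in> carr A \<Longrightarrow> involution A x \<in> carr A"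
  shows "star_alg_isomorphic B A"
proof -
  obtain \<Psi> where hm: "homeomorphic_maps (topol A) (topol B) \<Phi> \<Psi>"
    using iso unfolding star_alg_iso_def homeomorphic_map_maps by blast
  have bij: "bij_betw \<Phi> (carr A) (carr B)" using iso by (simp add: star_alg_iso_def)
  have \<Psi>\<Phi>: "\<Psi> (\<Phi> x) = x" if "x \<in> carr A" for x
    using hm that top by (simp add: homeomorphic_maps_def)
  have \<Psi>: "\<Psi> y \<in> carr A" "\<Phi> (\<Psi> y) = y" if "y \<in> carr B" for y
    using that bij \<Psi>\<Phi> by (metis bij_betw_iff_bijections)+
  have eq: "\<Psi> z = x" if "x \<in> carr A" "\<Phi> x = z" for x z using \<Psi>\<Phi> that by blast
  have "star_alg_iso B A \<Psi>"
    unfolding star_alg_iso_def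
  proof (intro conjI ballI allI)
    show "bij_betw \<Psi> (carr B) (carr A)"
      by (rule bij_betw_byWitness[of _ \<Phi>]) (use \<Psi> \<Psi>\<Phi> bij in \<open>auto simp: bij_betw_def\<close>)
    show "homeomorphic_map (topol B) (topol A) \<Psi>"
      using hm homeomorphic_maps_sym homeomorphic_maps_imp_map by blast
  qed (rule eq; use \<Psi> cl iso in \<open>auto simp: star_alg_iso_def\<close>)+
  then show ?thesis unfolding star_alg_isomorphic_def by blast
qed

context block_system
begin

lemma koethe_add: "\<xi> \<in> koethe_space a \<Longrightarrow> \<eta> \<in> koethe_space a \<Longrightarrow> \<xi> + \<eta> \<in> koethe_space a"
proof (rule koethe_spaceI)
  fix q assume *: "\<xi> \<in> koethe_space a" "\<eta> \<in> koethe_space a"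
  have "cmod ((\<xi> + \<eta>) k) * a k q \<le> koethe_norm a q \<xi> + koethe_norm a q \<eta>" for k
  proof -
    have "cmod ((\<xi> + \<eta>) k) * a k q \<le> (cmod (\<xi> k) + cmod (\<eta> k)) * a k q"
      by (intro mult_right_mono a_nonneg) (simp add: pointwise norm_triangle_ineq)
    then show ?thesis using koethe_bound[OF *(1), of k q] koethe_bound[OF *(2), of k q]
      by (simp add: ring_distribs)
  qed
  then show "\<exists>B. \<forall>k. cmod ((\<xi> + \<eta>) k) * a k q \<le> B" by blast
qed

lemma koethe_scale: assumes "\<xi> \<in> koethe_space a" shows "seq_scale c \<xi> \<in> koethe_space a"
proof (rule koethe_spaceI)
  fix q
  have "cmod (seq_scale c \<xi> k) * a k q \<le> cmod c * koethe_norm a q \<xi>" for k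
    using mult_left_mono[OF koethe_bound[OF assms, of k q], of "cmod c"]
    by (simp add: seq_scale_def norm_mult mult.assoc)
  then show "\<exists>B. \<forall>k. cmod (seq_scale c \<xi> k) * a k q \<le> B" by blast
qed

lemma koethe_diff: "\<xi> \<in> koethe_space a \<Longrightarrow> \<eta> \<in> koethe_space a \<Longrightarrow> \<xi> - \<eta> \<in> koethe_space a"
  by (simp add: seq_scale_minus_one koethe_add koethe_scale)

lemma seminorm_family_koethe: "seminorm_family (koethe_space a) (range (koethe_norm a))"
proof -
  have "koethe_norm a q 0 = 0" for q by (simp add: koethe_norm_def pointwise)
  moreover have "koethe_norm a q (x - z) \<le> koethe_norm a q (x - y) + koethe_norm a q (y - z)"
    if x: "x \<in> koethe_space a" "y \<in> koethe_space a" "z \<in> koethe_space a" for q x y z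
  proof (rule koethe_normI)
    fix k
    have "cmod ((x - z) k) * a k q \<le> (cmod ((x - y) k) + cmod ((y - z) k)) * a k q"
      using norm_triangle_ineq[of "x k - y k" "y k - z k"]
      by (intro mult_right_mono a_nonneg) (simp add: pointwise)
    then show "cmod ((x - z) k) * a k q \<le> koethe_norm a q (x - y) + koethe_norm a q (y - z)"
      using koethe_bound[OF koethe_diff[OF x(1,2)], of k q] koethe_bound[OF koethe_diff[OF x(2,3)], of k q]
      by (simp add: ring_distribs)
  qed
  ultimately show ?thesis by (auto simp: seminorm_family_def)
qed

text \<open>Reading off eigenvalues is the isomorphism: it does not increase the norms, and its inverse
  is the block series, which loses the derivatives of the preceding section.\<close>

lemma eigenvalue_isomorphism:
  assumes E: "closed_subalgebra E" and PE: "\<And>k. P k \<in> E"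
    and eig: "\<And>x k. x \<in> E \<Longrightarrow> \<exists>c. x \<circ> P k = op_scale c (P k)"
    and sep: "\<And>x. x \<in> E \<Longrightarrow> (\<And>k. x \<circ> P k = 0) \<Longrightarrow> x = 0"
  shows "\<exists>\<Phi>. star_alg_iso (subalg L_alg E) (koethe_alg a) \<Phi> \<and> (\<forall>k. \<Phi> (P k) = unit_seq k)"
proof -
  interpret closed_subalgebra E by (rule E)
  obtain \<Phi> where \<Phi>: "\<And>x k. x \<in> E \<Longrightarrow> x \<circ> P k = op_scale (\<Phi> x k) (P k)"
    using eig by metis
  have uniq: "\<Phi> x = c" if "x \<in> E" "\<And>k. x \<circ> P k = op_scale (c k) (P k)" for x c
  proof
    fix k show "\<Phi> x k = c k"
      by (rule op_scale_P_cancel[of _ k]) (use \<Phi> that in simp)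
  qed
  have scale_add: "op_scale (c + d) x = op_scale c x + op_scale d x" for c d and x :: cop
    by (intro ext) (simp add: op_scale_def seq_scale_def pointwise ring_distribs)
  have scale_diff: "op_scale (c - d) x = op_scale c x - op_scale d x" for c d and x :: cop
    by (intro ext) (simp add: op_scale_def seq_scale_def pointwise ring_distribs)
  have scale_scale: "op_scale c (op_scale d x) = op_scale (c * d) x" for c d and x :: cop
    by (intro ext) (simp add: op_scale_def seq_scale_def)
  have \<Phi>_bound: "cmod (\<Phi> x k) * a k q \<le> op_norm q x" if "x \<in> E" for x k q
    by (rule eigenvalue_bound[OF E_Lss[OF that] \<Phi>[OF that]])
  have \<Phi>_koethe: "\<Phi> x \<in> koethe_space a" if "x \<in> E" for x
    using \<Phi>_bound[OF that] by (intro koethe_spaceI) blast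
  have \<Phi>_add: "\<Phi> (x + y) = \<Phi> x + \<Phi> y" if "x \<in> E" "y \<in> E" for x y
    using that by (intro uniq) (simp_all add: E_add op_add_comp \<Phi> plus_fun_apply[of "\<Phi> x"] scale_add)
  have \<Phi>_diff: "\<Phi> (x - y) = \<Phi> x - \<Phi> y" if "x \<in> E" "y \<in> E" for x y
    using that by (intro uniq) (simp_all add: E_diff op_diff_comp \<Phi> minus_apply[of "\<Phi> x"] scale_diff)
  have \<Phi>_comp: "\<Phi> (x \<circ> y) = \<Phi> x * \<Phi> y" if "x \<in> E" "y \<in> E" for x y
  proof (rule uniq)
    fix k
    have "(x \<circ> y) \<circ> P k = op_scale (\<Phi> y k) (op_scale (\<Phi> x k) (P k))"
      using that by (simp add: comp_assoc \<Phi> comp_op_scale E_Lss)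
    then show "(x \<circ> y) \<circ> P k = op_scale ((\<Phi> x * \<Phi> y) k) (P k)"
      by (simp add: scale_scale mult.commute)
  qed (use that E_comp in auto)
  have \<Phi>_scale: "\<Phi> (op_scale c x) = seq_scale c (\<Phi> x)" if "x \<in> E" for x c
    using that by (intro uniq) (simp_all add: E_scale op_scale_comp \<Phi> scale_scale seq_scale_def)
  have \<Phi>_adjoint: "\<Phi> (op_adjoint x) = (\<lambda>k. cnj (\<Phi> x k))" if x: "x \<in> E" for x
  proof
    fix k
    note L = E_Lss[OF x] P_Lss[of k]
    have "P k \<circ> op_adjoint x = op_scale (cnj (\<Phi> x k)) (P k)"
      using arg_cong[OF \<Phi>[OF x, of k], of op_adjoint] L by (simp add: op_adjoint_comp op_adjoint_scale P_adjoint)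
    then have "(P k \<circ> op_adjoint x) \<circ> P k = op_scale (cnj (\<Phi> x k)) (P k)"
      by (simp add: op_scale_comp P_is_projection)
    moreover have "(P k \<circ> op_adjoint x) \<circ> P k = op_scale (\<Phi> (op_adjoint x) k) (P k)"
      by (simp add: comp_assoc \<Phi>[OF E_adjoint[OF x]] comp_op_scale P_is_projection)
    ultimately show "\<Phi> (op_adjoint x) k = cnj (\<Phi> x k)" using op_scale_P_cancel by metis
  qed
  have \<Phi>_P: "\<Phi> (P k) = unit_seq k" for k
    by (rule uniq[OF PE]) (auto simp: P_comp_P unit_seq_def fun_eq_iff op_scale_def seq_scale_def pointwise)
  have inj: "x = y" if "x \<in> E" "y \<in> E" "\<Phi> x = \<Phi> y" for x y
  proof -
    have "(x - y) \<circ> P k = 0" for k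
      unfolding op_diff_comp \<Phi>[OF that(1)] \<Phi>[OF that(2)] that(3) by simp
    then have "x - y = 0" by (rule sep[OF E_diff[OF that(1,2)]])
    then show ?thesis by simp
  qed
  have surj: "\<exists>x\<in>E. \<Phi> x = \<xi> \<and> op_tendsto (partial_sum \<xi>) x" if \<xi>: "\<xi> \<in> koethe_space a" for \<xi>
  proof -
    obtain x where x: "x \<in> Lss" "op_tendsto (partial_sum \<xi>) x" using block_series_converges[OF \<xi>] .
    have pE: "partial_sum \<xi> n \<in> E" for n unfolding partial_sum_def by (intro E_sum E_scale PE)
    have "x \<in> E" by (rule op_tendsto_closed[OF E_closed x(2) pE x(1)])
    then show ?thesis using x uniq[of x \<xi>] block_series_comp_P[OF x] by blast
  qed
  have bound: "op_norm q x \<le> basel * koethe_norm a (4 * q + 4) (\<Phi> x)" if x: "x \<in> E" for x q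
  proof -
    have "op_tendsto (partial_sum (\<Phi> x)) x" using surj[OF \<Phi>_koethe[OF x]] inj x by blast
    then show ?thesis using E_Lss[OF x] koethe_bound[OF \<Phi>_koethe[OF x]] by (intro block_series_bound)
  qed
  have bij: "bij_betw \<Phi> E (koethe_space a)"
    unfolding bij_betw_def inj_on_def using inj surj \<Phi>_koethe by blast
  define \<Psi> where "\<Psi> = inv_into E \<Phi>"
  have \<Psi>: "\<Psi> \<xi> \<in> E" "\<Phi> (\<Psi> \<xi>) = \<xi>" if "\<xi> \<in> koethe_space a" for \<xi>
    using bij that unfolding \<Psi>_def by (auto simp: bij_betw_def inv_into_into f_inv_into_f)
  have \<Psi>\<Phi>: "\<Psi> (\<Phi> x) = x" if "x \<in> E" for x
    using bij that unfolding \<Psi>_def by (auto simp: bij_betw_def inv_into_f_f)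
  let ?TE = "subtopology (seminorm_topology Lss (range op_norm)) E"
  let ?TK = "seminorm_topology (koethe_space a) (range (koethe_norm a))"
  have tsE: "topspace ?TE = E"
    using E_Lss by (auto simp: topspace_seminorm_topology[OF seminorm_family_Lss])
  have tsK: "topspace ?TK = koethe_space a" by (rule topspace_seminorm_topology[OF seminorm_family_koethe])
  have c1: "continuous_map ?TE ?TK \<Phi>"
  proof (rule continuous_map_seminorm_topology[OF seminorm_family_Lss seminorm_family_koethe])
    fix p assume "p \<in> range (koethe_norm a)"
    then obtain q where q: "p = koethe_norm a q" by blast
    have "koethe_norm a q (\<Phi> y - \<Phi> x) \<le> 1 * op_norm q (y - x)" if "x \<in> E" "y \<in> E" for x y
      using \<Phi>_bound[OF E_diff[OF that(2,1)]] that by (intro koethe_normI) (simp add: \<Phi>_diff)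
    then show "\<exists>p'\<in>range op_norm. \<exists>C\<ge>0. \<forall>x\<in>E. \<forall>y\<in>E. p (\<Phi> y - \<Phi> x) \<le> C * p' (y - x)"
      unfolding q by (intro bexI[of _ "op_norm q"] exI[of _ 1]) auto
  qed (use E_Lss \<Phi>_koethe in auto)
  have "continuous_map (subtopology ?TK (koethe_space a)) (seminorm_topology Lss (range op_norm)) \<Psi>"
  proof (rule continuous_map_seminorm_topology[OF seminorm_family_koethe seminorm_family_Lss])
    fix p assume "p \<in> range op_norm"
    then obtain q where q: "p = op_norm q" by blast
    have "op_norm q (\<Psi> \<eta> - \<Psi> \<xi>) \<le> basel * koethe_norm a (4 * q + 4) (\<eta> - \<xi>)"
      if "\<xi> \<in> koethe_space a" "\<eta> \<in> koethe_space a" for \<xi> \<eta>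
      using bound[OF E_diff[OF \<Psi>(1)[OF that(2)] \<Psi>(1)[OF that(1)]]] that by (simp add: \<Phi>_diff \<Psi>)
    then show "\<exists>p'\<in>range (koethe_norm a). \<exists>C\<ge>0. \<forall>\<xi>\<in>koethe_space a. \<forall>\<eta>\<in>koethe_space a.
        p (\<Psi> \<eta> - \<Psi> \<xi>) \<le> C * p' (\<eta> - \<xi>)"
      unfolding q using basel_nonneg
      by (intro bexI[of _ "koethe_norm a (4 * q + 4)"] exI[of _ basel]) auto
  qed (use E_Lss \<Psi> in auto)
  then have c2: "continuous_map ?TK ?TE \<Psi>"
    using \<Psi>(1) tsK by (intro continuous_map_into_subtopology) (metis subtopology_topspace, auto)
  have "homeomorphic_maps ?TE ?TK \<Phi> \<Psi>"
    unfolding homeomorphic_maps_def tsE tsK using c1 c2 \<Psi> \<Psi>\<Phi> by auto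
  then have "homeomorphic_map ?TE ?TK \<Phi>" by (rule homeomorphic_maps_imp_map)
  then have "star_alg_iso (subalg L_alg E) (koethe_alg a) \<Phi>"
    using bij \<Phi>_add \<Phi>_comp \<Phi>_scale \<Phi>_adjoint
    by (simp add: star_alg_iso_def subalg_def L_alg_def koethe_alg_def op_scale_def)
  then show ?thesis using \<Phi>_P by blast
qed

definition block_algebra :: "cop set" where
  "block_algebra = {x \<in> Lss. \<exists>\<xi>\<in>koethe_space a. op_tendsto (partial_sum \<xi>) x}"

lemma block_algebraE:
  assumes "x \<in> block_algebra"
  obtains \<xi> where "x \<in> Lss" "\<xi> \<in> koethe_space a" "op_tendsto (partial_sum \<xi>) x"
  using assms by (auto simp: block_algebra_def)

lemma block_algebra_eqI:
  assumes "x \<in> Lss" "op_tendsto (partial_sum \<xi>) x" "y \<in> Lss" "op_tendsto (partial_sum \<xi>) y"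
  shows "x = y"
  by (rule op_tendsto_unique[OF assms(2,4) partial_sum_Lss assms(1,3)])

text \<open>All weights with \<open>q = 0\<close> are one, so elements of the Koethe space are bounded sequences.\<close>

lemma koethe_mult:
  assumes "\<xi> \<in> koethe_space a" "\<eta> \<in> koethe_space a" shows "\<xi> * \<eta> \<in> koethe_space a"
proof (rule koethe_spaceI)
  fix q
  have "cmod ((\<xi> * \<eta>) k) * a k q \<le> koethe_norm a q \<xi> * koethe_norm a 0 \<eta>" for k
  proof -
    have "cmod ((\<xi> * \<eta>) k) * a k q = (cmod (\<xi> k) * a k q) * (cmod (\<eta> k) * a k 0)"
      by (simp add: norm_mult a_zero)
    also have "\<dots> \<le> koethe_norm a q \<xi> * koethe_norm a 0 \<eta>"
      using order_trans[OF _ koethe_bound[OF assms(1), of k q]] a_nonneg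
      by (intro mult_mono koethe_bound assms) (auto intro: mult_nonneg_nonneg)
    finally show ?thesis .
  qed
  then show "\<exists>B. \<forall>k. cmod ((\<xi> * \<eta>) k) * a k q \<le> B" by blast
qed

lemma koethe_cnj: "\<xi> \<in> koethe_space a \<Longrightarrow> (\<lambda>k. cnj (\<xi> k)) \<in> koethe_space a"
  by (simp add: koethe_space_def)

lemma koethe_unit_seq: "unit_seq k \<in> koethe_space a"
proof (rule koethe_spaceI)
  fix q
  have "cmod (unit_seq k l) * a l q \<le> a k q" for l using a_nonneg by (simp add: unit_seq_def)
  then show "\<exists>B. \<forall>l. cmod (unit_seq k l) * a l q \<le> B" by blast
qed

lemma op_tendsto_add:
  assumes "op_tendsto X x" "op_tendsto Y y" "\<And>n. X n \<in> Lss" "\<And>n. Y n \<in> Lss" "x \<in> Lss" "y \<in> Lss"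
  shows "op_tendsto (\<lambda>n. X n + Y n) (x + y)"
  unfolding op_tendsto_def
proof
  fix q
  show "(\<lambda>n. op_norm q (X n + Y n - (x + y))) \<longlonglongrightarrow> 0"
  proof (rule Lim_null_comparison)
    have "op_norm q (X n + Y n - (x + y)) \<le> op_norm q (X n - x) + op_norm q (Y n - y)" for n
      using op_norm_add[of "X n - x" "Y n - y" q] assms by (simp add: algebra_simps)
    then show "\<forall>\<^sub>F n in sequentially. norm (op_norm q (X n + Y n - (x + y)))
        \<le> op_norm q (X n - x) + op_norm q (Y n - y)"
      using assms by simp
    have "(\<lambda>n. op_norm q (X n - x) + op_norm q (Y n - y)) \<longlonglongrightarrow> 0 + 0"
      using assms unfolding op_tendsto_def by (intro tendsto_intros) auto
    then show "(\<lambda>n. op_norm q (X n - x) + op_norm q (Y n - y)) \<longlonglongrightarrow> 0" by simp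
  qed
qed

lemma op_tendsto_scale:
  assumes "op_tendsto X x" "\<And>n. X n \<in> Lss" "x \<in> Lss"
  shows "op_tendsto (\<lambda>n. op_scale c (X n)) (op_scale c x)"
  unfolding op_tendsto_def
proof
  fix q
  have "op_scale c (X n) - op_scale c x = op_scale c (X n - x)" for n
    by (intro ext) (simp add: op_scale_def seq_scale_def pointwise ring_distribs)
  then have "op_norm q (op_scale c (X n) - op_scale c x) = cmod c * op_norm q (X n - x)" for n
    using assms by (simp add: op_norm_scale)
  then show "(\<lambda>n. op_norm q (op_scale c (X n) - op_scale c x)) \<longlonglongrightarrow> 0"
    using assms(1) unfolding op_tendsto_def by (simp add: tendsto_mult_right_zero)
qed

lemma block_algebra_comp:
  assumes "x \<in> Lss" "op_tendsto (partial_sum \<xi>) x" "y \<in> Lss" "op_tendsto (partial_sum \<eta>) y"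
  shows "op_tendsto (partial_sum (\<xi> * \<eta>)) (x \<circ> y)"
  using op_tendsto_comp[OF assms(2) partial_sum_Lss assms(1,4) partial_sum_Lss assms(3)]
  unfolding partial_sum_comp .

lemma block_algebra_adjoint:
  assumes x: "x \<in> Lss" "op_tendsto (partial_sum \<xi>) x" and \<xi>: "\<xi> \<in> koethe_space a"
  shows "op_tendsto (partial_sum (\<lambda>k. cnj (\<xi> k))) (op_adjoint x)"
proof -
  obtain z where z: "z \<in> Lss" "op_tendsto (partial_sum (\<lambda>k. cnj (\<xi> k))) z"
    using block_series_converges[OF koethe_cnj[OF \<xi>]] .
  have "z = op_adjoint x"
  proof (rule Lss_eqI)
    fix i j
    have "entry (partial_sum (\<lambda>k. cnj (\<xi> k)) n) i j = cnj (entry (partial_sum \<xi> n) j i)" for n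
      by (simp add: entry_op_adjoint flip: partial_sum_adjoint)
    then have "(\<lambda>n. cnj (entry (partial_sum \<xi> n) j i)) \<longlonglongrightarrow> entry z i j"
      using op_tendsto_entry[OF z(2) partial_sum_Lss z(1), of i j] by simp
    moreover have "(\<lambda>n. cnj (entry (partial_sum \<xi> n) j i)) \<longlonglongrightarrow> cnj (entry x j i)"
      by (intro tendsto_cnj op_tendsto_entry x partial_sum_Lss)
    ultimately show "entry z i j = entry (op_adjoint x) i j"
      using x by (simp add: entry_op_adjoint LIMSEQ_unique)
  qed (use x z in auto)
  then show ?thesis using z by simp
qed

text \<open>If \<open>x\<close> is a limit of block series, its eigenvalues form an element of the Koethe space, and
  the difference to the block series of these eigenvalues is controlled by the approximation
  error.\<close>

lemma block_algebra_closed: "closedin (topol L_alg) block_algebra"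
  unfolding L_alg_def star_alg.simps
proof (rule closedin_seminorm_topologyI[OF seminorm_family_Lss])
  show "block_algebra \<subseteq> Lss" by (auto simp: block_algebra_def)
  fix x assume x: "x \<in> Lss"
    and ad: "\<And>p e. p \<in> range op_norm \<Longrightarrow> 0 < e \<Longrightarrow> \<exists>y\<in>block_algebra. p (y - x) < e"
  have approx: "\<exists>y \<eta>. y \<in> Lss \<and> op_tendsto (partial_sum \<eta>) y \<and> op_norm q (y - x) < e" if "0 < e" for q e
    using ad[of "op_norm q" e] that unfolding block_algebra_def by blast
  have "\<exists>c. x \<circ> P k = op_scale c (P k)" for k
  proof -
    obtain i where i: "i \<in> N k" using N_nonempty by blast
    define c where "c = pairing (x (f i)) (f i)"
    have xl2: "x \<xi> \<in> ell2" for \<xi> using x by (simp add: s_subset_ell2)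
    have "x (f j) = seq_scale c (f j)" if j: "j \<in> N k" for j
    proof -
      define d where "d = x (f j) - seq_scale c (f j)"
      have dl2: "d \<in> ell2" unfolding d_def by (intro ell2_diff ell2_scale xl2 f_ell2)
      have "ell2_norm d \<le> e" if e: "0 < e" for e
      proof -
        obtain y \<eta> where y: "y \<in> Lss" "op_tendsto (partial_sum \<eta>) y" "op_norm 0 (y - x) < e / 2"
          using approx[of "e / 2" 0] e by auto
        have yf: "y (f l) = seq_scale (\<eta> k) (f l)" if "l \<in> N k" for l
          using comp_P_f[OF block_series_comp_P[OF y(1,2)] that] .
        have yl2: "(y - x) (f l) \<in> ell2" for l
          using x y by (simp add: s_subset_ell2)
        have nrm: "ell2_norm ((y - x) (f l)) < e / 2" for l
          using op_norm_bound_ell2[of "y - x" "f l" 0] x y by (simp add: s_norm_0 f_norm)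
        have "\<eta> k - c = pairing ((y - x) (f i)) (f i)"
          using x y yf[OF i] xl2
          by (simp add: op_diff_apply pairing_diff_left ell2_scale c_def pairing_scale_left
              ell2_pairing f_orthonormal)
        then have "cmod (\<eta> k - c) \<le> ell2_norm ((y - x) (f i))"
          using ell2_pairing(2)[OF yl2 f_ell2, of i i] by (simp add: f_norm)
        then have c: "cmod (\<eta> k - c) < e / 2" using nrm[of i] by linarith
        have "d = seq_scale (\<eta> k - c) (f j) + seq_scale (-1) ((y - x) (f j))"
          by (simp add: d_def op_diff_apply yf[OF j]) (simp add: fun_eq_iff seq_scale_def pointwise algebra_simps)
        then have "ell2_norm d \<le> cmod (\<eta> k - c) + ell2_norm ((y - x) (f j))"
          using ell2_add(2)[OF ell2_scale(1)[OF f_ell2] ell2_scale(1)[OF yl2], of "\<eta> k - c" j "-1" j]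
          by (simp add: ell2_scale yl2 f_norm)
        then show ?thesis using c nrm[of j] by linarith
      qed
      then have "ell2_norm d \<le> 0" by (rule dense_ge)
      then have "d = 0" using ell2_norm_nonneg[OF dl2] by (intro ell2_norm_eq_0 dl2) linarith
      then show ?thesis by (simp add: d_def)
    qed
    then show ?thesis using comp_P[OF x] by blast
  qed
  then obtain \<xi> where \<xi>: "\<And>k. x \<circ> P k = op_scale (\<xi> k) (P k)" by metis
  have K: "\<xi> \<in> koethe_space a" using eigenvalue_bound[OF x \<xi>] by (intro koethe_spaceI) blast
  obtain z where z: "z \<in> Lss" "op_tendsto (partial_sum \<xi>) z" using block_series_converges[OF K] .
  have "op_norm 0 (x - z) \<le> e" if e: "0 < e" for e
  proof -
    \<comment> \<open>The distance to \<open>z\<close> is at most \<open>1 + basel\<close> times the approximation error.\<close>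
    define e' where "e' = e / (1 + basel)"
    have e': "0 < e'" using e basel_nonneg by (simp add: e'_def)
    obtain y \<eta> where y: "y \<in> Lss" "op_tendsto (partial_sum \<eta>) y" "op_norm 4 (y - x) < e'"
      using approx[OF e', of 4] by auto
    have yx: "y - x \<in> Lss" using y x by simp
    have "(y - x) \<circ> P k = op_scale ((\<eta> - \<xi>) k) (P k)" for k
      unfolding op_diff_comp \<xi> block_series_comp_P[OF y(1,2)]
      by (intro ext) (simp add: op_scale_def seq_scale_def pointwise ring_distribs)
    then have "cmod ((\<eta> - \<xi>) k) * a k (4 * 0 + 4) \<le> op_norm 4 (y - x)" for k
      using eigenvalue_bound[OF yx, of k "(\<eta> - \<xi>) k" 4] by simp
    moreover have "op_tendsto (partial_sum (\<eta> - \<xi>)) (y - z)"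
    proof -
      have "op_tendsto (\<lambda>n. partial_sum \<eta> n + op_scale (-1) (partial_sum \<xi> n)) (y + op_scale (-1) z)"
        using y z by (intro op_tendsto_add op_tendsto_scale) auto
      then show ?thesis by (simp only: op_diff_eq partial_sum_linear)
    qed
    ultimately have "op_norm 0 (y - z) \<le> basel * op_norm 4 (y - x)"
      using y z by (intro block_series_bound) auto
    then have "op_norm 0 (x - z) \<le> op_norm 0 (y - x) + basel * op_norm 4 (y - x)"
      using op_norm_triangle[OF x y(1) z(1), of 0] op_norm_diff_commute[OF x y(1), of 0] by linarith
    also have "\<dots> \<le> (1 + basel) * op_norm 4 (y - x)"
      using op_norm_mono[OF yx, of 0 4] by (simp add: ring_distribs)
    also have "\<dots> \<le> (1 + basel) * e'" using y(3) basel_nonneg by (intro mult_left_mono) auto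
    also have "\<dots> = e" using basel_nonneg by (simp add: e'_def)
    finally show ?thesis .
  qed
  then have "op_norm 0 (x - z) \<le> 0" by (rule dense_ge)
  then have "op_norm 0 (x - z) = 0" using op_norm_nonneg[OF Lss_diff[OF x z(1)], of 0] by linarith
  then have "x - z = 0" by (rule op_norm_0_eq_0[OF Lss_diff[OF x z(1)]])
  then show "x \<in> block_algebra" using z K by (auto simp: block_algebra_def)
qed

lemma block_algebra_subalgebra: "closed_star_subalgebra L_alg block_algebra"
  unfolding closed_star_subalgebra_def
proof (intro conjI ballI allI block_algebra_closed)
  show "block_algebra \<subseteq> carr L_alg" by (auto simp: block_algebra_def L_alg_def)
  have "0 \<in> koethe_space a" by (rule koethe_spaceI) (auto simp: pointwise)
  moreover have "partial_sum 0 = (\<lambda>n. 0)"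
    by (intro ext) (simp add: partial_sum_def op_sum_apply op_scale_def seq_scale_def pointwise)
  ultimately show "0 \<in> block_algebra" by (auto simp: block_algebra_def op_tendsto_const intro!: bexI[of _ 0])
next
  fix x y assume x: "x \<in> block_algebra" and y: "y \<in> block_algebra"
  obtain \<xi> where \<xi>: "x \<in> Lss" "\<xi> \<in> koethe_space a" "op_tendsto (partial_sum \<xi>) x" using x by (rule block_algebraE)
  obtain \<eta> where \<eta>: "y \<in> Lss" "\<eta> \<in> koethe_space a" "op_tendsto (partial_sum \<eta>) y" using y by (rule block_algebraE)
  have "op_tendsto (partial_sum (\<xi> + \<eta>)) (x + y)"
    using op_tendsto_add[OF \<xi>(3) \<eta>(3) partial_sum_Lss partial_sum_Lss \<xi>(1) \<eta>(1)]
    by (simp only: partial_sum_linear)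
  then show "x + y \<in> block_algebra"
    using \<xi> \<eta> koethe_add by (auto simp: block_algebra_def)
  have "x \<circ> y \<in> block_algebra"
    using block_algebra_comp[OF \<xi>(1,3) \<eta>(1,3)] koethe_mult[OF \<xi>(2) \<eta>(2)] \<xi>(1) \<eta>(1)
    by (auto simp: block_algebra_def)
  then show "mul L_alg x y \<in> block_algebra" by (simp add: L_alg_def)
next
  fix c x assume x: "x \<in> block_algebra"
  obtain \<xi> where \<xi>: "x \<in> Lss" "\<xi> \<in> koethe_space a" "op_tendsto (partial_sum \<xi>) x" using x by (rule block_algebraE)
  have "op_tendsto (partial_sum (seq_scale c \<xi>)) (op_scale c x)"
    using op_tendsto_scale[OF \<xi>(3) partial_sum_Lss \<xi>(1)] by (simp only: partial_sum_linear)
  then have "op_scale c x \<in> block_algebra"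
    using \<xi> koethe_scale by (auto simp: block_algebra_def)
  then show "scal L_alg c x \<in> block_algebra" by (simp add: L_alg_def op_scale_def)
next
  fix x assume x: "x \<in> block_algebra"
  obtain \<xi> where \<xi>: "x \<in> Lss" "\<xi> \<in> koethe_space a" "op_tendsto (partial_sum \<xi>) x" using x by (rule block_algebraE)
  have "op_adjoint x \<in> block_algebra"
    using block_algebra_adjoint[OF \<xi>(1,3,2)] koethe_cnj[OF \<xi>(2)] \<xi>(1) by (auto simp: block_algebra_def)
  then show "involution L_alg x \<in> block_algebra" by (simp add: L_alg_def)
qed

lemma block_algebra_commutative: "commutative_in L_alg block_algebra"
  unfolding commutative_in_def
proof (intro ballI)
  fix x y assume x: "x \<in> block_algebra" and y: "y \<in> block_algebra"
  obtain \<xi> where \<xi>: "x \<in> Lss" "\<xi> \<in> koethe_space a" "op_tendsto (partial_sum \<xi>) x" using x by (rule block_algebraE)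
  obtain \<eta> where \<eta>: "y \<in> Lss" "\<eta> \<in> koethe_space a" "op_tendsto (partial_sum \<eta>) y" using y by (rule block_algebraE)
  have "x \<circ> y = y \<circ> x"
    using block_algebra_comp[OF \<xi>(1,3) \<eta>(1,3)] block_algebra_comp[OF \<eta>(1,3) \<xi>(1,3)] \<xi>(1) \<eta>(1)
    by (intro block_algebra_eqI[of _ "\<xi> * \<eta>"]) (auto simp: mult.commute)
  then show "mul L_alg x y = mul L_alg y x" by (simp add: L_alg_def)
qed

lemma P_in_block_algebra: "P k \<in> block_algebra"
proof -
  have "partial_sum (unit_seq k) (n + Suc k) = P k" for n
  proof -
    have "partial_sum (unit_seq k) (n + Suc k) = (\<Sum>l<n + Suc k. if l = k then P k else 0)"
      unfolding partial_sum_def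
      by (rule sum.cong) (auto simp: unit_seq_def fun_eq_iff seq_scale_zero op_zero_apply)
    then show ?thesis by simp
  qed
  then have "op_tendsto (\<lambda>n. partial_sum (unit_seq k) (n + Suc k)) (P k)" by (simp add: op_tendsto_const)
  then have "op_tendsto (partial_sum (unit_seq k)) (P k)" by (simp only: op_tendsto_offset)
  then show ?thesis using koethe_unit_seq by (auto simp: block_algebra_def)
qed

end

interpretation op_space: vector_space op_scale
  by unfold_locales (simp_all add: fun_eq_iff op_scale_def seq_scale_def pointwise algebra_simps)

lemma span_L_alg: "module.span (scal L_alg) B = op_space.span B"
proof -
  have "scal L_alg = op_scale" by (simp add: L_alg_def op_scale_def[abs_def])
  then show ?thesis by simp
qed

lemma (in block_system) P_inj: "inj P"
proof (rule injI, rule ccontr)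
  fix k l assume "P k = P l" "k \<noteq> l"
  then show False using P_comp_P[of k l] P_is_projection[of l] P_neq_0[of l] by simp
qed

lemma (in block_system) P_independent: "op_space.independent (P ` {..<n})"
proof -
  have inj: "inj_on P {..<n}" by (rule inj_on_subset[OF P_inj]) simp
  have fin: "finite (P ` {..<n})" by (intro finite_imageI finite_lessThan)
  have zero: "g x = 0" if 0: "(\<Sum>x\<in>P ` {..<n}. op_scale (g x) x) = 0" and x: "x \<in> P ` {..<n}"
    for g :: "cop \<Rightarrow> complex" and x
  proof -
    obtain k where k: "k < n" "x = P k" using x by blast
    have "partial_sum (\<lambda>l. g (P l)) n = 0"
      using 0 by (simp only: sum.reindex[OF inj] partial_sum_def comp_def)
    then have "op_scale (g (P k)) (P k) = 0"
      using partial_sum_comp_P[of "\<lambda>l. g (P l)" n k] k by simp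
    also have "0 = op_scale 0 (P k)" by (rule ext) (simp add: op_zero_apply seq_scale_zero)
    finally show ?thesis unfolding k(2) by (rule op_scale_P_cancel)
  qed
  show ?thesis unfolding op_space.dependent_finite[OF fin] using zero by blast
qed

lemma (in block_system) P_infinite_dimensional:
  assumes "\<And>k. P k \<in> E" shows "infinite_dimensional_in L_alg E"
proof -
  have False if B: "finite B" "E \<subseteq> op_space.span B" for B
  proof -
    have "P ` {..<Suc (card B)} \<subseteq> op_space.span B"
      by (rule image_subsetI) (rule subsetD[OF B(2) assms])
    from op_space.independent_span_bound[OF B(1) P_independent this]
    have "card (P ` {..<Suc (card B)}) \<le> card B" by (rule conjunct2)
    also have "card (P ` {..<Suc (card B)}) = Suc (card B)"
      by (subst card_image) (auto intro: inj_on_subset[OF P_inj])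
    finally show False by simp
  qed
  then show ?thesis by (auto simp: infinite_dimensional_in_def span_L_alg)
qed

lemma (in block_system) koethe_alg_is_operator_algebra:
  "\<exists>E. inf_dim_closed_comm_star_subalgebra L_alg E \<and>
     star_alg_isomorphic (koethe_alg a) (subalg L_alg E)"
proof (intro exI conjI)
  show "inf_dim_closed_comm_star_subalgebra L_alg block_algebra"
    unfolding inf_dim_closed_comm_star_subalgebra_def
    by (intro conjI block_algebra_subalgebra block_algebra_commutative P_infinite_dimensional P_in_block_algebra)
  interpret closed_subalgebra block_algebra by unfold_locales (rule block_algebra_subalgebra)
  have "\<exists>\<Phi>. star_alg_iso (subalg L_alg block_algebra) (koethe_alg a) \<Phi> \<and> (\<forall>k. \<Phi> (P k) = unit_seq k)"
  proof (rule eigenvalue_isomorphism)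
    show "closed_subalgebra block_algebra" by unfold_locales
    fix x assume x: "x \<in> block_algebra"
    obtain \<xi> where \<xi>: "x \<in> Lss" "\<xi> \<in> koethe_space a" "op_tendsto (partial_sum \<xi>) x" using x by (rule block_algebraE)
    show "\<exists>c. x \<circ> P k = op_scale c (P k)" for k using block_series_comp_P[OF \<xi>(1,3)] by blast
    assume "\<And>k. x \<circ> P k = 0"
    then have "op_scale (\<xi> k) (P k) = op_scale 0 (P k)" for k
      using block_series_comp_P[OF \<xi>(1,3), of k] by (auto simp: fun_eq_iff op_zero_apply seq_scale_zero)
    then have "\<xi> k = 0" for k by (rule op_scale_P_cancel)
    then have "op_norm 0 x \<le> basel * 0" by (intro block_series_bound[OF \<xi>(1,3)]) simp
    then show "x = 0" using \<xi>(1) op_norm_nonneg[OF \<xi>(1), of 0] by (intro op_norm_0_eq_0) auto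
  qed (rule P_in_block_algebra)
  then obtain \<Phi> where "star_alg_iso (subalg L_alg block_algebra) (koethe_alg a) \<Phi>" by blast
  then show "star_alg_isomorphic (koethe_alg a) (subalg L_alg block_algebra)"
  proof (rule star_alg_iso_inverse)
    show "topspace (topol (subalg L_alg block_algebra)) = carr (subalg L_alg block_algebra)"
      using E_Lss by (auto simp: subalg_def L_alg_def topspace_seminorm_topology[OF seminorm_family_Lss])
  qed (use E_add E_comp E_scale E_adjoint in \<open>auto simp: subalg_def L_alg_def op_scale_def\<close>)
qed

section \<open>The canonical basis\<close>

context closed_commutative_subalgebra
begin

lemma canonical_basis_isomorphism:
  assumes data: "orthonormal_block_data f N"
    and basis: "canonical_schauder_basis L_alg E (block_projection f N)"
  shows "\<exists>\<Phi>. star_alg_iso (subalg L_alg E) (koethe_alg (max_norm_matrix f N)) \<Phi> \<and>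
    (\<forall>k. \<Phi> (block_projection f N k) = unit_seq k)"
proof -
  interpret block_system f N by unfold_locales (rule data)
  have range: "range P = minimals"
    using basis by (simp add: canonical_schauder_basis_def bij_betw_def)
  then have min: "P k \<in> minimals" for k by blast
  show ?thesis
  proof (rule eigenvalue_isomorphism)
    show "closed_subalgebra E" by unfold_locales
    show "P k \<in> E" for k using projectionD(1)[OF minimal_projection[OF min]] .
    show "\<exists>c. x \<circ> P k = op_scale c (P k)" if "x \<in> E" for x k by (rule minimal_eigenvalue[OF min that])
    show "x = 0" if "x \<in> E" "\<And>k. x \<circ> P k = 0" for x
    proof (rule minimals_separate[OF that(1)])
      fix Q assume "Q \<in> minimals"
      then obtain k where "Q = P k" unfolding range[symmetric] by blast
      then show "x \<circ> Q = 0" by (simp only: that(2))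
    qed
  qed
qed

text \<open>If there were only finitely many minimal projections, every element of \<open>E\<close> would be the sum of
  its components, because all minimal projections annihilate the difference.\<close>

lemma minimals_infinite:
  assumes "infinite_dimensional_in L_alg E" shows "infinite minimals"
proof
  assume fin: "finite minimals"
  have sub: "minimals \<subseteq> E" using projectionD(1)[OF minimal_projection] by blast
  have "x \<in> op_space.span minimals" if x: "x \<in> E" for x
  proof -
    obtain c where c: "\<And>P. P \<in> minimals \<Longrightarrow> x \<circ> P = op_scale (c P) P"
      using minimal_eigenvalue[OF _ x] by metis
    define z where "z = (\<Sum>P\<in>minimals. op_scale (c P) P)"
    have zE: "z \<in> E" unfolding z_def using sub by (intro E_sum E_scale) auto
    have zP: "z \<circ> P = op_scale (c P) P" if P: "P \<in> minimals" for P
    proof -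
      have "z \<circ> P = (\<Sum>Q\<in>minimals. op_scale (c Q) (Q \<circ> P))"
        by (simp add: z_def op_sum_comp op_scale_comp)
      also have "\<dots> = (\<Sum>Q\<in>minimals. if Q = P then op_scale (c P) P else 0)"
        using P minimals_orthogonal projectionD(4)[OF minimal_projection[OF P]]
        by (intro sum.cong) auto
      finally show ?thesis using fin P by simp
    qed
    have "(x - z) \<circ> P = 0" if "P \<in> minimals" for P
      unfolding op_diff_comp c[OF that] zP[OF that] by simp
    then have "x - z = 0" by (rule minimals_separate[OF E_diff[OF x zE]])
    then have "x = z" by simp
    also have "z \<in> op_space.span minimals"
      unfolding z_def by (intro op_space.span_sum op_space.span_scale op_space.span_base)
    finally show ?thesis .
  qed
  then show False using assms fin sub unfolding infinite_dimensional_in_def span_L_alg by blast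
qed

text \<open>Orthonormal bases of the ranges of all minimal projections form one orthonormal system; it is
  countable because the inverse squares of its first norms are summable.\<close>

lemma canonical_basis_exists:
  assumes inf: "infinite_dimensional_in L_alg E"
  obtains f N where "orthonormal_block_data f N" "canonical_schauder_basis L_alg E (block_projection f N)"
proof -
  have "\<forall>P\<in>minimals. \<exists>F. finite F \<and> F \<subseteq> s_space \<and> orthonormal_on F (\<lambda>f. f) \<and> P = sum rank_one F \<and>
      (\<forall>f\<in>F. P f = f)" (is "\<forall>P\<in>_. \<exists>F. ?basis P F")
  proof
    fix P assume "P \<in> minimals"
    then have P: "P \<in> projections" by (rule minimal_projection)
    show "\<exists>F. ?basis P F"
      by (rule projection_finite_rank[OF projectionD(2,4,5)[OF P]]) blast
  qed
  from bchoice[OF this] obtain F where F': "\<forall>P\<in>minimals. ?basis P (F P)" ..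
  have F: "finite (F P)" "F P \<subseteq> s_space" "orthonormal_on (F P) (\<lambda>f. f)" "sum rank_one (F P) = P"
    "\<And>f. f \<in> F P \<Longrightarrow> P f = f" if "P \<in> minimals" for P
    using bspec[OF F' that] by simp_all
  have Fne: "F P \<noteq> {}" if "P \<in> minimals" for P
    using F(4)[OF that] projectionD(3)[OF minimal_projection[OF that]] by force
  have s: "f \<in> s_space" if "P \<in> minimals" "f \<in> F P" for P f using F(2) that by blast
  have cross: "pairing f g = 0" if PQ: "P \<in> minimals" "Q \<in> minimals" "P \<noteq> Q" and fg: "f \<in> F P" "g \<in> F Q" for P Q f g
  proof -
    note P = projectionD[OF minimal_projection[OF PQ(1)]]
    have "pairing (P f) g = pairing f (P g)"
      using pairing_op_adjoint[OF P(2)] s[OF PQ(1) fg(1)] s[OF PQ(2) fg(2)] P(5) by (simp add: s_subset_ell2)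
    moreover have "P g = (P \<circ> Q) g" using F(5)[OF PQ(2) fg(2)] by simp
    ultimately show ?thesis
      using F(5)[OF PQ(1) fg(1)] minimals_orthogonal[OF PQ] by (simp add: op_zero_apply)
  qed
  have self: "pairing f f = 1" if "P \<in> minimals" "f \<in> F P" for P f
    using F(3)[OF that(1)] that(2) by (simp add: orthonormal_on_def)
  have disj: "P = Q" if "P \<in> minimals" "Q \<in> minimals" "f \<in> F P" "f \<in> F Q" for P Q f
    using cross[OF that(1,2) _ that(3,4)] self[OF that(1,3)] by auto
  define G where "G = (\<Union>P\<in>minimals. F P)"
  have Gs: "f \<in> s_space" if "f \<in> G" for f using that s by (auto simp: G_def)
  have Gorth: "orthonormal_on G (\<lambda>f. f)"
    unfolding orthonormal_on_def
  proof (intro conjI ballI)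
    show "f \<in> ell2" if "f \<in> G" for f using Gs that s_subset_ell2 by blast
    fix f g assume "f \<in> G" "g \<in> G"
    then obtain P Q where PQ: "P \<in> minimals" "f \<in> F P" "Q \<in> minimals" "g \<in> F Q" by (auto simp: G_def)
    show "pairing f g = (if f = g then 1 else 0)"
    proof (cases "P = Q")
      case True
      then show ?thesis using F(3)[OF PQ(1)] PQ by (simp add: orthonormal_on_def)
    next
      case False
      then show ?thesis using cross PQ disj by metis
    qed
  qed
  have Gsub: "orthonormal_on H (\<lambda>f. f)" if "H \<subseteq> G" for H
    using Gorth that unfolding orthonormal_on_def by blast
  have pos: "s_norm 1 f > 0" if "f \<in> G" for f
    using ell2_norm_le_s_norm[OF Gs[OF that], of 1] orthonormal_on_norm[OF Gorth that] by linarith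
  have "countable G"
  proof -
    have "(\<lambda>f. 1 / (s_norm 1 f)\<^sup>2) summable_on G"
    proof (rule nonneg_bdd_above_summable_on)
      have "(\<Sum>f\<in>H. 1 / (s_norm 1 f)\<^sup>2) \<le> basel" if "H \<subseteq> G" "finite H" for H
        using that Gs by (intro orthonormal_inverse_norm_sum Gsub) auto
      then show "bdd_above (sum (\<lambda>f. 1 / (s_norm 1 f)\<^sup>2) ` {H. H \<subseteq> G \<and> finite H})"
        by (intro bdd_aboveI2) auto
    qed simp
    then have "countable {f \<in> G. 1 / (s_norm 1 f)\<^sup>2 \<noteq> 0}" by (rule summable_countable_real)
    also have "{f \<in> G. 1 / (s_norm 1 f)\<^sup>2 \<noteq> 0} = G" using pos by force
    finally show ?thesis .
  qed
  define r where "r P = (SOME f. f \<in> F P)" for P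
  have r: "r P \<in> F P" if "P \<in> minimals" for P unfolding r_def using Fne[OF that] by (simp add: some_in_eq)
  have r_inj: "inj_on r minimals" using r disj by (intro inj_onI) metis
  have rG: "r ` minimals \<subseteq> G" using r by (auto simp: G_def)
  have "countable minimals"
    using countable_subset[OF rG \<open>countable G\<close>] countable_image_inj_on r_inj by blast
  moreover have "infinite minimals" by (rule minimals_infinite[OF inf])
  ultimately have p: "bij_betw (from_nat_into minimals) UNIV minimals" by (rule bij_betw_from_nat_into)
  have "infinite G" using rG r_inj \<open>infinite minimals\<close> finite_imageD finite_subset by metis
  then have e: "bij_betw (from_nat_into G) UNIV G" by (rule bij_betw_from_nat_into[OF \<open>countable G\<close>])
  define p where "p = from_nat_into minimals"
  define f where "f = from_nat_into G"
  define N where "N k = f -` F (p k)" for k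
  have pM: "p k \<in> minimals" for k using p bij_betwE unfolding p_def by blast
  have p_inj: "p k = p l \<Longrightarrow> k = l" for k l using p unfolding p_def by (auto simp: bij_betw_def inj_on_def)
  have f_inj: "inj f" and f_range: "range f = G" using e by (auto simp: f_def bij_betw_def)
  have fN: "bij_betw f (N k) (F (p k))" for k
    unfolding bij_betw_def
  proof
    show "inj_on f (N k)" using f_inj by (rule inj_on_subset) simp
    have "F (p k) \<subseteq> range f" unfolding f_range G_def by (rule UN_upper[OF pM])
    then show "f ` N k = F (p k)" by (simp only: N_def image_vimage_eq Int_absorb2)
  qed
  have data: "orthonormal_block_data f N"
    unfolding orthonormal_block_data_def orthonormal_seq_def
  proof (intro conjI allI)
    show "range f \<subseteq> s_space" using f_range Gs by blast
    show "f i \<in> ell2" for i using f_range Gs s_subset_ell2 by blast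
    show "pairing (f i) (f j) = (if i = j then 1 else 0)" for i j
      using Gorth f_range f_inj unfolding orthonormal_on_def by (metis injD rangeI)
    show "finite (N k)" for k using fN F(1)[OF pM] bij_betw_finite by blast
    show "N k \<noteq> {}" for k using fN[of k] Fne[OF pM, of k] by (auto simp: bij_betw_def)
    show "disjoint_family N"
      unfolding disjoint_family_on_def
    proof (intro ballI impI equals0I)
      fix k l i assume "k \<noteq> l" "i \<in> N k \<inter> N l"
      then have "p k = p l" by (intro disj[OF pM[of k] pM[of l], of "f i"]) (auto simp: N_def)
      then show False using p_inj \<open>k \<noteq> l\<close> by blast
    qed
  qed
  have "block_projection f N k = p k" for k
    using sum.reindex_bij_betw[OF fN[of k], of rank_one] F(4)[OF pM] by (simp add: block_projection_def)
  then have "block_projection f N = p" by blast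
  then have "canonical_schauder_basis L_alg E (block_projection f N)"
    using p by (simp add: canonical_schauder_basis_def p_def)
  with data show ?thesis by (rule that)
qed

end

theorem corollary5p4:
  shows
    "(\<forall>E. inf_dim_closed_comm_star_subalgebra L_alg E \<longrightarrow>
        (\<exists>f N. orthonormal_block_data f N \<and>
           star_alg_isomorphic (subalg L_alg E) (koethe_alg (max_norm_matrix f N))))
     \<and>
     (\<forall>E f N. inf_dim_closed_comm_star_subalgebra L_alg E \<and>
        orthonormal_block_data f N \<and>
        canonical_schauder_basis L_alg E (block_projection f N) \<longrightarrow>
        (\<exists>\<Phi>. star_alg_iso (subalg L_alg E) (koethe_alg (max_norm_matrix f N)) \<Phi> \<and>
           (\<forall>k. \<Phi> (block_projection f N k) = unit_seq k)))
     \<and>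
     (\<forall>f N. orthonormal_block_data f N \<longrightarrow>
        (\<exists>E. inf_dim_closed_comm_star_subalgebra L_alg E \<and>
           star_alg_isomorphic (koethe_alg (max_norm_matrix f N)) (subalg L_alg E)))"
proof (intro conjI allI impI)
  fix E assume E: "inf_dim_closed_comm_star_subalgebra L_alg E"
  interpret closed_commutative_subalgebra E
    using E by unfold_locales (auto simp: inf_dim_closed_comm_star_subalgebra_def)
  have "infinite_dimensional_in L_alg E" using E by (simp add: inf_dim_closed_comm_star_subalgebra_def)
  then obtain f N where "orthonormal_block_data f N" "canonical_schauder_basis L_alg E (block_projection f N)"
    by (rule canonical_basis_exists)
  then show "\<exists>f N. orthonormal_block_data f N \<and>
      star_alg_isomorphic (subalg L_alg E) (koethe_alg (max_norm_matrix f N))"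
    using canonical_basis_isomorphism unfolding star_alg_isomorphic_def by blast
next
  fix E f N
  assume *: "inf_dim_closed_comm_star_subalgebra L_alg E \<and> orthonormal_block_data f N \<and>
    canonical_schauder_basis L_alg E (block_projection f N)"
  interpret closed_commutative_subalgebra E
    using * by unfold_locales (auto simp: inf_dim_closed_comm_star_subalgebra_def)
  show "\<exists>\<Phi>. star_alg_iso (subalg L_alg E) (koethe_alg (max_norm_matrix f N)) \<Phi> \<and>
      (\<forall>k. \<Phi> (block_projection f N k) = unit_seq k)"
    using * by (intro canonical_basis_isomorphism) auto
next
  fix f N assume "orthonormal_block_data f N"
  then interpret block_system f N by unfold_locales
  show "\<exists>E. inf_dim_closed_comm_star_subalgebra L_alg E \<and>
      star_alg_isomorphic (koethe_alg (max_norm_matrix f N)) (subalg L_alg E)"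
    by (rule koethe_alg_is_operator_algebra)
qed

end
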